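(* Let $p$ be an odd prime and let $G$ be a group of order $p^5$ in the isoclinism family $\Phi_5$; that is, $G$ is one of the two groups below. For $\mu\in\mathrm{Irr}(Z(G)|G')$ let $\chi_\mu\in\mathrm{nl}(G)$ be the character with $\chi_\mu(g)=p^2\mu(g)$ for $g\in Z(G)$ and $\chi_\mu(g)=0$ otherwise (these are exactly the non-linear irreducible complex characters of $G$). Then for every $\mu\in\mathrm{Irr}(Z(G)|G')$ the pair $(H,\psi_\mu)$ given below ($\psi_\mu$ being the linear character of $H$ with the given values on generators) is a required pair for $\Omega(\chi_\mu)$. Consequently, if $\Psi_\mu$ is an irreducible rational matrix representation of $H$ affording $\Omega(\psi_\mu)$, the induced representations $\Psi_\mu^G$ are, up to equivalence, all the irreducible rational matrix representations of $G$ whose kernels do not contain $G'$. - $\Phi_5(2111)=\langle\alpha_1,\alpha_2,\alpha_3,\alpha_4,\beta:[\alpha_1,\alpha_2]=[\alpha_3,\alpha_4]=\alpha_1^p=\beta,\ \alpha_2^p=\alpha_3^p=\alpha_4^p=\beta^p=1\rangle$; $Z(G)=G'=\langle\alpha_1^p\rangle$; $H=\langle\alpha_1^p,\alpha_2,\alpha_3\rangle$; $\psi_\mu(\alpha_1^p)=\mu(\alpha_1^p)$, $\psi_\mu(\alpha_2)=\psi_\mu(\alpha_3)=1$. - $\Phi_5(1^5)=\langle\alpha_1,\alpha_2,\alpha_3,\alpha_4,\beta:[\alpha_1,\alpha_2]=[\alpha_3,\alpha_4]=\beta,\ \alpha_1^p=\alpha_2^p=\alpha_3^p=\alpha_4^p=\beta^p=1\rangle$;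 $Z(G)=G'=\langle\beta\rangle$; $H=\langle\alpha_1,\alpha_3,\beta\rangle$; $\psi_\mu(\alpha_1)=\psi_\mu(\alpha_3)=1$, $\psi_\mu(\beta)=\mu(\beta)$.
   Context: For a finite group $G$: $\mathrm{Irr}(G)$ is the set of irreducible complex characters, $\mathrm{lin}(G)$ (resp. $\mathrm{nl}(G)$) the subset of linear (resp. non-linear) ones; for $N\trianglelefteq G$, $\mathrm{Irr}(G|N)=\{\chi\in\mathrm{Irr}(G): N\nsubseteq\ker\chi\}$; $\mathbb{Q}(\chi)$ is the field generated over $\mathbb{Q}$ by the values of $\chi$; $\psi^G$, $\Psi^G$ denote induction to $G$. $\Omega(\chi)=m_{\mathbb{Q}}(\chi)\sum_{\sigma\in\mathrm{Gal}(\mathbb{Q}(\chi)/\mathbb{Q})}\chi^\sigma$, where $m_{\mathbb{Q}}(\chi)$ is the Schur index over $\mathbb{Q}$; it is the character of an irreducible $\mathbb{Q}$-representation. Required pair: for a finite $p$-group $G$ ($p$ odd) and $\chi\in\mathrm{Irr}(G)$, a required pair for (an irreducible rational matrix representation of $G$ affording) $\Omega(\chi)$ is a pair $(H,\psi)$ with $H\le G$, $\psi\in\mathrm{lin}(H)$, $\psi^G=\chi$ and $\mathbb{Q}(\psi)=\mathbb{Q}(\chi)$. $\Phi_5$ is the isoclinism family of extraspecial groups of order $p^5$; its members of order $p^5$ are (R. James) exactly the two groups listed. Presentations are of groups of order $p^5$; $[x,y]=x^{-1}y^{-1}xy$; relations $[x,y]=1$ between generators whose commutator is not listed are omitted. 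*)

theory Defs
  imports
    Complex_Main
    "HOL-Library.FuncSet"
    "HOL-Algebra.Algebra"
    "HOL-Computational_Algebra.Primes"
    "Jordan_Normal_Form.VS_Connect"
begin

abbreviation subgrp :: "('a, 'b) monoid_scheme \<Rightarrow> 'a set \<Rightarrow> ('a, 'b) monoid_scheme" where
  "subgrp G H \<equiv> G\<lparr>carrier := H\<rparr>"

definition center :: "('a, 'b) monoid_scheme \<Rightarrow> 'a set" where
  "center G = {z \<in> carrier G. \<forall>g \<in> carrier G. z \<otimes>\<^bsub>G\<^esub> g = g \<otimes>\<^bsub>G\<^esub> z}"

abbreviation commutator_subgroup :: "('a, 'b) monoid_scheme \<Rightarrow> 'a set" where
  "commutator_subgroup G \<equiv> derived G (carrier G)"

definition commutator :: "('a, 'b) monoid_scheme \<Rightarrow> 'a \<Rightarrow> 'a \<Rightarrow> 'a" where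
  "commutator G x y = inv\<^bsub>G\<^esub> x \<otimes>\<^bsub>G\<^esub> inv\<^bsub>G\<^esub> y \<otimes>\<^bsub>G\<^esub> x \<otimes>\<^bsub>G\<^esub> y"

text \<open>
  The two presentations below are presentations of groups of order \<open>p ^ 5\<close>. A group of order
  \<open>p ^ 5\<close> that is generated by elements satisfying the defining relations is a quotient of the
  presented group of the same finite order, and hence is the presented group. This is how
  presentations are expressed here.
\<close>

definition phi5_commutator_relations ::
    "('a, 'b) monoid_scheme \<Rightarrow> 'a \<Rightarrow> 'a \<Rightarrow> 'a \<Rightarrow> 'a \<Rightarrow> 'a \<Rightarrow> bool" where
  "phi5_commutator_relations G a1 a2 a3 a4 b \<longleftrightarrow>
     commutator G a1 a2 = b \<and> commutator G a3 a4 = b \<and>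
     commutator G a1 a3 = \<one>\<^bsub>G\<^esub> \<and> commutator G a1 a4 = \<one>\<^bsub>G\<^esub> \<and>
     commutator G a2 a3 = \<one>\<^bsub>G\<^esub> \<and> commutator G a2 a4 = \<one>\<^bsub>G\<^esub> \<and>
     commutator G a1 b = \<one>\<^bsub>G\<^esub> \<and> commutator G a2 b = \<one>\<^bsub>G\<^esub> \<and>
     commutator G a3 b = \<one>\<^bsub>G\<^esub> \<and> commutator G a4 b = \<one>\<^bsub>G\<^esub>"

definition Phi5_2111 ::
    "nat \<Rightarrow> ('a, 'b) monoid_scheme \<Rightarrow> 'a \<Rightarrow> 'a \<Rightarrow> 'a \<Rightarrow> 'a \<Rightarrow> 'a \<Rightarrow> bool" where
  "Phi5_2111 p G a1 a2 a3 a4 b \<longleftrightarrow>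
     group G \<and> Coset.order G = p ^ 5 \<and>
     {a1, a2, a3, a4, b} \<subseteq> carrier G \<and> generate G {a1, a2, a3, a4, b} = carrier G \<and>
     phi5_commutator_relations G a1 a2 a3 a4 b \<and>
     a1 [^]\<^bsub>G\<^esub> p = b \<and> a2 [^]\<^bsub>G\<^esub> p = \<one>\<^bsub>G\<^esub> \<and> a3 [^]\<^bsub>G\<^esub> p = \<one>\<^bsub>G\<^esub> \<and>
     a4 [^]\<^bsub>G\<^esub> p = \<one>\<^bsub>G\<^esub> \<and> b [^]\<^bsub>G\<^esub> p = \<one>\<^bsub>G\<^esub>"

definition Phi5_11111 ::
    "nat \<Rightarrow> ('a, 'b) monoid_scheme \<Rightarrow> 'a \<Rightarrow> 'a \<Rightarrow> 'a \<Rightarrow> 'a \<Rightarrow> 'a \<Rightarrow> bool" where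
  "Phi5_11111 p G a1 a2 a3 a4 b \<longleftrightarrow>
     group G \<and> Coset.order G = p ^ 5 \<and>
     {a1, a2, a3, a4, b} \<subseteq> carrier G \<and> generate G {a1, a2, a3, a4, b} = carrier G \<and>
     phi5_commutator_relations G a1 a2 a3 a4 b \<and>
     a1 [^]\<^bsub>G\<^esub> p = \<one>\<^bsub>G\<^esub> \<and> a2 [^]\<^bsub>G\<^esub> p = \<one>\<^bsub>G\<^esub> \<and> a3 [^]\<^bsub>G\<^esub> p = \<one>\<^bsub>G\<^esub> \<and>
     a4 [^]\<^bsub>G\<^esub> p = \<one>\<^bsub>G\<^esub> \<and> b [^]\<^bsub>G\<^esub> p = \<one>\<^bsub>G\<^esub>"

abbreviation GL :: "'k::field itself \<Rightarrow> nat \<Rightarrow> 'k mat monoid" where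
  "GL ty n \<equiv> units_of (ring_mat ty n ())"

definition matrix_rep :: "('a, 'b) monoid_scheme \<Rightarrow> nat \<Rightarrow> ('a \<Rightarrow> 'k::field mat) \<Rightarrow> bool" where
  "matrix_rep G n \<rho> \<longleftrightarrow> \<rho> \<in> hom G (GL TYPE('k) n)"

definition irreducible_rep :: "('a, 'b) monoid_scheme \<Rightarrow> nat \<Rightarrow> ('a \<Rightarrow> 'k::field mat) \<Rightarrow> bool" where
  "irreducible_rep G n \<rho> \<longleftrightarrow>
     matrix_rep G n \<rho> \<and> 0 < n \<and>
     (\<forall>W. subspace class_ring W (module_vec TYPE('k) n) \<and>
          (\<forall>g \<in> carrier G. \<forall>w \<in> W. \<rho> g *\<^sub>v w \<in> W) \<longrightarrow>
          W = {0\<^sub>v n} \<or> W = carrier_vec n)"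

definition equivalent_reps ::
    "('a, 'b) monoid_scheme \<Rightarrow> ('a \<Rightarrow> 'k::field mat) \<Rightarrow> ('a \<Rightarrow> 'k mat) \<Rightarrow> bool" where
  "equivalent_reps G \<rho> \<tau> \<longleftrightarrow> (\<exists>P Q. \<forall>g \<in> carrier G. similar_mat_wit (\<rho> g) (\<tau> g) P Q)"

definition mat_trace :: "'k::comm_monoid_add mat \<Rightarrow> 'k" where
  "mat_trace A = (\<Sum>i < dim_row A. A $$ (i, i))"

text \<open>
  Characters are total functions; they are normalised to vanish outside the carrier, so that
  equality of characters is equality of functions.
\<close>

definition character :: "('a, 'b) monoid_scheme \<Rightarrow> ('a \<Rightarrow> 'k::field mat) \<Rightarrow> 'a \<Rightarrow> 'k" where
  "character G \<rho> g = (if g \<in> carrier G then mat_trace (\<rho> g) else 0)"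

definition Irr :: "('a, 'b) monoid_scheme \<Rightarrow> ('a \<Rightarrow> complex) set" where
  "Irr G = {character G \<rho> | n \<rho>. irreducible_rep G n \<rho>}"

definition lin :: "('a, 'b) monoid_scheme \<Rightarrow> ('a \<Rightarrow> complex) set" where
  "lin G = {\<chi> \<in> Irr G. \<chi> \<one>\<^bsub>G\<^esub> = 1}"

definition nl :: "('a, 'b) monoid_scheme \<Rightarrow> ('a \<Rightarrow> complex) set" where
  "nl G = {\<chi> \<in> Irr G. \<chi> \<one>\<^bsub>G\<^esub> \<noteq> 1}"

definition char_kernel :: "('a, 'b) monoid_scheme \<Rightarrow> ('a \<Rightarrow> complex) \<Rightarrow> 'a set" where
  "char_kernel G \<chi> = {g \<in> carrier G. \<chi> g = \<chi> \<one>\<^bsub>G\<^esub>}"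

definition Irr_over :: "('a, 'b) monoid_scheme \<Rightarrow> 'a set \<Rightarrow> ('a \<Rightarrow> complex) set" where
  "Irr_over G N = {\<chi> \<in> Irr G. \<not> N \<subseteq> char_kernel G \<chi>}"

definition induced_char ::
    "('a, 'b) monoid_scheme \<Rightarrow> 'a set \<Rightarrow> ('a \<Rightarrow> complex) \<Rightarrow> 'a \<Rightarrow> complex" where
  "induced_char G H \<psi> g =
     (if g \<in> carrier G
      then (\<Sum>x \<in> carrier G. let y = x \<otimes>\<^bsub>G\<^esub> g \<otimes>\<^bsub>G\<^esub> inv\<^bsub>G\<^esub> x in if y \<in> H then \<psi> y else 0)
             / of_nat (card H)
      else 0)"

text \<open>The subfield of \<open>\<complex>\<close> generated by a set automatically contains \<open>\<rat>\<close>.\<close>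

definition field_of_values :: "('a, 'b) monoid_scheme \<Rightarrow> ('a \<Rightarrow> complex) \<Rightarrow> complex set" where
  "field_of_values G \<chi> = generate_field class_ring (\<chi> ` carrier G)"

text \<open>
  Automorphisms of the subfield \<open>F\<close> of \<open>\<complex>\<close> over \<open>\<rat>\<close>. Being a set of
  total functions, they are made extensional so that an automorphism of \<open>F\<close> is counted once.
\<close>

definition Gal_over_rat :: "complex set \<Rightarrow> (complex \<Rightarrow> complex) set" where
  "Gal_over_rat F =
     {\<sigma> \<in> extensional F.
        \<sigma> \<in> ring_iso (class_ring\<lparr>carrier := F\<rparr>) (class_ring\<lparr>carrier := F\<rparr>) \<and>
        (\<forall>q \<in> \<rat>. \<sigma> q = q)}"

text \<open>
  The Schur index over \<open>\<rat>\<close>: the least \<open>m > 0\<close> such that \<open>m \<chi>\<close> is afforded by a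
  matrix representation with entries in \<open>\<rat>(\<chi>)\<close>.
\<close>

definition schur_index :: "('a, 'b) monoid_scheme \<Rightarrow> ('a \<Rightarrow> complex) \<Rightarrow> nat" where
  "schur_index G \<chi> =
     (LEAST m. 0 < m \<and>
        (\<exists>n \<rho>. matrix_rep G n \<rho> \<and>
           (\<forall>g \<in> carrier G. elements_mat (\<rho> g) \<subseteq> field_of_values G \<chi>) \<and>
           (\<forall>g \<in> carrier G. character G \<rho> g = of_nat m * \<chi> g)))"

definition Omega :: "('a, 'b) monoid_scheme \<Rightarrow> ('a \<Rightarrow> complex) \<Rightarrow> 'a \<Rightarrow> complex" where
  "Omega G \<chi> g =
     of_nat (schur_index G \<chi>) * (\<Sum>\<sigma> \<in> Gal_over_rat (field_of_values G \<chi>). \<sigma> (\<chi> g))"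

definition affords_over_rat ::
    "('a, 'b) monoid_scheme \<Rightarrow> ('a \<Rightarrow> rat mat) \<Rightarrow> ('a \<Rightarrow> complex) \<Rightarrow> bool" where
  "affords_over_rat G \<rho> \<theta> \<longleftrightarrow> (\<forall>g \<in> carrier G. of_rat (character G \<rho> g) = \<theta> g)"

definition irr_rat_rep_affording ::
    "('a, 'b) monoid_scheme \<Rightarrow> nat \<Rightarrow> ('a \<Rightarrow> rat mat) \<Rightarrow> ('a \<Rightarrow> complex) \<Rightarrow> bool" where
  "irr_rat_rep_affording G n \<rho> \<theta> \<longleftrightarrow> irreducible_rep G n \<rho> \<and> affords_over_rat G \<rho> \<theta>"

definition rep_kernel :: "('a, 'b) monoid_scheme \<Rightarrow> nat \<Rightarrow> ('a \<Rightarrow> 'k::field mat) \<Rightarrow> 'a set" where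
  "rep_kernel G n \<rho> = kernel G (GL TYPE('k) n) \<rho>"

definition left_transversal :: "('a, 'b) monoid_scheme \<Rightarrow> 'a set \<Rightarrow> 'a list \<Rightarrow> bool" where
  "left_transversal G H ts \<longleftrightarrow>
     set ts \<subseteq> carrier G \<and>
     bij_betw (\<lambda>i. (ts ! i) <#\<^bsub>G\<^esub> H) {..<length ts} (lcosets\<^bsub>G\<^esub> H)"

text \<open>
  For a representation \<open>\<Psi>\<close> of \<open>H\<close> of degree \<open>n\<close>, the matrix of \<open>g\<close> in the induced
  representation has the \<open>n \<times> n\<close> block \<open>\<Psi> (t\<^sub>i\<inverse> g t\<^sub>j)\<close>, or
  zero if that element is not in \<open>H\<close>, at block position \<open>(i, j)\<close>.
\<close>

definition induced_rep ::
    "('a, 'b) monoid_scheme \<Rightarrow> 'a set \<Rightarrow> 'a list \<Rightarrow> nat \<Rightarrow> ('a \<Rightarrow> 'k::field mat) \<Rightarrow> 'a \<Rightarrow> 'k mat" where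
  "induced_rep G H ts n \<Psi> g =
     mat (length ts * n) (length ts * n)
       (\<lambda>(r, c). let y = inv\<^bsub>G\<^esub> (ts ! (r div n)) \<otimes>\<^bsub>G\<^esub> g \<otimes>\<^bsub>G\<^esub> (ts ! (c div n))
                 in if y \<in> H then \<Psi> y $$ (r mod n, c mod n) else 0)"

definition required_pair ::
    "('a, 'b) monoid_scheme \<Rightarrow> ('a \<Rightarrow> complex) \<Rightarrow> 'a set \<Rightarrow> ('a \<Rightarrow> complex) \<Rightarrow> bool" where
  "required_pair G \<chi> H \<psi> \<longleftrightarrow>
     \<chi> \<in> Irr G \<and> subgroup H G \<and> \<psi> \<in> lin (subgrp G H) \<and>
     induced_char G H \<psi> = \<chi> \<and>
     field_of_values (subgrp G H) \<psi> = field_of_values G \<chi>"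

definition chi_of :: "nat \<Rightarrow> ('a, 'b) monoid_scheme \<Rightarrow> ('a \<Rightarrow> complex) \<Rightarrow> 'a \<Rightarrow> complex" where
  "chi_of p G \<mu> g = (if g \<in> center G then of_nat (p ^ 2) * \<mu> g else 0)"

end

theory Submission
  imports
    Defs
    "Jordan_Normal_Form.Spectral_Radius"
    "HOL-Computational_Algebra.Field_as_Ring"
begin

text \<open>
  Write \<open>Z = Z(G) = G'\<close>, a group of order \<open>p\<close>, and \<open>H = K Z\<close> with \<open>K\<close> of order \<open>p\<^sup>2\<close>, \<open>K \<inter> Z = 1\<close> and
  \<open>C\<^sub>G(K) = H\<close> abelian. For a representation \<open>\<Psi>\<close> of \<open>H\<close>, over any field of characteristic \<open>0\<close>, that is
  trivial on \<open>K\<close> and satisfies \<open>\<Sum>\<^sub>c \<Psi>(c) = 0\<close> over \<open>c \<in> Z\<close>, the element \<open>\<Sum>\<^sub>k t k t\<inverse>\<close> over \<open>k \<in> K\<close> acts on the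
  induced representation as \<open>|K|\<close> times the projection to the block of the coset \<open>t H\<close>: on any other block
  it acts by an operator fixed under multiplication by some \<open>\<Psi>(c)\<close>, \<open>c \<noteq> 1\<close> in \<open>Z\<close>, hence by \<open>0\<close>. So the
  induced representation is irreducible if \<open>\<Psi>\<close> is. Over \<open>\<complex>\<close> this produces the characters \<open>\<chi>\<^sub>\<mu>\<close>; over \<open>\<rat>\<close>, the
  representations \<open>\<Psi>\<^sub>\<mu>\<^sup>G\<close>.

  Conversely, an irreducible \<open>\<rho>\<close> that is nontrivial on \<open>Z\<close> satisfies \<open>\<Sum>\<^sub>c \<rho>(c) = 0\<close>, so its character vanishes
  off \<open>Z\<close>, and the scalar product of its character with that of the induced representation is visibly
  nonzero; by Schur orthogonality the two are equivalent. Irreducibility of \<open>1 + X + \<dots> + X\<^bsup>p - 1\<^esup>\<close>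
  over \<open>\<rat>\<close> (Eisenstein) enters through the Galois sum defining \<open>\<Omega>(\<psi>)\<close> and the rational
  representation of \<open>H\<close> on \<open>\<rat>(\<zeta>)\<close>.
\<close>

section \<open>Prime cyclotomic fields\<close>

text \<open>Over Q a central element need not act by a scalar, so nontriviality on the center is
  never expressed by a central character there. Its substitute is the vanishing of
  \<open>msum n n \<rho> Z\<close>, which makes sense over every field and passes from
  \<open>H\<close> to induced representations. The center has prime order, so an identity
  \<open>A * \<rho> c = A\<close> at one nontrivial \<open>c\<close> spreads to all of the center,
  and summing kills \<open>A\<close>; this replaces the usual comparison of scalars. Over Q there is
  only one class of irreducible representations that are nontrivial on the center: the Galois group
  permutes the \<open>p - 1\<close> nontrivial characters of \<open>Z\<close> transitively, and
  \<open>\<Psi>\<close> has trace \<open>p - 1\<close> at the identity and \<open>- 1\<close> at the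
  other central elements, whichever \<open>\<mu>\<close> is chosen. Hence all induced rational
  representations are equivalent, and exhaustion may be shown with any single \<open>\<mu>\<close>.
  Both groups are handled at once by generators paired as in a Heisenberg group: \<open>x\<close>
  with \<open>u\<close>, \<open>y\<close> with \<open>v\<close>, where \<open>x\<close> and
  \<open>y\<close> generate \<open>K\<close>. A generator of order \<open>p ^ 2\<close> is harmless
  on the other side, since its \<open>p\<close>-th power only adds to the exponent of
  \<open>z\<close>.\<close>

lemma eisenstein_aux:
  fixes F G :: "int poly" and q :: int
  assumes q: "prime_elem q" and G0: "\<not> q dvd poly.coeff G 0"
    and lead: "\<not> q dvd Polynomial.lead_coeff F"
    and low: "\<And>i. i < n \<Longrightarrow> q dvd poly.coeff (F * G) i"
  shows "n \<le> Polynomial.degree F"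
proof -
  \<comment> \<open>\<open>r\<close> is the first index at which the coefficient of \<open>F\<close>
    is not divisible by \<open>q\<close>. Modulo \<open>q\<close> the coefficient of
    \<open>F * G\<close> at \<open>r\<close> is that of \<open>F\<close> at \<open>r\<close> times
    the constant term of \<open>G\<close>, hence nonzero; so \<open>r\<close> is not below
    \<open>n\<close>, yet it is at most the degree of \<open>F\<close>.\<close>
  define r where "r = (LEAST i. \<not> q dvd poly.coeff F i)"
  have r: "\<not> q dvd poly.coeff F r" unfolding r_def by (rule LeastI[of _ "Polynomial.degree F"]) (use lead in simp)
  have less: "q dvd poly.coeff F i" if "i < r" for i
    using not_less_Least that unfolding r_def by blast
  have le: "r \<le> Polynomial.degree F" unfolding r_def by (rule Least_le) (use lead in simp)
  have "\<not> r < n"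
  proof
    assume "r < n"
    have "poly.coeff (F * G) r = (\<Sum>i\<le>r. poly.coeff F i * poly.coeff G (r - i))"
      by (simp add: coeff_mult)
    also have "{..r} = insert r {..<r}" by auto
    also have "(\<Sum>i\<in>insert r {..<r}. poly.coeff F i * poly.coeff G (r - i)) =
        poly.coeff F r * poly.coeff G 0 + (\<Sum>i<r. poly.coeff F i * poly.coeff G (r - i))"
      by simp
    finally have eq: "poly.coeff F r * poly.coeff G 0 =
        poly.coeff (F * G) r - (\<Sum>i<r. poly.coeff F i * poly.coeff G (r - i))" by simp
    have "q dvd poly.coeff F r * poly.coeff G 0" unfolding eq
      by (intro dvd_diff low \<open>r < n\<close> dvd_sum dvd_mult2 less) auto
    then show False using q r G0 by (simp add: prime_elem_dvd_mult_iff)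
  qed
  then show ?thesis using le by simp
qed

text \<open>As \<open>q ^ 2\<close> does not divide the constant term of the product, exactly one
  factor has constant term divisible by \<open>q\<close>. By \<open>eisenstein_aux\<close> that
  factor has the full degree of the product. Only degrees are concluded, because a constant integer
  factor need not be a unit.\<close>

lemma eisenstein:
  fixes F G :: "int poly" and q :: int
  assumes q: "prime_elem q"
    and lead: "\<not> q dvd Polynomial.lead_coeff (F * G)"
    and low: "\<And>i. i < Polynomial.degree (F * G) \<Longrightarrow> q dvd poly.coeff (F * G) i"
    and const: "\<not> q ^ 2 dvd poly.coeff (F * G) 0"
  shows "Polynomial.degree F = 0 \<or> Polynomial.degree G = 0"
proof (rule ccontr)
  assume "\<not> ?thesis"
  then have pos: "Polynomial.degree F > 0" "Polynomial.degree G > 0" by auto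
  then have deg: "Polynomial.degree (F * G) = Polynomial.degree F + Polynomial.degree G"
    by (intro degree_mult_eq) auto
  have lF: "\<not> q dvd Polynomial.lead_coeff F" and lG: "\<not> q dvd Polynomial.lead_coeff G"
    using lead by (auto simp: lead_coeff_mult)
  have c0: "poly.coeff (F * G) 0 = poly.coeff F 0 * poly.coeff G 0" by (simp add: coeff_mult)
  have "q dvd poly.coeff F 0 * poly.coeff G 0" using low[of 0] deg pos c0 by simp
  then consider "q dvd poly.coeff F 0" | "q dvd poly.coeff G 0"
    using q by (auto simp: prime_elem_dvd_mult_iff)
  then show False
  proof cases
    case 1
    then have "\<not> q dvd poly.coeff G 0"
      using const c0 mult_dvd_mono[of q _ q] by (auto simp: power2_eq_square)
    from eisenstein_aux[OF q this lF, of "Polynomial.degree (F * G)"] low deg pos show False by simp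
  next
    case 2
    then have "\<not> q dvd poly.coeff F 0"
      using const c0 mult_dvd_mono[of q _ q] by (auto simp: power2_eq_square)
    from eisenstein_aux[OF q this lG, of "Polynomial.degree (F * G)"] low deg pos show False
      by (simp add: mult.commute)
  qed
qed

text \<open>For prime \<open>p\<close> this is the \<open>p\<close>-th cyclotomic polynomial. It is
  polymorphic in the coefficients: Eisenstein is applied over the integers, remainders and gcds are
  taken over the rationals.\<close>

abbreviation (input) geom :: "nat \<Rightarrow> 'a::comm_ring_1 poly" where
  "geom p \<equiv> (\<Sum>i<p. Polynomial.monom 1 i)"

lemma coeff_geom: "poly.coeff (geom p :: 'a::comm_ring_1 poly) i = (if i < p then 1 else 0)"
  by (simp add: coeff_sum coeff_monom)

lemma degree_geom: "p > 0 \<Longrightarrow> Polynomial.degree (geom p :: 'a::comm_ring_1 poly) = p - 1"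
  by (intro antisym degree_le le_degree) (auto simp: coeff_geom)

lemma pcompose_monom_1: "pcompose (Polynomial.monom 1 i) q = (q :: 'a::comm_semiring_1 poly) ^ i"
  by (induction i) (simp_all add: monom_0 monom_Suc pcompose_pCons one_pCons)

text \<open>Multiplying by X turns the shifted geometric sum into (X + 1)^p - 1, whose coefficients
  are binomial; this factor X causes the index shift.\<close>

lemma coeff_geom_shift: "poly.coeff (pcompose (geom p) [:1, 1:] :: int poly) i = int (p choose Suc i)"
proof -
  have "pcompose (geom p) [:1, 1:] = (\<Sum>i<p. [:1, 1::int:] ^ i)"
    by (simp add: pcompose_sum pcompose_monom_1)
  then have "[:0, 1:] * pcompose (geom p) [:1, 1:] = [:1, 1::int:] ^ p - 1"
    using power_diff_1_eq[of "[:1, 1::int:]" p] by (simp add: one_pCons)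
  then have "poly.coeff ([:0, 1:] * pcompose (geom p) [:1, 1::int:]) (Suc i) = poly.coeff ([:1, 1::int:] ^ p) (Suc i)"
    by simp
  also have "\<dots> = int (p choose Suc i)"
    by (cases "Suc i \<le> p") (simp_all add: coeff_linear_poly_power coeff_eq_0 degree_linear_power)
  finally show ?thesis by simp
qed
text \<open>Substituting X + 1 for X preserves degrees and makes Eisenstein applicable at
  \<open>p\<close>: the leading coefficient is 1, the constant one is \<open>p\<close>, and
  \<open>p\<close> divides the binomials in between.\<close>

lemma geom_factor:
  fixes F G :: "int poly"
  assumes p: "Factorial_Ring.prime p" and FG: "geom p = F * G"
  shows "Polynomial.degree F = 0 \<or> Polynomial.degree G = 0"
proof -
  have p1: "p > 1" using p by (rule prime_gt_1_nat)
  let ?c = "\<lambda>F :: int poly. pcompose F [:1, 1:]"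
  have eq: "?c F * ?c G = ?c (geom p)" by (simp add: FG pcompose_mult)
  have deg: "Polynomial.degree (?c (geom p)) = p - 1"
    using p1 by (simp add: degree_pcompose degree_geom)
  have "Polynomial.degree (?c F) = 0 \<or> Polynomial.degree (?c G) = 0"
  proof (rule eisenstein[of "int p"], unfold eq deg coeff_geom_shift)
    show "prime_elem (int p)" using p by simp
    show "\<not> int p dvd int (p choose Suc (p - 1))" using p1 by simp
    show "\<And>i. i < p - 1 \<Longrightarrow> int p dvd int (p choose Suc i)"
      using p by (simp add: dvd_choose_prime)
    show "\<not> (int p)\<^sup>2 dvd int (p choose Suc 0)"
      using p1 by (auto simp: power2_eq_square zdvd_not_zless simp flip: of_nat_mult dest: dvd_imp_le)
  qed
  then show ?thesis by (simp add: degree_pcompose)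
qed

lemma sum_powers_root: "w ^ p = 1 \<Longrightarrow> w \<noteq> 1 \<Longrightarrow> (\<Sum>i<p. w ^ i) = (0 :: complex)"
  using power_diff_1_eq[of w p] by (metis diff_self mult_eq_0_iff right_minus_eq)

text \<open>An integer polynomial of least degree vanishing at \<open>w\<close> has a primitive part
  that divides \<open>geom p\<close> over the integers, so by \<open>geom_factor\<close> its degree
  is \<open>p - 1\<close>. Pseudo-division keeps everything integral although the leading
  coefficient need not be a unit.\<close>

lemma int_poly_root_of_unity_degree:
  fixes w :: complex and f :: "int poly"
  assumes p: "Factorial_Ring.prime p" and w: "w ^ p = 1" "w \<noteq> 1"
    and f: "f \<noteq> 0" "poly (of_int_poly f) w = 0"
  shows "p - 1 \<le> Polynomial.degree f"
proof -
  have p1: "p > 1" using p by (rule prime_gt_1_nat)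
  let ?K = "\<lambda>f :: int poly. f \<noteq> 0 \<and> poly (of_int_poly f) w = 0"
  obtain m where m: "?K m" and min: "\<And>g. ?K g \<Longrightarrow> Polynomial.degree m \<le> Polynomial.degree g"
    using ex_has_least_nat[of ?K f Polynomial.degree] f by blast
  define g where "g = primitive_part m"
  have mg: "m = Polynomial.smult (content m) g" by (simp add: g_def)
  have cont: "content g = 1" using m by (simp add: g_def)
  have g: "?K g"
  proof -
    have "poly (of_int_poly m) w = of_int (content m) * poly (of_int_poly g) w"
      by (subst mg) (simp add: hom_distribs)
    then show ?thesis using m by (auto simp: g_def)
  qed
  have deg: "Polynomial.degree g = Polynomial.degree m" using m by (simp add: g_def)
  obtain Q R where QR: "pseudo_divmod (geom p) g = (Q, R)" by force
  \<comment> \<open>The power of the leading coefficient by which \<open>pseudo_divmod\<close>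
    scales the dividend.\<close>
  define c where "c = Polynomial.lead_coeff g ^ (Suc (Polynomial.degree (geom p :: int poly)) - Polynomial.degree g)"
  have c0: "c \<noteq> 0" using g by (simp add: c_def)
  from pseudo_divmod[OF _ QR] g have eq: "Polynomial.smult c (geom p) = g * Q + R"
    and Rdeg: "R = 0 \<or> Polynomial.degree R < Polynomial.degree g" by (auto simp: c_def)
  have geom0: "poly (of_int_poly (geom p)) w = 0"
    using sum_powers_root[OF w] by (simp add: hom_distribs poly_sum poly_monom)
  have "R = 0"
  proof (rule ccontr)
    assume R: "R \<noteq> 0"
    define E :: "int poly" where "E = geom p"
    from arg_cong[OF eq[folded E_def], of "\<lambda>f. poly (of_int_poly f) w"] g geom0[folded E_def]
    have "poly (of_int_poly R) w = 0" by (simp add: hom_distribs)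
    from min[of R] this R Rdeg deg show False by auto
  qed
  with eq have eq: "Polynomial.smult c (geom p) = g * Q" by simp
  \<comment> \<open>Gauss: contents multiply, and both \<open>geom p\<close> and \<open>g\<close>
    have content 1. So the content of \<open>Q\<close> is the absolute value of \<open>c\<close>,
    and \<open>c\<close> cancels up to its sign.\<close>
  have "content (geom p :: int poly) dvd 1"
    using content_dvd_coeff[of "geom p :: int poly" 0] p1 by (simp add: coeff_geom)
  then have "content (geom p :: int poly) = 1" by (metis normalize_content is_unit_normalize)
  with arg_cong[OF eq, of content] have cQ: "content Q = \<bar>c\<bar>"
    by (simp add: content_mult cont content_smult)
  have "Polynomial.smult c (geom p) = Polynomial.smult c (g * Polynomial.smult (sgn c) (primitive_part Q))"
  proof -
    have "Polynomial.smult c (geom p) = g * Polynomial.smult \<bar>c\<bar> (primitive_part Q)"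
      using eq content_times_primitive_part[of Q] cQ by simp
    then show ?thesis by (simp add: abs_sgn)
  qed
  then have fac: "geom p = g * Polynomial.smult (sgn c) (primitive_part Q)"
    using c0 smult_cancel by blast
  have "Polynomial.degree g \<noteq> 0"
  proof
    assume "Polynomial.degree g = 0"
    then obtain a where "g = [:a:]" by (rule degree_eq_zeroE)
    with g show False by (auto simp: map_poly_pCons)
  qed
  with geom_factor[OF p fac] have "Polynomial.degree (Polynomial.smult (sgn c) (primitive_part Q)) = 0" by simp
  moreover have "Polynomial.degree (geom p :: int poly) = Polynomial.degree g + Polynomial.degree (Polynomial.smult (sgn c) (primitive_part Q))"
  proof -
    have "(geom p :: int poly) \<noteq> 0" using coeff_geom[of p 0, where 'a=int] p1 by auto
    then show ?thesis unfolding fac by (intro degree_mult_eq) auto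
  qed
  ultimately have "Polynomial.degree g = p - 1" using p1 by (simp add: degree_geom)
  then show ?thesis using deg min[of f] f by simp
qed

lemma rat_poly_clear_denominators:
  "\<exists>d g. d \<noteq> 0 \<and> Polynomial.smult (of_int d) (f :: rat poly) = of_int_poly g"
proof (induction f rule: pCons_induct)
  case 0
  show "\<exists>d g. d \<noteq> 0 \<and> Polynomial.smult (of_int d) (0 :: rat poly) = of_int_poly g"
    by (intro exI[of _ 1] exI[of _ 0]) simp
next
  case (pCons a f)
  then obtain d g where d: "d \<noteq> 0" and g: "Polynomial.smult (of_int d) f = of_int_poly g" by blast
  obtain n e where ne: "quotient_of a = (n, e)" by force
  have e: "e > 0" "a = of_int n / of_int e"
    using quotient_of_denom_pos[OF ne] quotient_of_div[OF ne] by auto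
  have "Polynomial.smult (of_int (d * e)) (pCons a f) = of_int_poly (pCons (n * d) (Polynomial.smult e g))"
    using e by (simp add: hom_distribs g[symmetric] mult.commute)
  then show "\<exists>d g. d \<noteq> 0 \<and> Polynomial.smult (of_int d) (pCons a f) = of_int_poly g"
    using d e by (intro exI[of _ "d * e"] exI[of _ "pCons (n * d) (Polynomial.smult e g)"]) simp
qed

section \<open>Evaluation of rational polynomials and the ring Q[w]\<close>

definition eval_rat :: "rat poly \<Rightarrow> complex \<Rightarrow> complex" where
  "eval_rat f x = poly (map_poly of_rat f) x"

lemma eval_rat_simps:
  "eval_rat 0 w = 0" "eval_rat 1 w = 1" "eval_rat (pCons a f) w = of_rat a + w * eval_rat f w"
  "eval_rat (f + g) w = eval_rat f w + eval_rat g w"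
  "eval_rat (f * g) w = eval_rat f w * eval_rat g w"
  "eval_rat (- f) w = - eval_rat f w"
proof -
  interpret h: map_poly_comm_ring_hom "of_rat :: rat \<Rightarrow> complex" ..
  show "eval_rat 0 w = 0" "eval_rat 1 w = 1" "eval_rat (pCons a f) w = of_rat a + w * eval_rat f w"
    "eval_rat (f + g) w = eval_rat f w + eval_rat g w"
    "eval_rat (f * g) w = eval_rat f w * eval_rat g w"
    "eval_rat (- f) w = - eval_rat f w"
    by (cases "a = 0 \<and> f = 0"; auto simp: eval_rat_def h.hom_mult h.hom_add h.hom_uminus map_poly_pCons)+
qed

lemma eval_rat_sum: "eval_rat (sum f A) w = (\<Sum>i\<in>A. eval_rat (f i) w)"
  by (induction A rule: infinite_finite_induct) (simp_all add: eval_rat_simps)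

lemma eval_rat_monom: "eval_rat (Polynomial.monom 1 i) w = w ^ i"
  by (induction i) (simp_all add: monom_0 monom_Suc eval_rat_simps)

lemma eval_rat_geom: "eval_rat (geom p) w = (\<Sum>i<p. w ^ i)"
  by (simp add: eval_rat_sum eval_rat_monom)

lemma eval_rat_smult: "eval_rat (Polynomial.smult c f) w = of_rat c * eval_rat f w"
  by (induction f) (simp_all add: eval_rat_simps algebra_simps of_rat_mult)

lemma rat_poly_root_of_unity_degree:
  fixes w :: complex and f :: "rat poly"
  assumes p: "Factorial_Ring.prime p" and w: "w ^ p = 1" "w \<noteq> 1"
    and f: "f \<noteq> 0" "eval_rat f w = 0"
  shows "p - 1 \<le> Polynomial.degree f"
proof -
  obtain d g where d: "d \<noteq> 0" and g: "Polynomial.smult (of_int d) f = of_int_poly g"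
    using rat_poly_clear_denominators by blast
  have "of_int d * eval_rat f w = poly (of_int_poly g) w"
    using arg_cong[OF g, of "\<lambda>f. eval_rat f w"] by (simp add: eval_rat_smult) (simp add: eval_rat_def map_poly_map_poly o_def)
  then have "poly (of_int_poly g) w = 0" using f by simp
  moreover have "g \<noteq> 0" using g d f by auto
  moreover have "Polynomial.degree g = Polynomial.degree f"
    using arg_cong[OF g, of Polynomial.degree] d by (simp add: degree_smult_eq)
  ultimately show ?thesis using int_poly_root_of_unity_degree[OF p w, of g] by simp
qed

text \<open>This is the ring Q[w], for any complex \<open>w\<close>. For a nontrivial root of unity
  of prime order it is a field, by \<open>cyc_inverse\<close>.\<close>

definition cyc :: "complex \<Rightarrow> complex set" where
  "cyc w = range (\<lambda>f. eval_rat f w)"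

lemma
  shows cyc_of_rat: "of_rat q \<in> cyc w"
    and cyc_self: "w \<in> cyc w"
    and cyc_add: "x \<in> cyc w \<Longrightarrow> y \<in> cyc w \<Longrightarrow> x + y \<in> cyc w"
    and cyc_mult: "x \<in> cyc w \<Longrightarrow> y \<in> cyc w \<Longrightarrow> x * y \<in> cyc w"
    and cyc_uminus: "x \<in> cyc w \<Longrightarrow> - x \<in> cyc w"
proof -
  have *: "eval_rat f w \<in> cyc w" for f by (simp add: cyc_def)
  show "of_rat q \<in> cyc w" using *[of "[:q:]"] by (simp add: eval_rat_simps)
  show "w \<in> cyc w" using *[of "[:0, 1:]"] by (simp add: eval_rat_simps)
  show "x \<in> cyc w \<Longrightarrow> y \<in> cyc w \<Longrightarrow> x + y \<in> cyc w"
    by (auto simp: cyc_def image_iff simp flip: eval_rat_simps)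
  show "x \<in> cyc w \<Longrightarrow> y \<in> cyc w \<Longrightarrow> x * y \<in> cyc w"
    by (auto simp: cyc_def image_iff simp flip: eval_rat_simps)
  show "x \<in> cyc w \<Longrightarrow> - x \<in> cyc w"
    by (auto simp: cyc_def image_iff simp flip: eval_rat_simps)
qed

lemma cyc_1: "1 \<in> cyc w" using cyc_of_rat[of 1] by simp

lemma cyc_power: "x \<in> cyc w \<Longrightarrow> x ^ k \<in> cyc w"
  by (induction k) (auto intro: cyc_1 cyc_mult)

lemma cyc_eval_rat: "x \<in> cyc w \<Longrightarrow> eval_rat f x \<in> cyc w"
proof (induction f)
  case 0
  then show ?case using cyc_of_rat[of 0] by (simp add: eval_rat_simps)
next
  case (pCons a f)
  then show ?case unfolding eval_rat_simps by (intro cyc_add cyc_mult cyc_of_rat) auto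
qed

lemma cyc_subset: "x \<in> cyc w \<Longrightarrow> cyc x \<subseteq> cyc w"
  using cyc_eval_rat by (auto simp: cyc_def)

text \<open>A subfield contains 1, hence all integers and their quotients, so it is closed under
  evaluating rational polynomials.\<close>

lemma generate_field_cyc_subset:
  assumes w: "w \<in> generate_field class_ring S"
  shows "cyc w \<subseteq> generate_field class_ring S"
proof -
  let ?F = "generate_field (class_ring :: complex ring) S"
  note add = generate_field.eng_add[of _ "class_ring :: complex ring" S, simplified]
  note mult = generate_field.eng_mult[of _ "class_ring :: complex ring" S, simplified]
  note one = generate_field.one[of "class_ring :: complex ring" S, simplified]
  have uminus: "- x \<in> ?F" if "x \<in> ?F" for x
    using generate_field.a_inv[OF that] by (simp add: class_ring_simps)
  have inv: "inverse x \<in> ?F" if "x \<in> ?F" "x \<noteq> 0" for x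
    using generate_field.m_inv[OF that(1)] that(2) by (simp add: class_ring_simps)
  have zero: "0 \<in> ?F" using add[OF one uminus[OF one]] by simp
  have nat: "of_nat n \<in> ?F" for n :: nat
    by (induction n) (auto intro: zero one add)
  have int: "of_int n \<in> ?F" for n :: int
    by (cases n) (auto intro!: nat uminus simp del: of_nat_Suc simp flip: of_nat_Suc minus_add_distrib)
  have rat: "of_rat q \<in> ?F" for q
  proof (cases q)
    case (Fract a b)
    then have "(of_rat q :: complex) = of_int a * inverse (of_int b)"
      by (simp add: of_rat_rat divide_inverse)
    then show ?thesis using Fract by (auto intro!: mult int inv)
  qed
  have "eval_rat f w \<in> ?F" for f
  proof (induction f)
    case 0
    then show ?case using zero by (simp add: eval_rat_simps)
  next
    case (pCons a f)
    then show ?case unfolding eval_rat_simps by (intro add mult rat w)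
  qed
  then show ?thesis by (auto simp: cyc_def)
qed

section \<open>Roots of unity of prime order and the field they generate\<close>

locale prime_root_of_unity =
  fixes p :: nat and w :: complex
  assumes p: "Factorial_Ring.prime p" and w_pow: "w ^ p = 1" and w_neq: "w \<noteq> 1"
begin

lemma p_gt_1: "p > 1" using p by (rule prime_gt_1_nat)

lemma w_nonzero: "w \<noteq> 0"
  using w_pow p_gt_1 by (auto simp: power_0_left)

lemma power_eq_1_iff: "w ^ i = 1 \<longleftrightarrow> p dvd i"
proof
  assume "p dvd i"
  then show "w ^ i = 1" using w_pow by (auto simp: power_mult)
next
  assume i: "w ^ i = 1"
  show "p dvd i"
  proof (rule ccontr)
    assume n: "\<not> p dvd i"
    then have "coprime p i" using p by (simp add: prime_imp_coprime)
    then obtain x y where "i * x = p * y + 1"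
      using bezout_nat[of i p] n by (metis coprime_commute coprime_iff_gcd_eq_1 dvd_0_right)
    then have "w ^ (i * x) = w ^ (p * y) * w" by simp
    then show False using i w_pow w_neq by (simp add: power_mult)
  qed
qed

lemma power_mod: "w ^ (i mod p) = w ^ i"
proof -
  have "w ^ i = w ^ (p * (i div p) + i mod p)" by simp
  also have "\<dots> = w ^ (i mod p)" by (simp only: power_add power_mult w_pow) simp
  finally show ?thesis by simp
qed

lemma inj_power: "inj_on (\<lambda>i. w ^ i) {..<p}"
proof (rule linorder_inj_onI)
  fix i j assume ij: "i < j" "i \<in> {..<p}" "j \<in> {..<p}"
  show "w ^ i \<noteq> w ^ j"
  proof
    assume "w ^ i = w ^ j"
    moreover have "w ^ j = w ^ i * w ^ (j - i)" using ij by (simp flip: power_add)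
    ultimately have "w ^ i * w ^ (j - i) = w ^ i * 1" by simp
    then have "w ^ (j - i) = 1" using w_nonzero by simp
    then have "p dvd j - i" by (simp add: power_eq_1_iff)
    then show False using ij by (auto dest: dvd_imp_le)
  qed
qed auto

lemma roots_eq: "{z. z ^ p = 1} = (\<lambda>i. w ^ i) ` {..<p}"
proof (rule card_subset_eq[symmetric])
  show "finite {z :: complex. z ^ p = 1}" using p_gt_1 by (intro finite_roots_unity) auto
  show "(\<lambda>i. w ^ i) ` {..<p} \<subseteq> {z. z ^ p = 1}"
    using w_pow by (auto simp: power_mult simp flip: power_mult) (metis mult.commute power_mult power_one)
  show "card ((\<lambda>i. w ^ i) ` {..<p}) = card {z :: complex. z ^ p = 1}"
    using p_gt_1 by (simp add: card_image inj_power card_roots_unity_eq)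
qed

text \<open>All nontrivial \<open>p\<close>-th roots of unity are conjugate: the remainder of
  \<open>f\<close> modulo \<open>geom p\<close> vanishes at \<open>w\<close> but has degree below
  \<open>p - 1\<close>, so it is zero, and \<open>geom p\<close> vanishes at
  \<open>z\<close>.\<close>

lemma eval_rat_conj:
  assumes z: "z ^ p = 1" "z \<noteq> 1" and f: "eval_rat f w = 0"
  shows "eval_rat f z = 0"
proof -
  have geom0: "eval_rat (geom p) y = 0" if "y ^ p = 1" "y \<noteq> 1" for y
    using sum_powers_root[OF that] by (simp add: eval_rat_geom)
  define r where "r = f mod geom p"
  have eq: "f = geom p * (f div geom p) + r" by (simp add: r_def)
  have ev: "eval_rat f y = eval_rat r y" if "y ^ p = 1" "y \<noteq> 1" for y
    by (subst eq, simp only: eval_rat_simps geom0[OF that]) simp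
  have "geom p \<noteq> (0 :: rat poly)" using coeff_geom[of p 0, where 'a=rat] p_gt_1 by auto
  then have "r = 0 \<or> Polynomial.degree r < Polynomial.degree (geom p :: rat poly)"
    unfolding r_def by (rule degree_mod_less)
  then have "r = 0 \<or> Polynomial.degree r < p - 1" using p_gt_1 by (simp add: degree_geom)
  then have "r = 0"
    using rat_poly_root_of_unity_degree[OF p w_pow w_neq, of r] ev[OF w_pow w_neq] f by force
  then show ?thesis using ev[OF z] by (simp add: eval_rat_simps)
qed

text \<open>If \<open>f\<close> does not vanish at \<open>w\<close>, neither does its gcd with
  \<open>geom p\<close>. The cofactor of the gcd in \<open>geom p\<close> then vanishes at
  \<open>w\<close> and already has degree \<open>p - 1\<close>, so the gcd is constant and a Bezout
  identity evaluated at \<open>w\<close> yields the inverse.\<close>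

lemma cyc_inverse:
  assumes "x \<in> cyc w" "x \<noteq> 0"
  shows "inverse x \<in> cyc w"
proof -
  obtain f where f: "x = eval_rat f w" using assms by (auto simp: cyc_def)
  define g where "g = gcd f (geom p)"
  obtain h where h: "geom p = g * h" unfolding g_def using gcd_dvd2 by (metis dvd_def)
  obtain k where k: "f = g * k" unfolding g_def using gcd_dvd1 by (metis dvd_def)
  have g0: "eval_rat g w \<noteq> 0" using assms(2) f k by (auto simp: eval_rat_simps)
  have "eval_rat (geom p) w = 0"
    using sum_powers_root[OF w_pow w_neq] by (simp add: eval_rat_geom)
  then have h0: "eval_rat h w = 0" using g0 unfolding h eval_rat_simps by simp
  have nz: "geom p \<noteq> (0 :: rat poly)" using coeff_geom[of p 0, where 'a=rat] p_gt_1 by auto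
  then have "h \<noteq> 0" "g \<noteq> 0" using h by auto
  then have "p - 1 \<le> Polynomial.degree h"
    using rat_poly_root_of_unity_degree[OF p w_pow w_neq] h0 by blast
  moreover have "Polynomial.degree g + Polynomial.degree h = p - 1"
    using degree_mult_eq[OF \<open>g \<noteq> 0\<close> \<open>h \<noteq> 0\<close>] p_gt_1 by (simp add: degree_geom flip: h)
  ultimately have "Polynomial.degree g = 0" by simp
  then obtain c where c: "g = [:c:]" by (rule degree_eq_zeroE)
  obtain a b where ab: "a * f + b * geom p = g"
    unfolding g_def by (metis bezout_coefficients_fst_snd)
  have "eval_rat a w * x = of_rat c"
    using arg_cong[OF ab, of "\<lambda>f. eval_rat f w"] \<open>eval_rat (geom p) w = 0\<close>
    by (simp only: eval_rat_simps f c) simp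
  moreover have "c \<noteq> 0" using \<open>g \<noteq> 0\<close> c by auto
  ultimately have "inverse x = eval_rat a w * inverse (of_rat c)"
    using assms(2) by (simp add: field_simps)
  then have "inverse x = eval_rat a w * of_rat (inverse c)" by (simp only: of_rat_inverse)
  moreover have "eval_rat a w \<in> cyc w" by (simp add: cyc_def)
  ultimately show ?thesis by (simp only: cyc_mult cyc_of_rat)
qed

lemma generate_field_eq_cyc:
  assumes S: "S \<subseteq> cyc w" and w: "w \<in> generate_field class_ring S"
  shows "generate_field class_ring S = cyc w"
proof (rule antisym)
  show "generate_field class_ring S \<subseteq> cyc w"
  proof
    fix x assume "x \<in> generate_field class_ring S"
    then show "x \<in> cyc w"
      using S by induction (auto simp: class_ring_simps intro: cyc_1 cyc_uminus cyc_inverse cyc_add cyc_mult)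
  qed
qed (rule generate_field_cyc_subset[OF w])

text \<open>If \<open>p\<close> does not divide \<open>j\<close>, multiplication by \<open>w\<close>
  permutes the roots and scales the sum by \<open>w ^ j\<close>, which is not 1; so the sum over all
  roots is zero. Removing the root 1 subtracts 1.\<close>

lemma sum_roots_power:
  "(\<Sum>z | z ^ p = 1 \<and> z \<noteq> 1. z ^ j) = (if p dvd j then of_nat p - 1 else - 1 :: complex)"
proof -
  have fin: "finite {z :: complex. z ^ p = 1}" using p_gt_1 by (intro finite_roots_unity) auto
  have "(\<Sum>z | z ^ p = 1. z ^ j) = (if p dvd j then of_nat p else 0 :: complex)"
  proof (cases "p dvd j")
    case True
    then have "z ^ j = 1" if "z ^ p = 1" for z :: complex using that by (auto simp: power_mult)
    then show ?thesis using True p_gt_1 by (simp add: card_roots_unity_eq)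
  next
    case False
    have "(\<Sum>z | z ^ p = 1. z ^ j) = (\<Sum>z | z ^ p = 1. (w * z) ^ j)"
      by (rule sum.reindex_bij_witness[of _ "\<lambda>z. w * z" "\<lambda>z. z / w"])
        (use w_nonzero w_pow in \<open>auto simp: power_mult_distrib power_divide\<close>)
    then have "(1 - w ^ j) * (\<Sum>z | z ^ p = 1. z ^ j) = 0"
      by (simp add: power_mult_distrib left_diff_distrib flip: sum_distrib_left)
    then show ?thesis using False by (simp add: power_eq_1_iff)
  qed
  moreover have "{z :: complex. z ^ p = 1} = insert 1 {z. z ^ p = 1 \<and> z \<noteq> 1}" by auto
  moreover have "finite {z :: complex. z ^ p = 1 \<and> z \<noteq> 1}"
    by (rule finite_subset[OF _ fin]) auto
  ultimately show ?thesis by (auto split: if_splits simp: algebra_simps add_eq_0_iff)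
qed

section \<open>The Galois group of Q(w)\<close>

lemma Gal_eval_rat:
  assumes s: "s \<in> Gal_over_rat (cyc w)"
  shows "s (eval_rat f w) = eval_rat f (s w)"
proof (induction f)
  case 0
  have "s 0 = 0" using s by (simp add: Gal_over_rat_def)
  then show ?case by (simp add: eval_rat_simps)
next
  case (pCons a f)
  have hom: "s \<in> Ring.ring_hom (class_ring\<lparr>carrier := cyc w\<rparr>) (class_ring\<lparr>carrier := cyc w\<rparr>)"
    and rat: "s (of_rat a) = of_rat a"
    using s by (auto simp: Gal_over_rat_def ring_iso_def)
  have mem: "eval_rat f w \<in> cyc w" by (simp add: cyc_def)
  have "s (of_rat a + w * eval_rat f w) = s (of_rat a) + s w * s (eval_rat f w)"
    using Ring.ring_hom_add[OF hom, of "of_rat a" "w * eval_rat f w"]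
      Ring.ring_hom_mult[OF hom, of w "eval_rat f w"] mem
    by (simp add: cyc_of_rat cyc_mult cyc_self)
  then show ?case by (simp only: eval_rat_simps rat pCons.IH)
qed

lemma Gal_exists:
  assumes z: "z ^ p = 1" "z \<noteq> 1"
  shows "\<exists>s \<in> Gal_over_rat (cyc w). s w = z"
proof -
  interpret z: prime_root_of_unity p z by unfold_locales (use p z in auto)
  obtain i where "z = w ^ i" using z roots_eq by auto
  then have "cyc z \<subseteq> cyc w" by (auto intro!: cyc_subset cyc_power cyc_self)
  moreover obtain j where "w = z ^ j" using w_pow z.roots_eq by auto
  then have "cyc w \<subseteq> cyc z" by (metis cyc_subset cyc_power cyc_self)
  ultimately have cz: "cyc z = cyc w" by simp
  \<comment> \<open>The automorphism sends the value of a polynomial at \<open>w\<close> to its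
    value at \<open>z\<close>. By \<open>eval_rat_conj\<close> the polynomial picked by
    \<open>SOME\<close> does not matter; the same lemma from \<open>z\<close> back to
    \<open>w\<close> gives injectivity. \<open>restrict\<close> provides the extensionality demanded
    by \<open>Gal_over_rat\<close>.\<close>
  define s where "s = restrict (\<lambda>x. eval_rat (SOME f. eval_rat f w = x) z) (cyc w)"
  have s: "s (eval_rat f w) = eval_rat f z" for f
  proof -
    let ?g = "SOME g. eval_rat g w = eval_rat f w"
    have "eval_rat ?g w = eval_rat f w" by (rule someI[of _ f]) simp
    then have "eval_rat (?g + - f) w = 0" by (simp only: eval_rat_simps) simp
    then have "eval_rat (?g + - f) z = 0" by (rule eval_rat_conj[OF z])
    then have "eval_rat ?g z = eval_rat f z" by (simp only: eval_rat_simps) simp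
    then show ?thesis by (simp add: s_def cyc_def)
  qed
  have inj: "inj_on s (cyc w)"
  proof (rule inj_onI)
    fix x y assume "x \<in> cyc w" "y \<in> cyc w" and eq: "s x = s y"
    then obtain f g where fg: "x = eval_rat f w" "y = eval_rat g w" by (auto simp: cyc_def)
    have "eval_rat (f + - g) z = 0" using eq unfolding fg s by (simp only: eval_rat_simps) simp
    then have "eval_rat (f + - g) w = 0" by (rule z.eval_rat_conj[OF w_pow w_neq])
    then show "x = y" unfolding fg by (simp only: eval_rat_simps) simp
  qed
  have "s ` cyc w = cyc z" by (auto simp: cyc_def s image_image)
  with inj cz have bij: "bij_betw s (cyc w) (cyc w)" by (simp add: bij_betw_def)
  have add: "s (x + y) = s x + s y" and mult: "s (x * y) = s x * s y"
    if xy: "x \<in> cyc w" "y \<in> cyc w" for x y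
  proof -
    obtain f g where fg: "x = eval_rat f w" "y = eval_rat g w" using xy unfolding cyc_def by blast
    show "s (x + y) = s x + s y" "s (x * y) = s x * s y"
      unfolding fg by (simp_all only: s flip: eval_rat_simps)
  qed
  have rat: "s (of_rat q) = of_rat q" for q using s[of "[:q:]"] by (simp add: eval_rat_simps)
  have "s \<in> ring_iso (class_ring\<lparr>carrier := cyc w\<rparr>) (class_ring\<lparr>carrier := cyc w\<rparr>)"
    using bij add mult rat[of 1] bij_betwE[OF bij]
    by (auto simp: ring_iso_def Ring.ring_hom_def)
  then have "s \<in> Gal_over_rat (cyc w)"
    using rat by (auto simp: Gal_over_rat_def s_def Rats_def)
  moreover have "s w = z" using s[of "[:0, 1:]"] by (simp add: eval_rat_simps)
  ultimately show ?thesis by blast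
qed

text \<open>An automorphism is determined by its value at \<open>w\<close>, and
  \<open>Gal_exists\<close> realises every nontrivial root. Sums over automorphisms thus become sums
  over roots.\<close>

lemma bij_Gal: "bij_betw (\<lambda>s. s w) (Gal_over_rat (cyc w)) {z. z ^ p = 1 \<and> z \<noteq> 1}"
proof (rule bij_betw_imageI)
  show "inj_on (\<lambda>s. s w) (Gal_over_rat (cyc w))"
  proof (rule inj_onI)
    fix s t assume s: "s \<in> Gal_over_rat (cyc w)" and t: "t \<in> Gal_over_rat (cyc w)" and eq: "s w = t w"
    show "s = t"
    proof (rule extensionalityI[of _ "cyc w"])
      show "s \<in> extensional (cyc w)" "t \<in> extensional (cyc w)" using s t by (auto simp: Gal_over_rat_def)
      fix x assume "x \<in> cyc w"
      then obtain f where "x = eval_rat f w" by (auto simp: cyc_def)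
      then show "s x = t x" using Gal_eval_rat[OF s] Gal_eval_rat[OF t] eq by simp
    qed
  qed
  have "s w ^ p = 1 \<and> s w \<noteq> 1" if s: "s \<in> Gal_over_rat (cyc w)" for s
  proof
    have "s (eval_rat (Polynomial.monom 1 p) w) = eval_rat (Polynomial.monom 1 p) (s w)"
      by (rule Gal_eval_rat[OF s])
    moreover have one: "s 1 = 1" using Gal_eval_rat[OF s, of 1] by (simp add: eval_rat_simps)
    ultimately show "s w ^ p = 1" using w_pow by (simp add: eval_rat_monom)
    have "inj_on s (cyc w)" using s by (auto simp: Gal_over_rat_def ring_iso_def bij_betw_def)
    then show "s w \<noteq> 1" using one w_neq cyc_1 cyc_self by (metis inj_onD)
  qed
  then show "(\<lambda>s. s w) ` Gal_over_rat (cyc w) = {z. z ^ p = 1 \<and> z \<noteq> 1}"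
    using Gal_exists by auto
qed

text \<open>This is the trace of \<open>w ^ j\<close> from Q(w) to Q; it supplies the values of
  \<open>Omega\<close> on linear characters.\<close>

lemma sum_Gal_power:
  "(\<Sum>s \<in> Gal_over_rat (cyc w). s (w ^ j)) = (if p dvd j then of_nat p - 1 else - 1)"
proof -
  have "(\<Sum>s \<in> Gal_over_rat (cyc w). s (w ^ j)) = (\<Sum>s \<in> Gal_over_rat (cyc w). s w ^ j)"
  proof (rule sum.cong)
    fix s assume "s \<in> Gal_over_rat (cyc w)"
    from Gal_eval_rat[OF this, of "Polynomial.monom 1 j"]
    show "s (w ^ j) = s w ^ j" by (simp add: eval_rat_monom)
  qed simp
  also have "\<dots> = (\<Sum>z | z ^ p = 1 \<and> z \<noteq> 1. z ^ j)"
    by (rule sum.reindex_bij_betw[OF bij_Gal])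
  finally show ?thesis by (simp add: sum_roots_power)
qed

end

section \<open>Matrix representations\<close>

lemma subspace_iff:
  "VectorSpace.subspace class_ring W (module_vec TYPE('k::field) n) \<longleftrightarrow>
     W \<subseteq> carrier_vec n \<and> 0\<^sub>v n \<in> W \<and> (\<forall>v \<in> W. \<forall>w \<in> W. v + w \<in> W) \<and>
     (\<forall>c. \<forall>v \<in> W. c \<cdot>\<^sub>v v \<in> W)"
proof -
  interpret vec_space "TYPE('k)" n .
  show ?thesis
    using vec_vs vec_module
    by (auto simp: VectorSpace.subspace_def LinearCombinations.submodule_def module_vec_simps)
qed

text \<open>Merges the \<open>subspace\<close> condition of \<open>irreducible_rep\<close>, written
  elementwise, with stability under the group, so that invariance can be proved and used clause by
  clause.\<close>

definition rep_invariant :: "('a, 'b) monoid_scheme \<Rightarrow> nat \<Rightarrow> ('a \<Rightarrow> 'k::field mat) \<Rightarrow> 'k vec set \<Rightarrow> bool" where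
  "rep_invariant G n \<rho> W \<longleftrightarrow>
     W \<subseteq> carrier_vec n \<and> 0\<^sub>v n \<in> W \<and> (\<forall>v \<in> W. \<forall>w \<in> W. v + w \<in> W) \<and>
     (\<forall>c. \<forall>v \<in> W. c \<cdot>\<^sub>v v \<in> W) \<and> (\<forall>g \<in> carrier G. \<forall>w \<in> W. \<rho> g *\<^sub>v w \<in> W)"

lemma irreducible_rep_iff:
  "irreducible_rep G n \<rho> \<longleftrightarrow> matrix_rep G n \<rho> \<and> 0 < n \<and>
     (\<forall>W. rep_invariant G n \<rho> W \<longrightarrow> W = {0\<^sub>v n} \<or> W = carrier_vec n)"
  unfolding irreducible_rep_def subspace_iff rep_invariant_def by blast

lemma matrix_repD:
  assumes "matrix_rep G n \<rho>" "group G"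
  shows "g \<in> carrier G \<Longrightarrow> \<rho> g \<in> carrier_mat n n"
    and "g \<in> carrier G \<Longrightarrow> h \<in> carrier G \<Longrightarrow> \<rho> (g \<otimes>\<^bsub>G\<^esub> h) = \<rho> g * \<rho> h"
    and "\<rho> \<one>\<^bsub>G\<^esub> = 1\<^sub>m n"
proof -
  interpret G: group G by fact
  interpret R: ring "ring_mat TYPE('c) n ()" by (rule ring_mat)
  have hom: "\<rho> \<in> hom G (GL TYPE('c) n)" using assms(1) by (simp add: matrix_rep_def)
  have "group (GL TYPE('c) n)" by (rule R.units_group)
  then interpret group_hom G "GL TYPE('c) n" \<rho>
    using hom by (auto simp: group_hom_def group_hom_axioms_def)
  show "\<rho> g \<in> carrier_mat n n" if "g \<in> carrier G"
    using hom_in_carrier hom that by (auto simp: hom_def units_of_def Units_def ring_mat_simps Pi_def)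
  show "\<rho> (g \<otimes>\<^bsub>G\<^esub> h) = \<rho> g * \<rho> h" if "g \<in> carrier G" "h \<in> carrier G"
    using hom_mult[OF that] by (simp add: units_of_def ring_mat_simps)
  show "\<rho> \<one>\<^bsub>G\<^esub> = 1\<^sub>m n"
    using hom_one by (simp add: units_of_def ring_mat_simps)
qed

lemma matrix_repI:
  assumes "group G" and car: "\<And>g. g \<in> carrier G \<Longrightarrow> \<rho> g \<in> carrier_mat n n"
    and mult: "\<And>g h. g \<in> carrier G \<Longrightarrow> h \<in> carrier G \<Longrightarrow> \<rho> (g \<otimes>\<^bsub>G\<^esub> h) = \<rho> g * \<rho> h"
    and one: "\<rho> \<one>\<^bsub>G\<^esub> = 1\<^sub>m n"
  shows "matrix_rep G n (\<rho> :: _ \<Rightarrow> 'k::field mat)"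
proof -
  interpret G: group G by fact
  \<comment> \<open>The image of the inverse element serves as inverse matrix.\<close>
  have "\<rho> g \<in> Units (ring_mat TYPE('k) n ())" if g: "g \<in> carrier G" for g
  proof -
    have "\<rho> (inv\<^bsub>G\<^esub> g) * \<rho> g = 1\<^sub>m n" "\<rho> g * \<rho> (inv\<^bsub>G\<^esub> g) = 1\<^sub>m n"
      using g one by (simp_all flip: mult)
    then show ?thesis using car g by (auto simp: Units_def ring_mat_simps intro!: bexI[of _ "\<rho> (inv\<^bsub>G\<^esub> g)"])
  qed
  then show ?thesis using mult by (auto simp: matrix_rep_def hom_def units_of_def ring_mat_simps)
qed

lemma rep_kernel_iff:
  "rep_kernel G n (\<rho> :: _ \<Rightarrow> 'k::field mat) = {g \<in> carrier G. \<rho> g = 1\<^sub>m n}"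
  by (simp add: rep_kernel_def kernel_def units_of_def ring_mat_simps)

section \<open>Traces and sums of matrices\<close>

lemma mat_trace_mult_comm:
  assumes "A \<in> carrier_mat n m" "B \<in> carrier_mat m n"
  shows "mat_trace (A * B) = (mat_trace (B * A) :: 'k::comm_ring_1)"
proof -
  have "mat_trace (A * B) = (\<Sum>i<n. \<Sum>j<m. A $$ (i,j) * B $$ (j,i))"
    using assms by (simp add: mat_trace_def scalar_prod_def atLeast0LessThan)
  also have "\<dots> = (\<Sum>j<m. \<Sum>i<n. B $$ (j,i) * A $$ (i,j))"
    by (subst sum.swap) (simp add: mult.commute)
  also have "\<dots> = mat_trace (B * A)"
    using assms by (simp add: mat_trace_def scalar_prod_def atLeast0LessThan)
  finally show ?thesis .
qed

lemma mat_trace_one [simp]: "mat_trace (1\<^sub>m n) = (of_nat n :: 'k::comm_ring_1)"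
  by (simp add: mat_trace_def)

lemma mat_trace_zero [simp]: "mat_trace (0\<^sub>m n n) = (0 :: 'k::comm_ring_1)"
  by (simp add: mat_trace_def)

lemma mat_trace_smult [simp]:
  "A \<in> carrier_mat n n \<Longrightarrow> mat_trace (c \<cdot>\<^sub>m A) = (c :: 'k::comm_ring_1) * mat_trace A"
  by (auto simp: mat_trace_def sum_distrib_left)

text \<open>The dimensions are arguments because the type of matrices does not fix them; the sum
  over an empty set must still have the right size.\<close>

definition msum :: "nat \<Rightarrow> nat \<Rightarrow> ('i \<Rightarrow> 'k::comm_ring_1 mat) \<Rightarrow> 'i set \<Rightarrow> 'k mat" where
  "msum n m f S = mat n m (\<lambda>ij. \<Sum>s\<in>S. f s $$ ij)"

lemma msum_carrier [simp]: "msum n m f S \<in> carrier_mat n m" by (simp add: msum_def)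

lemma msum_cong: "(\<And>s. s \<in> S \<Longrightarrow> f s = g s) \<Longrightarrow> msum n m f S = msum n m g S"
  by (simp add: msum_def)

lemma msum_reindex_bij_witness:
  assumes "\<And>a. a \<in> S \<Longrightarrow> i (j a) = a" "\<And>a. a \<in> S \<Longrightarrow> j a \<in> T"
    "\<And>b. b \<in> T \<Longrightarrow> j (i b) = b" "\<And>b. b \<in> T \<Longrightarrow> i b \<in> S"
    "\<And>a. a \<in> S \<Longrightarrow> h (j a) = g a"
  shows "msum n m g S = msum n m h T"
  unfolding msum_def using assms by (intro cong_mat refl sum.reindex_bij_witness[of _ i j]) auto

lemma mult_msum:
  assumes A: "A \<in> carrier_mat l n" and f: "\<And>s. s \<in> S \<Longrightarrow> f s \<in> carrier_mat n m"
  shows "A * msum n m f S = msum l m (\<lambda>s. A * f s) S"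
proof (rule eq_matI)
  fix i j assume "i < dim_row (msum l m (\<lambda>s. A * f s) S)" "j < dim_col (msum l m (\<lambda>s. A * f s) S)"
  then have ij: "i < l" "j < m" by (auto simp: msum_def)
  have "(A * msum n m f S) $$ (i, j) = (\<Sum>k<n. \<Sum>s\<in>S. A $$ (i, k) * f s $$ (k, j))"
    using A ij by (simp add: msum_def scalar_prod_def atLeast0LessThan sum_distrib_left)
  also have "\<dots> = (\<Sum>s\<in>S. (A * f s) $$ (i, j))"
    by (subst sum.swap) (use A ij in \<open>auto simp: scalar_prod_def atLeast0LessThan dest: f intro!: sum.cong\<close>)
  finally show "(A * msum n m f S) $$ (i, j) = msum l m (\<lambda>s. A * f s) S $$ (i, j)"
    using ij by (simp add: msum_def)
qed (use A in \<open>auto simp: msum_def\<close>)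

lemma msum_mult:
  assumes A: "A \<in> carrier_mat m l" and f: "\<And>s. s \<in> S \<Longrightarrow> f s \<in> carrier_mat n m"
  shows "msum n m f S * A = msum n l (\<lambda>s. f s * A) S"
proof (rule eq_matI)
  fix i j assume "i < dim_row (msum n l (\<lambda>s. f s * A) S)" "j < dim_col (msum n l (\<lambda>s. f s * A) S)"
  then have ij: "i < n" "j < l" by (auto simp: msum_def)
  have "(msum n m f S * A) $$ (i, j) = (\<Sum>k<m. \<Sum>s\<in>S. f s $$ (i, k) * A $$ (k, j))"
    using A ij by (simp add: msum_def scalar_prod_def atLeast0LessThan sum_distrib_right)
  also have "\<dots> = (\<Sum>s\<in>S. (f s * A) $$ (i, j))"
    by (subst sum.swap) (use A ij in \<open>auto simp: scalar_prod_def atLeast0LessThan dest: f intro!: sum.cong\<close>)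
  finally show "(msum n m f S * A) $$ (i, j) = msum n l (\<lambda>s. f s * A) S $$ (i, j)"
    using ij by (simp add: msum_def)
qed (use A in \<open>auto simp: msum_def\<close>)

lemma mat_trace_msum:
  "(\<And>s. s \<in> S \<Longrightarrow> f s \<in> carrier_mat n n) \<Longrightarrow> mat_trace (msum n n f S) = (\<Sum>s\<in>S. mat_trace (f s))"
  by (subst sum.cong[OF refl, of S _ "\<lambda>s. \<Sum>i<n. f s $$ (i,i)"])
    (auto simp: mat_trace_def msum_def sum.swap[of _ S])

lemma msum_const: "A \<in> carrier_mat n m \<Longrightarrow> msum n m (\<lambda>s. A) S = of_nat (card S) \<cdot>\<^sub>m A"
  by (rule eq_matI) (auto simp: msum_def)

lemma unit_vec_span:
  assumes W: "rep_invariant G n \<rho> W" and units: "\<And>i. i < n \<Longrightarrow> unit_vec n i \<in> W"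
  shows "W = carrier_vec n"
proof -
  \<comment> \<open>Truncating \<open>v\<close> after its first \<open>k\<close> coordinates stays
    in \<open>W\<close>, by induction on \<open>k\<close>.\<close>
  have "vec n (\<lambda>i. if i < k then v $ i else 0) \<in> W" if v: "v \<in> carrier_vec n" and "k \<le> n" for v k
    using that(2)
  proof (induction k)
    case 0
    have "vec n (\<lambda>i. if i < 0 then v $ i else 0) = 0\<^sub>v n" by auto
    then show ?case using W by (simp add: rep_invariant_def)
  next
    case (Suc k)
    have "vec n (\<lambda>i. if i < Suc k then v $ i else 0) =
        vec n (\<lambda>i. if i < k then v $ i else 0) + v $ k \<cdot>\<^sub>v unit_vec n k"
      using Suc.prems by (intro eq_vecI) (auto simp: unit_vec_def less_Suc_eq)
    then show ?case using W Suc units[of k] by (simp add: rep_invariant_def)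
  qed
  from this[of _ n] have "v \<in> W" if v: "v \<in> carrier_vec n" for v
  proof -
    have "vec n (\<lambda>i. if i < n then v $ i else 0) = v" using v by auto
    then show ?thesis using \<open>\<And>v. v \<in> carrier_vec n \<Longrightarrow> n \<le> n \<Longrightarrow> _ v \<in> W\<close>[OF v] by simp
  qed
  then show ?thesis using W by (auto simp: rep_invariant_def)
qed

section \<open>Schur's lemma, characters of equivalent representations, linear characters\<close>

lemma mat_eq_zeroI:
  assumes A: "A \<in> carrier_mat N n" and "\<And>v. v \<in> carrier_vec n \<Longrightarrow> A *\<^sub>v v = 0\<^sub>v N"
  shows "A = (0\<^sub>m N n :: 'k::comm_ring_1 mat)"
proof (rule mat_col_eqI)
  fix j assume j: "j < dim_col (0\<^sub>m N n :: 'k mat)"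
  have "A *\<^sub>v unit_vec n j = col A j" using A j by (intro eq_vecI) auto
  then show "col A j = col (0\<^sub>m N n) j" using assms(2)[of "unit_vec n j"] j by simp
qed (use A in auto)

lemma mat_eq_mult_vecI:
  assumes A: "A \<in> carrier_mat N n" and B: "B \<in> carrier_mat N n"
    and "\<And>v. v \<in> carrier_vec n \<Longrightarrow> A *\<^sub>v v = B *\<^sub>v v"
  shows "A = (B :: 'k::comm_ring_1 mat)"
proof (rule mat_col_eqI)
  fix j assume j: "j < dim_col B"
  have "A *\<^sub>v unit_vec n j = col A j" "B *\<^sub>v unit_vec n j = col B j"
    using A B j by (auto intro!: eq_vecI)
  then show "col A j = col B j" using assms(3)[of "unit_vec n j"] by simp
qed (use A B in auto)

text \<open>Kernel and image of \<open>T\<close> are invariant, so the kernel is zero and the image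
  is everything. The degrees agree because the two products of \<open>T\<close> with its inverse
  have the same trace; here characteristic 0 enters.\<close>

lemma schur:
  fixes \<rho> \<tau> :: "'a \<Rightarrow> 'k::field_char_0 mat"
  assumes G: "group G" and \<rho>: "irreducible_rep G N \<rho>" and \<tau>: "irreducible_rep G n \<tau>"
    and T: "T \<in> carrier_mat N n" and comm: "\<And>g. g \<in> carrier G \<Longrightarrow> \<rho> g * T = T * \<tau> g"
    and nz: "T \<noteq> 0\<^sub>m N n"
  shows "N = n \<and> (\<exists>Q \<in> carrier_mat n N. T * Q = 1\<^sub>m N \<and> Q * T = 1\<^sub>m n)"
proof -
  have R: "\<rho> g \<in> carrier_mat N N" "\<tau> g \<in> carrier_mat n n" if "g \<in> carrier G" for g
    using matrix_repD(1)[OF _ G that] \<rho> \<tau> by (auto simp: irreducible_rep_iff)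
  have comm_vec: "\<rho> g *\<^sub>v (T *\<^sub>v v) = T *\<^sub>v (\<tau> g *\<^sub>v v)" if "g \<in> carrier G" "v \<in> carrier_vec n" for g v
    using comm[OF that(1)] T R[OF that(1)] that(2) by (metis assoc_mult_mat_vec)
  define Ker where "Ker = {v \<in> carrier_vec n. T *\<^sub>v v = 0\<^sub>v N}"
  have "rep_invariant G n \<tau> Ker"
    unfolding rep_invariant_def
  proof (intro conjI ballI allI)
    show "0\<^sub>v n \<in> Ker" using T by (auto simp: Ker_def)
    show "v + w \<in> Ker" if "v \<in> Ker" "w \<in> Ker" for v w
      using that T by (auto simp: Ker_def mult_add_distrib_mat_vec)
    show "c \<cdot>\<^sub>v v \<in> Ker" if "v \<in> Ker" for c v
      using that T by (auto simp: Ker_def mult_mat_vec)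
    show "\<tau> g *\<^sub>v v \<in> Ker" if "g \<in> carrier G" "v \<in> Ker" for g v
    proof -
      have "\<rho> g *\<^sub>v 0\<^sub>v N = 0\<^sub>v N" using R[OF that(1)] by auto
      then show ?thesis using that R[OF that(1)] comm_vec[OF that(1), of v] by (auto simp: Ker_def)
    qed
  qed (auto simp: Ker_def)
  moreover have "Ker \<noteq> carrier_vec n" using nz mat_eq_zeroI[OF T] by (auto simp: Ker_def)
  ultimately have Ker: "Ker = {0\<^sub>v n}" using \<tau> by (auto simp: irreducible_rep_iff)
  define Im where "Im = (\<lambda>v. T *\<^sub>v v) ` carrier_vec n"
  have "rep_invariant G N \<rho> Im"
    unfolding rep_invariant_def
  proof (intro conjI ballI allI)
    show "Im \<subseteq> carrier_vec N" using T by (auto simp: Im_def)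
    have "T *\<^sub>v 0\<^sub>v n = 0\<^sub>v N" using T by auto
    then show "0\<^sub>v N \<in> Im" by (metis Im_def imageI zero_carrier_vec)
    show "v + w \<in> Im" if "v \<in> Im" "w \<in> Im" for v w
      using that T by (auto simp: Im_def simp flip: mult_add_distrib_mat_vec)
    show "c \<cdot>\<^sub>v v \<in> Im" if "v \<in> Im" for c v
      using that T by (auto simp: Im_def simp flip: mult_mat_vec)
    show "\<rho> g *\<^sub>v v \<in> Im" if "g \<in> carrier G" "v \<in> Im" for g v
      using that R[OF that(1)] comm_vec[OF that(1)] by (auto simp: Im_def)
  qed
  moreover have "Im \<noteq> {0\<^sub>v N}" using nz mat_eq_zeroI[OF T] by (auto simp: Im_def)
  ultimately have Im: "Im = carrier_vec N" using \<rho> by (auto simp: irreducible_rep_iff)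
  \<comment> \<open>Preimages of the unit vectors form the columns of a right inverse.\<close>
  have "\<exists>q. q \<in> carrier_vec n \<and> T *\<^sub>v q = unit_vec N i" for i
  proof -
    have "unit_vec N i \<in> Im" using Im by simp
    then show ?thesis unfolding Im_def by force
  qed
  then obtain q where q: "q i \<in> carrier_vec n" "T *\<^sub>v q i = unit_vec N i" for i by metis
  define Q where "Q = mat n N (\<lambda>(i, j). q j $ i)"
  have Q: "Q \<in> carrier_mat n N" by (simp add: Q_def)
  have TQ: "T * Q = 1\<^sub>m N"
  proof (rule mat_col_eqI)
    fix j assume "j < dim_col (1\<^sub>m N :: 'k mat)"
    then have j: "j < N" by simp
    have "col Q j = q j" using j q(1)[of j] by (auto simp: Q_def)
    then show "col (T * Q) j = col (1\<^sub>m N) j" using q(2)[of j] col_mult2[OF T Q j] j by simp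
  qed (use T Q in auto)
  have inj: "v = 0\<^sub>v n" if "v \<in> carrier_vec n" "T *\<^sub>v v = 0\<^sub>v N" for v
    using that Ker by (auto simp: Ker_def)
  \<comment> \<open>\<open>T\<close> times this difference is zero because \<open>Q\<close> is a
    right inverse; injectivity of \<open>T\<close> makes \<open>Q\<close> a left inverse
    too.\<close>
  have "Q * T - 1\<^sub>m n = 0\<^sub>m n n"
  proof (rule mat_eq_zeroI)
    fix v :: "'k vec" assume v: "v \<in> carrier_vec n"
    have "T *\<^sub>v ((Q * T - 1\<^sub>m n) *\<^sub>v v) = (T * (Q * T - 1\<^sub>m n)) *\<^sub>v v"
      using T Q v by (subst assoc_mult_mat_vec[of _ N n _ n]) auto
    also have "T * (Q * T - 1\<^sub>m n) = T * Q * T - T"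
      using T Q by (subst mult_minus_distrib_mat[of _ N n _ n]) auto
    also have "\<dots> = 0\<^sub>m N n" using T TQ by simp
    also have "0\<^sub>m N n *\<^sub>v v = 0\<^sub>v N" using v by (intro eq_vecI) auto
    finally have "T *\<^sub>v ((Q * T - 1\<^sub>m n) *\<^sub>v v) = 0\<^sub>v N" .
    moreover have "Q * T - 1\<^sub>m n \<in> carrier_mat n n" by (rule minus_carrier_mat) simp
    ultimately show "(Q * T - 1\<^sub>m n) *\<^sub>v v = 0\<^sub>v n"
      using v by (intro inj mult_mat_vec_carrier)
  qed (use T Q in auto)
  then have QT: "Q * T = 1\<^sub>m n"
  proof -
    have "Q * T = (Q * T - 1\<^sub>m n) + 1\<^sub>m n" using Q T by (intro eq_matI) auto
    then show ?thesis using \<open>Q * T - 1\<^sub>m n = 0\<^sub>m n n\<close> by simp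
  qed
  have "(of_nat N :: 'k) = of_nat n"
    using mat_trace_mult_comm[OF T Q] TQ QT by simp
  then show ?thesis using Q TQ QT by auto
qed

lemma commuting_zero_or_invertible:
  fixes \<rho> :: "'a \<Rightarrow> 'k::field_char_0 mat"
  assumes "group G" "irreducible_rep G n \<rho>" "E \<in> carrier_mat n n"
    and "\<And>g. g \<in> carrier G \<Longrightarrow> \<rho> g * E = E * \<rho> g" and "E \<noteq> 0\<^sub>m n n"
  obtains Q where "Q \<in> carrier_mat n n" "E * Q = 1\<^sub>m n" "Q * E = 1\<^sub>m n"
  using schur[OF assms(1,2,2,3,4,5)] by blast

text \<open>Averaging a matrix \<open>A\<close> over the group gives an intertwiner
  \<open>T A\<close>. If all averages vanished, then so would the (i, k) entry of the average of the
  matrix unit at (i, k), and summing over i and k would make the product of characters zero. So some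
  average is nonzero and Schur's lemma applies. The argument works over Q as well as over C.\<close>

lemma equivalent_if_char_product_nonzero:
  fixes G (structure) and \<rho> \<tau> :: "'a \<Rightarrow> 'k::field_char_0 mat"
  assumes G: "group G" and \<rho>: "irreducible_rep G N \<rho>" and \<tau>: "irreducible_rep G n \<tau>"
    and nz: "(\<Sum>g\<in>carrier G. mat_trace (\<rho> g) * mat_trace (\<tau> (inv g))) \<noteq> 0"
  shows "N = n \<and> equivalent_reps G \<rho> \<tau>"
proof -
  interpret G: group G by fact
  have mr: "matrix_rep G N \<rho>" "matrix_rep G n \<tau>" using \<rho> \<tau> by (auto simp: irreducible_rep_iff)
  note car = matrix_repD(1)[OF mr(1) G] matrix_repD(1)[OF mr(2) G]
  note mult = matrix_repD(2)[OF mr(1) G] matrix_repD(2)[OF mr(2) G]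
  define T where "T A = msum N n (\<lambda>g. \<rho> g * A * \<tau> (inv g)) (carrier G)" for A
  have TC: "T A \<in> carrier_mat N n" for A by (simp add: T_def)
  have comm: "\<rho> h * T A = T A * \<tau> h" if A: "A \<in> carrier_mat N n" and h: "h \<in> carrier G" for A h
  proof -
    have rA: "\<rho> g * A \<in> carrier_mat N n" if "g \<in> carrier G" for g
      using car(1)[OF that] A by (rule mult_carrier_mat)
    have AC: "\<rho> g * A * \<tau> g' \<in> carrier_mat N n" if "g \<in> carrier G" "g' \<in> carrier G" for g g'
      using A that car by (metis mult_carrier_mat)
    have "\<rho> h * T A = msum N n (\<lambda>g. \<rho> h * (\<rho> g * A * \<tau> (inv g))) (carrier G)"
      unfolding T_def by (rule mult_msum[OF car(1)[OF h]]) (simp add: AC)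
    also have "\<dots> = msum N n (\<lambda>g. (\<rho> g * A * \<tau> (inv g)) * \<tau> h) (carrier G)"
    proof (rule msum_reindex_bij_witness[of _ "\<lambda>g. inv h \<otimes> g" "\<lambda>g. h \<otimes> g"])
      fix g assume g: "g \<in> carrier G"
      let ?g = "h \<otimes> g"
      have e1: "\<rho> ?g * A * \<tau> (inv ?g) * \<tau> h = \<rho> ?g * A * (\<tau> (inv ?g) * \<tau> h)"
        by (rule assoc_mult_mat[of _ N n _ n _ n]) (use rA car g h in \<open>auto intro: mult_carrier_mat\<close>)
      have e2: "\<tau> (inv ?g) * \<tau> h = \<tau> (inv g)"
        using g h by (simp flip: mult add: G.inv_mult_group G.m_assoc)
      have e3: "\<rho> ?g * A = \<rho> h * (\<rho> g * A)"
        using g h A car by (simp add: mult assoc_mult_mat[of _ N N _ N _ n])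
      have e4: "\<rho> h * (\<rho> g * A) * \<tau> (inv g) = \<rho> h * (\<rho> g * A * \<tau> (inv g))"
        by (rule assoc_mult_mat[of _ N N _ n _ n]) (use rA car g h in \<open>auto intro: mult_carrier_mat\<close>)
      show "\<rho> ?g * A * \<tau> (inv ?g) * \<tau> h = \<rho> h * (\<rho> g * A * \<tau> (inv g))"
        by (simp only: e1 e2) (simp only: e3 e4)
    qed (use h in \<open>simp_all add: G.m_assoc[symmetric]\<close>)
    also have "\<dots> = T A * \<tau> h"
      unfolding T_def by (rule msum_mult[symmetric, OF car(2)[OF h]]) (simp add: AC)
    finally show ?thesis .
  qed
  have "\<exists>A \<in> carrier_mat N n. T A \<noteq> 0\<^sub>m N n"
  proof (rule ccontr)
    assume "\<not> ?thesis"
    then have zero: "T A = 0\<^sub>m N n" if "A \<in> carrier_mat N n" for A using that by blast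
    have "(\<Sum>g\<in>carrier G. \<rho> g $$ (i, i) * \<tau> (inv g) $$ (k, k)) = 0" if i: "i < N" and k: "k < n" for i k
    proof -
      define A :: "'k mat" where "A = mat N n (\<lambda>(a, b). if a = i \<and> b = k then 1 else 0)"
      have entry: "(\<rho> g * A * \<tau> (inv g)) $$ (i, k) = \<rho> g $$ (i, i) * \<tau> (inv g) $$ (k, k)"
        if g: "g \<in> carrier G" for g
      proof -
        have "(\<rho> g * A) $$ (i, b) = (if b = k then \<rho> g $$ (i, i) else 0)" if "b < n" for b
          using that i car(1)[OF g]
          by (simp add: A_def scalar_prod_def if_distrib[of "\<lambda>x. _ * x"] cong: if_cong)
        then show ?thesis
          using i k car(1)[OF g] car(2)[OF G.inv_closed[OF g]]
          by (simp add: scalar_prod_def A_def if_distrib[of "\<lambda>x. x * _"] cong: if_cong)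
      qed
      have "T A $$ (i, k) = 0" using zero[of A] i k by (simp add: A_def)
      then show ?thesis using i k by (simp add: T_def msum_def entry)
    qed
    then have "(\<Sum>i<N. \<Sum>k<n. \<Sum>g\<in>carrier G. \<rho> g $$ (i, i) * \<tau> (inv g) $$ (k, k)) = 0" by simp
    also have "(\<Sum>i<N. \<Sum>k<n. \<Sum>g\<in>carrier G. \<rho> g $$ (i, i) * \<tau> (inv g) $$ (k, k)) =
        (\<Sum>i<N. \<Sum>g\<in>carrier G. \<Sum>k<n. \<rho> g $$ (i, i) * \<tau> (inv g) $$ (k, k))"
      by (intro sum.cong refl sum.swap)
    also have "\<dots> = (\<Sum>g\<in>carrier G. \<Sum>i<N. \<Sum>k<n. \<rho> g $$ (i, i) * \<tau> (inv g) $$ (k, k))"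
      by (rule sum.swap)
    also have "\<dots> = (\<Sum>g\<in>carrier G. mat_trace (\<rho> g) * mat_trace (\<tau> (inv g)))"
    proof (intro sum.cong refl)
      fix g assume g: "g \<in> carrier G"
      have "dim_row (\<rho> g) = N" "dim_row (\<tau> (inv g)) = n"
        using car(1)[OF g] car(2)[OF G.inv_closed[OF g]] by auto
      then show "(\<Sum>i<N. \<Sum>k<n. \<rho> g $$ (i, i) * \<tau> (inv g) $$ (k, k)) =
          mat_trace (\<rho> g) * mat_trace (\<tau> (inv g))"
        by (simp add: mat_trace_def sum_product)
    qed
    finally show False using nz by simp
  qed
  then obtain A where A: "A \<in> carrier_mat N n" "T A \<noteq> 0\<^sub>m N n" by blast
  from schur[OF G \<rho> \<tau> TC comm[OF A(1)] A(2)] obtain Q where Nn: "N = n"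
    and Q: "Q \<in> carrier_mat n N" "T A * Q = 1\<^sub>m N" "Q * T A = 1\<^sub>m n" by blast
  have "similar_mat_wit (\<rho> g) (\<tau> g) (T A) Q" if g: "g \<in> carrier G" for g
  proof -
    have "T A * \<tau> g * Q = \<rho> g * T A * Q" using comm[OF A(1) g] by simp
    also have "\<dots> = \<rho> g * (T A * Q)" using car(1)[OF g] TC Q by (intro assoc_mult_mat[of _ N N _ n _ N]) auto
    finally have "\<rho> g = T A * \<tau> g * Q" using Q car(1)[OF g] by simp
    then show ?thesis
      using car[OF g] TC[of A] Q Nn unfolding similar_mat_wit_def Let_def by auto
  qed
  then show ?thesis using Nn unfolding equivalent_reps_def by blast
qed

lemma mat_trace_equivalent:
  assumes "equivalent_reps G \<rho> \<tau>" "g \<in> carrier G"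
  shows "mat_trace (\<rho> g) = (mat_trace (\<tau> g) :: 'k::field)"
proof -
  obtain P Q where "similar_mat_wit (\<rho> g) (\<tau> g) P Q" using assms unfolding equivalent_reps_def by blast
  then obtain n where C: "\<tau> g \<in> carrier_mat n n" "P \<in> carrier_mat n n" "Q \<in> carrier_mat n n"
    and QP: "Q * P = 1\<^sub>m n" and eq: "\<rho> g = P * \<tau> g * Q"
    unfolding similar_mat_wit_def Let_def by auto
  have "mat_trace (\<rho> g) = mat_trace (Q * (P * \<tau> g))"
    unfolding eq by (rule mat_trace_mult_comm[of _ n n]) (use C in auto)
  also have "Q * (P * \<tau> g) = \<tau> g"
    using C QP by (simp flip: assoc_mult_mat[of Q n n P n "\<tau> g" n])
  finally show ?thesis .
qed

text \<open>Over the complex numbers \<open>A\<close> has an eigenvalue \<open>c\<close>.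
  Subtracting the scalar \<open>c\<close> leaves a commuting matrix that kills an eigenvector, so it
  is not invertible and must vanish.\<close>

lemma commuting_scalar:
  fixes \<rho> :: "'a \<Rightarrow> complex mat"
  assumes G: "group G" and \<rho>: "irreducible_rep G n \<rho>" and A: "A \<in> carrier_mat n n"
    and comm: "\<And>g. g \<in> carrier G \<Longrightarrow> \<rho> g * A = A * \<rho> g"
  obtains c where "A = c \<cdot>\<^sub>m 1\<^sub>m n"
proof -
  have mr: "matrix_rep G n \<rho>" and n: "0 < n" using \<rho> by (auto simp: irreducible_rep_iff)
  obtain c where "eigenvalue A c" using spectrum_non_empty[OF A n] by (auto simp: spectrum_def)
  then obtain v where v: "v \<in> carrier_vec n" "v \<noteq> 0\<^sub>v n" "A *\<^sub>v v = c \<cdot>\<^sub>v v"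
    using A by (auto simp: eigenvalue_def eigenvector_def)
  define E where "E = A - c \<cdot>\<^sub>m 1\<^sub>m n"
  have EC: "E \<in> carrier_mat n n" using A by (auto simp: E_def)
  have Ev: "E *\<^sub>v v = 0\<^sub>v n"
    using A v by (auto simp: E_def minus_mult_distrib_mat_vec)
  have "E = 0\<^sub>m n n"
  proof (rule ccontr)
    assume "E \<noteq> 0\<^sub>m n n"
    moreover have "\<rho> g * E = E * \<rho> g" if g: "g \<in> carrier G" for g
      using matrix_repD(1)[OF mr G g] A comm[OF g]
      by (simp add: E_def mult_minus_distrib_mat[of _ n n _ n] minus_mult_distrib_mat[of _ n n _ _ n]
          mult_smult_distrib[of _ n n _ n] mult_smult_assoc_mat[of _ n n _ n])
    ultimately obtain Q where Q: "Q \<in> carrier_mat n n" "Q * E = 1\<^sub>m n"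
      using commuting_zero_or_invertible[OF G \<rho> EC] by metis
    have "v = (Q * E) *\<^sub>v v" using Q v by simp
    also have "\<dots> = Q *\<^sub>v (E *\<^sub>v v)" using Q EC v by (intro assoc_mult_mat_vec) auto
    also have "\<dots> = 0\<^sub>v n" using Ev Q by auto
    finally show False using v by simp
  qed
  have "A = E + c \<cdot>\<^sub>m 1\<^sub>m n" using A by (auto simp: E_def intro!: eq_matI)
  also have "\<dots> = c \<cdot>\<^sub>m 1\<^sub>m n" using \<open>E = 0\<^sub>m n n\<close> by simp
  finally show ?thesis using that by blast
qed

text \<open>Scalar matrices leave the line of the first unit vector invariant, and in dimension
  above 1 this line misses the second unit vector.\<close>

lemma scalar_irreducible_dim:
  fixes \<rho> :: "'a \<Rightarrow> 'k::field mat"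
  assumes \<rho>: "irreducible_rep G n \<rho>" and sc: "\<And>g. g \<in> carrier G \<Longrightarrow> \<exists>c. \<rho> g = c \<cdot>\<^sub>m 1\<^sub>m n"
  shows "n = 1"
proof (rule ccontr)
  assume "n \<noteq> 1"
  then have n: "1 < n" using \<rho> by (auto simp: irreducible_rep_iff)
  define W where "W = (\<lambda>c :: 'k. c \<cdot>\<^sub>v unit_vec n 0) ` UNIV"
  have "rep_invariant G n \<rho> W"
    unfolding rep_invariant_def
  proof (intro conjI ballI allI)
    show "0\<^sub>v n \<in> W" unfolding W_def by (rule image_eqI[of _ _ 0]) auto
    show "v + w \<in> W" if "v \<in> W" "w \<in> W" for v w
      using that by (auto simp: W_def simp flip: add_smult_distrib_vec)
    show "c \<cdot>\<^sub>v v \<in> W" if "v \<in> W" for c v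
      using that by (auto simp: W_def smult_smult_assoc)
    show "\<rho> g *\<^sub>v v \<in> W" if g: "g \<in> carrier G" and v: "v \<in> W" for g v
    proof -
      obtain c d where "\<rho> g = c \<cdot>\<^sub>m 1\<^sub>m n" "v = d \<cdot>\<^sub>v unit_vec n 0"
        using sc[OF g] v unfolding W_def by blast
      then have "\<rho> g *\<^sub>v v = (c * d) \<cdot>\<^sub>v unit_vec n 0"
        by (intro eq_vecI) auto
      then show ?thesis by (simp add: W_def)
    qed
  qed (auto simp: W_def)
  moreover have "unit_vec n 0 \<in> W" unfolding W_def by (rule image_eqI[of _ _ 1]) auto
  moreover have "unit_vec n 0 \<noteq> (0\<^sub>v n :: 'k vec)" using n by simp
  ultimately have "W = carrier_vec n" using \<rho> by (auto simp: irreducible_rep_iff)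
  then have "unit_vec n 1 \<in> W" by simp
  then obtain c :: 'k where c: "unit_vec n 1 = c \<cdot>\<^sub>v unit_vec n 0" by (auto simp: W_def)
  from arg_cong[OF c, of "\<lambda>v. v $ 1"] n show False by simp
qed

lemma irreducible_rep_dim_1:
  assumes "matrix_rep G 1 \<rho>"
  shows "irreducible_rep G 1 (\<rho> :: 'a \<Rightarrow> 'k::field mat)"
  unfolding irreducible_rep_iff
proof (intro conjI allI impI assms)
  fix W :: "'k vec set" assume W: "rep_invariant G 1 \<rho> W"
  show "W = {0\<^sub>v 1} \<or> W = carrier_vec 1"
  proof (cases "W = {0\<^sub>v 1}")
    case False
    then obtain v where v: "v \<in> W" "v \<noteq> 0\<^sub>v 1" using W by (auto simp: rep_invariant_def)
    then have vC: "v \<in> carrier_vec 1" using W by (auto simp: rep_invariant_def)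
    then have "v $ 0 \<noteq> 0" using v(2) by (metis carrier_vecD eq_vecI index_zero_vec less_one)
    then have "unit_vec 1 0 = inverse (v $ 0) \<cdot>\<^sub>v v" using vC by (intro eq_vecI) auto
    then have "unit_vec 1 0 \<in> W" using W v by (simp add: rep_invariant_def)
    then show ?thesis using unit_vec_span[OF W] by simp
  qed simp
qed simp

text \<open>The value 1 at the identity is the trace of an identity matrix, so the degree is 1 and
  the character is the single matrix entry. The vanishing clause mirrors the normalisation in
  \<open>character\<close>.\<close>

lemma lin_iff:
  assumes A: "group A"
  shows "\<psi> \<in> lin A \<longleftrightarrow> (\<forall>g \<in> carrier A. \<forall>h \<in> carrier A. \<psi> (g \<otimes>\<^bsub>A\<^esub> h) = \<psi> g * \<psi> h) \<and>
      \<psi> \<one>\<^bsub>A\<^esub> = 1 \<and> (\<forall>g. g \<notin> carrier A \<longrightarrow> \<psi> g = 0)" (is "_ \<longleftrightarrow> ?R")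
proof
  interpret A: group A by fact
  assume "\<psi> \<in> lin A"
  then obtain n \<rho> where \<rho>: "irreducible_rep A n \<rho>" and \<psi>: "\<psi> = character A \<rho>" and one: "\<psi> \<one>\<^bsub>A\<^esub> = 1"
    by (auto simp: lin_def Irr_def)
  have mr: "matrix_rep A n \<rho>" using \<rho> by (simp add: irreducible_rep_iff)
  note D = matrix_repD[OF mr A]
  have n: "n = 1" using one by (simp add: \<psi> character_def D(3))
  have "\<psi> g = \<rho> g $$ (0, 0)" if "g \<in> carrier A" for g
    using D(1)[OF that] that n by (simp add: \<psi> character_def mat_trace_def)
  moreover have "\<rho> (g \<otimes>\<^bsub>A\<^esub> h) $$ (0, 0) = \<rho> g $$ (0, 0) * \<rho> h $$ (0, 0)" if "g \<in> carrier A" "h \<in> carrier A" for g h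
    using D(1)[OF that(1)] D(1)[OF that(2)] n by (simp add: D(2)[OF that] scalar_prod_def)
  ultimately show ?R using one by (auto simp: \<psi> character_def)
next
  assume R: ?R
  let ?\<rho> = "\<lambda>g. mat 1 1 (\<lambda>_. \<psi> g)"
  have "matrix_rep A 1 ?\<rho>"
    using R by (intro matrix_repI[OF A]) (auto intro!: eq_matI simp: scalar_prod_def)
  then have "irreducible_rep A 1 ?\<rho>" by (rule irreducible_rep_dim_1)
  moreover have "\<psi> = character A ?\<rho>"
    using R by (auto simp: character_def mat_trace_def fun_eq_iff)
  ultimately show "\<psi> \<in> lin A" using R by (auto simp: lin_def Irr_def)
qed

lemma Irr_comm_group:
  assumes "comm_group A"
  shows "Irr A = lin A"
proof -
  interpret A: comm_group A by fact
  have "\<psi> \<one>\<^bsub>A\<^esub> = 1" if \<psi>: "\<psi> \<in> Irr A" for \<psi>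
  proof -
    obtain n \<rho> where \<rho>: "irreducible_rep A n \<rho>" and \<psi>: "\<psi> = character A \<rho>"
      using \<psi> by (auto simp: Irr_def)
    have mr: "matrix_rep A n \<rho>" using \<rho> by (simp add: irreducible_rep_iff)
    note D = matrix_repD[OF mr A.is_group]
    have "\<exists>c. \<rho> g = c \<cdot>\<^sub>m 1\<^sub>m n" if g: "g \<in> carrier A" for g
    proof -
      have "\<rho> h * \<rho> g = \<rho> g * \<rho> h" if "h \<in> carrier A" for h
        using that g by (metis A.m_comm D(2))
      then show ?thesis by (metis commuting_scalar[OF A.is_group \<rho> D(1)[OF g]])
    qed
    then have "n = 1" by (rule scalar_irreducible_dim[OF \<rho>])
    then show ?thesis by (simp add: \<psi> character_def D(3))
  qed
  then show ?thesis by (auto simp: lin_def)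
qed

section \<open>Induction from a polarization\<close>

text \<open>In a finite group the inverse of \<open>a\<close> is its power with exponent the group
  order minus 1, so closure under products suffices. Most subgroup claims below reduce to such a
  product check.\<close>

lemma (in group) finite_submonoid_subgroup:
  assumes "finite (carrier G)" and S: "S \<subseteq> carrier G" "\<one> \<in> S"
    and mult: "\<And>a b. a \<in> S \<Longrightarrow> b \<in> S \<Longrightarrow> a \<otimes> b \<in> S"
  shows "subgroup S G"
proof (rule subgroupI)
  fix a assume a: "a \<in> S"
  then have aG: "a \<in> carrier G" using S by auto
  have pow: "a [^] n \<in> S" for n :: nat by (induction n) (use S a mult in auto)
  have "card (carrier G) > 0" using assms(1) one_closed by (auto simp: card_gt_0_iff)
  then have "a [^] (card (carrier G) - 1) \<otimes> a = a [^] card (carrier G)"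
    by (metis Suc_diff_1 nat_pow_Suc)
  also have "\<dots> = \<one>" using pow_order_eq_1[OF aG] by (simp add: Coset.order_def)
  finally have "inv a = a [^] (card (carrier G) - 1)" using aG by (simp add: inv_equality)
  then show "inv a \<in> S" using pow by simp
qed (use S mult in auto)

lemma msum_mult_vec_index:
  assumes f: "\<And>s. s \<in> S \<Longrightarrow> f s \<in> carrier_mat N n" and v: "v \<in> carrier_vec n" and r: "r < N"
  shows "(msum N n f S *\<^sub>v v) $ r = (\<Sum>s\<in>S. (f s *\<^sub>v v) $ r)"
proof -
  have "(msum N n f S *\<^sub>v v) $ r = (\<Sum>k<n. \<Sum>s\<in>S. f s $$ (r, k) * v $ k)"
    using v r by (simp add: msum_def scalar_prod_def atLeast0LessThan sum_distrib_right)
  also have "\<dots> = (\<Sum>s\<in>S. (f s *\<^sub>v v) $ r)"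
    by (subst sum.swap) (use v r in \<open>auto simp: scalar_prod_def atLeast0LessThan dest!: f intro!: sum.cong\<close>)
  finally show ?thesis .
qed

lemma msum_mult_vec_mem:
  assumes W: "rep_invariant G N \<rho> W" and "finite S" and v: "v \<in> carrier_vec N"
    and "\<And>s. s \<in> S \<Longrightarrow> f s \<in> carrier_mat N N" and "\<And>s. s \<in> S \<Longrightarrow> f s *\<^sub>v v \<in> W"
  shows "msum N N f S *\<^sub>v v \<in> W"
  using assms(2,4,5)
proof (induction S rule: finite_induct)
  case empty
  have "msum N N f {} *\<^sub>v v = 0\<^sub>v N" using v by (auto simp: msum_def scalar_prod_def)
  then show ?case using W by (simp add: rep_invariant_def)
next
  case (insert s S)
  have "msum N N f (insert s S) *\<^sub>v v = f s *\<^sub>v v + msum N N f S *\<^sub>v v"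
  proof (rule eq_vecI)
    fix r assume "r < dim_vec (f s *\<^sub>v v + msum N N f S *\<^sub>v v)"
    then have r: "r < N" by (simp add: msum_def)
    then show "(msum N N f (insert s S) *\<^sub>v v) $ r = (f s *\<^sub>v v + msum N N f S *\<^sub>v v) $ r"
      using insert msum_mult_vec_index[of "insert s S" f N N v r] msum_mult_vec_index[of S f N N v r] v
      by (simp add: msum_def)
  qed (simp add: msum_def)
  then show ?case using insert W by (simp add: rep_invariant_def)
qed

text \<open>Splits an index into block number and position within the block, in the layout of
  \<open>induced_rep\<close>.\<close>

lemma sum_lessThan_mult:
  fixes f :: "nat \<Rightarrow> 'k::comm_monoid_add"
  shows "(\<Sum>s<m * n. f s) = (\<Sum>j<m. \<Sum>q<n. f (j * n + q))"
proof -
  have "(\<Sum>s<m * n. f s) = (\<Sum>(j, q)\<in>{..<m} \<times> {..<n}. f (j * n + q))"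
  proof (rule sum.reindex_bij_witness[of _ "\<lambda>(j, q). j * n + q" "\<lambda>s. (s div n, s mod n)"])
    fix s assume "s \<in> {..<m * n}"
    then have s: "s < m * n" by simp
    then have "n > 0" by (cases n) auto
    then show "(s div n, s mod n) \<in> {..<m} \<times> {..<n}" using s by (simp add: less_mult_imp_div_less)
  next
    fix jq assume "jq \<in> {..<m} \<times> {..<n}"
    then obtain j q where jq: "jq = (j, q)" "j < m" "q < n" by auto
    then have "j * n + q < Suc j * n" by simp
    also have "\<dots> \<le> m * n" using jq by (intro mult_le_mono1) simp
    finally show "(case jq of (j, q) \<Rightarrow> j * n + q) \<in> {..<m * n}" using jq by simp
  qed auto
  then show ?thesis by (simp add: sum.cartesian_product)
qed

text \<open>
  The last assumption makes the conjugates, by representatives of the cosets of \<open>H\<close>, of a linear character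
  of \<open>H\<close> that is trivial on \<open>K\<close> and faithful on the center pairwise distinct on \<open>K\<close>.
\<close>

locale polarized = group G for G :: "('a, 'b) monoid_scheme" (structure) +
  fixes p :: nat and K H :: "'a set"
  assumes p: "Factorial_Ring.prime p"
    and fin: "finite (carrier G)"
    and card_center: "card (center G) = p"
    and commutators: "g \<in> carrier G \<Longrightarrow> h \<in> carrier G \<Longrightarrow> inv g \<otimes> inv h \<otimes> g \<otimes> h \<in> center G"
    and K: "subgroup K G" and H: "subgroup H G"
    and KH: "K \<subseteq> H" and ZH: "center G \<subseteq> H"
    and H_comm: "g \<in> H \<Longrightarrow> h \<in> H \<Longrightarrow> g \<otimes> h = h \<otimes> g"
    and centralizer: "g \<in> carrier G \<Longrightarrow> (\<And>k. k \<in> K \<Longrightarrow> k \<otimes> g = g \<otimes> k) \<Longrightarrow> g \<in> H"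
begin

abbreviation "Z \<equiv> center G"

lemma Z_carrier: "c \<in> Z \<Longrightarrow> c \<in> carrier G" by (simp add: center_def)
lemma Z_comm: "c \<in> Z \<Longrightarrow> g \<in> carrier G \<Longrightarrow> c \<otimes> g = g \<otimes> c" by (simp add: center_def)
lemma H_carrier: "h \<in> H \<Longrightarrow> h \<in> carrier G" using subgroup.mem_carrier[OF H] .
lemma K_carrier: "h \<in> K \<Longrightarrow> h \<in> carrier G" using subgroup.mem_carrier[OF K] .

lemma Z_I: "a \<in> carrier G \<Longrightarrow> (\<And>g. g \<in> carrier G \<Longrightarrow> a \<otimes> g = g \<otimes> a) \<Longrightarrow> a \<in> Z"
  unfolding center_def by blast

lemma Z: "subgroup Z G"
proof (rule finite_submonoid_subgroup[OF fin])
  show "a \<otimes> b \<in> Z" if ab: "a \<in> Z" "b \<in> Z" for a b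
  proof (rule Z_I)
    note car = ab[THEN Z_carrier]
    show "a \<otimes> b \<in> carrier G" using car by simp
    fix g assume g: "g \<in> carrier G"
    have "a \<otimes> b \<otimes> g = a \<otimes> (g \<otimes> b)" using car g by (simp add: m_assoc Z_comm[OF ab(2) g])
    also have "\<dots> = g \<otimes> (a \<otimes> b)" using car g by (simp add: m_assoc[symmetric] Z_comm[OF ab(1) g])
    finally show "a \<otimes> b \<otimes> g = g \<otimes> (a \<otimes> b)" .
  qed
qed (auto simp: center_def)

lemma finite_Z: "finite Z" using fin by (rule finite_subset[rotated]) (auto simp: center_def)
lemma finite_K: "finite K" using fin by (rule finite_subset[rotated]) (auto intro: K_carrier)
lemma groups: "group (subgrp G Z)" "group (subgrp G H)" "group (subgrp G K)"
  using subgroup.subgroup_is_group Z H K is_group by blast+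

text \<open>The center has prime order. Recurring use: a condition on central elements that is
  stable under products and holds at the identity and at one nontrivial \<open>c\<close> holds on
  all of \<open>Z\<close>.\<close>

lemma subgroup_of_Z:
  assumes S: "subgroup S G" and "S \<subseteq> Z" and c: "c \<in> S" "c \<noteq> \<one>"
  shows "S = Z"
proof -
  interpret Zg: group "subgrp G Z" by (rule groups)
  have "subgroup S (subgrp G Z)"
    using S assms(2) Z by (intro subgroup_incl)
  then have "card S dvd Coset.order (subgrp G Z)"
    using Zg.lagrange by (metis dvd_triv_right)
  then have "card S dvd p" by (simp add: Coset.order_def card_center)
  moreover have "card S \<noteq> 1"
  proof
    assume "card S = 1"
    then have "S = {\<one>}" using subgroup.one_closed[OF S] by (metis card_1_singletonE singletonD)
    then show False using c by simp
  qed
  ultimately have "card S = card Z" using p card_center by (auto simp: prime_nat_iff)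
  then show ?thesis using assms(2) finite_Z by (metis card_subset_eq)
qed

text \<open>Conjugation by \<open>t\<close> multiplies \<open>g\<close> by the commutator of
  \<open>g\<close> and \<open>t\<close>, which is central by \<open>commutators\<close>.\<close>

lemma conj_eq: 
  assumes "g \<in> carrier G" "t \<in> carrier G"
  obtains c where "c \<in> Z" "inv t \<otimes> g \<otimes> t = g \<otimes> c" "c = \<one> \<longleftrightarrow> g \<otimes> t = t \<otimes> g"
proof
  let ?c = "inv g \<otimes> inv t \<otimes> g \<otimes> t"
  show "?c \<in> Z" using assms by (rule commutators)
  show eq: "inv t \<otimes> g \<otimes> t = g \<otimes> ?c" using assms by (simp add: m_assoc[symmetric])
  show "?c = \<one> \<longleftrightarrow> g \<otimes> t = t \<otimes> g"
  proof
    assume c: "?c = \<one>"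
    have "t \<otimes> (inv t \<otimes> g \<otimes> t) = t \<otimes> g" unfolding eq c using assms by simp
    moreover have "t \<otimes> (inv t \<otimes> g \<otimes> t) = g \<otimes> t" using assms by (simp add: m_assoc[symmetric])
    ultimately show "g \<otimes> t = t \<otimes> g" by simp
  next
    assume comm: "g \<otimes> t = t \<otimes> g"
    have "?c = inv g \<otimes> inv t \<otimes> (g \<otimes> t)" using assms by (simp add: m_assoc)
    also have "\<dots> = \<one>" unfolding comm using assms by (simp add: inv_mult_group[symmetric])
    finally show "?c = \<one>" .
  qed
qed

lemma H_conj: "t \<in> carrier G \<Longrightarrow> h \<in> H \<Longrightarrow> inv t \<otimes> h \<otimes> t \<in> H"
  by (metis conj_eq H_carrier ZH subsetD subgroup.m_closed[OF H])

text \<open>The \<open>d\<close> with \<open>A * \<rho> d = A\<close> form a subgroup of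
  \<open>Z\<close>, hence all of it. Summing over \<open>Z\<close> gives \<open>p\<close> times
  \<open>A\<close> on one side and zero on the other.\<close>

lemma msum_center_fixed:
  assumes \<rho>: "matrix_rep (subgrp G Z) n \<rho>" and sum: "msum n n \<rho> Z = 0\<^sub>m n n"
    and A: "A \<in> carrier_mat m n" and c: "c \<in> Z" "c \<noteq> \<one>" and fixed: "A * \<rho> c = A"
  shows "A = (0\<^sub>m m n :: 'k::field_char_0 mat)"
proof -
  note D = matrix_repD[OF \<rho> groups(1), simplified]
  define S where "S = {d \<in> Z. A * \<rho> d = A}"
  have mult: "A * \<rho> (d \<otimes> e) = A * \<rho> d * \<rho> e" if "d \<in> Z" "e \<in> Z" for d e
    using D(1)[OF that(1)] D(1)[OF that(2)] A by (simp add: D(2)[OF that])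
  have "S = Z"
  proof (rule subgroup_of_Z)
    show "subgroup S G"
    proof (rule finite_submonoid_subgroup[OF fin])
      show "S \<subseteq> carrier G" by (auto simp: S_def Z_carrier)
      show "\<one> \<in> S" using D(3) A subgroup.one_closed[OF Z] by (simp add: S_def)
      show "d \<otimes> e \<in> S" if "d \<in> S" "e \<in> S" for d e
        using that mult[of d e] subgroup.m_closed[OF Z] by (auto simp: S_def)
    qed
  qed (use c fixed in \<open>auto simp: S_def\<close>)
  then have "A * \<rho> d = A" if "d \<in> Z" for d using that by (auto simp: S_def)
  then have "msum m n (\<lambda>d. A * \<rho> d) Z = msum m n (\<lambda>d. A) Z" by (rule msum_cong)
  then have "of_nat p \<cdot>\<^sub>m A = msum m n (\<lambda>d. A * \<rho> d) Z"
    using A card_center by (simp add: msum_const)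
  also have "\<dots> = A * msum n n \<rho> Z" using A D(1) by (intro mult_msum[symmetric])
  also have "\<dots> = 0\<^sub>m m n" using A sum by simp
  finally have "of_nat p \<cdot>\<^sub>m A = 0\<^sub>m m n" .
  then have "of_nat p * A $$ (i, j) = 0" if "i < m" "j < n" for i j
    using A that by (metis carrier_matD index_smult_mat(1) index_zero_mat(1))
  moreover have "(of_nat p :: 'k) \<noteq> 0" using p by (simp add: prime_gt_0_nat)
  ultimately show ?thesis using A by (intro eq_matI) auto
qed

text \<open>A noncentral \<open>g\<close> is conjugate to every element of its coset modulo the
  center: the \<open>e\<close> for which \<open>g\<close> is conjugate to
  \<open>g \<otimes> e\<close> form a nontrivial subgroup of \<open>Z\<close>. So the trace is
  constant on the coset, while its sum there is the trace of \<open>\<rho> g\<close> times a zero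
  matrix.\<close>

lemma mat_trace_off_center:
  assumes \<rho>: "matrix_rep G n \<rho>" and sum: "msum n n \<rho> Z = 0\<^sub>m n n" and g: "g \<in> carrier G" "g \<notin> Z"
  shows "mat_trace (\<rho> g) = (0 :: 'k::field_char_0)"
proof -
  note D = matrix_repD[OF \<rho> is_group]
  have "\<exists>w \<in> carrier G. g \<otimes> w \<noteq> w \<otimes> g" using g by (auto simp: center_def)
  then obtain w where w: "w \<in> carrier G" "g \<otimes> w \<noteq> w \<otimes> g" by blast
  from conj_eq[OF g(1) w(1)] w(2) obtain c where c: "c \<in> Z" "inv w \<otimes> g \<otimes> w = g \<otimes> c" "c \<noteq> \<one>" by metis
  have conj: "mat_trace (\<rho> (inv w \<otimes> x \<otimes> w)) = mat_trace (\<rho> x)" if "w \<in> carrier G" "x \<in> carrier G" for w x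
  proof -
    have "mat_trace (\<rho> (inv w \<otimes> x \<otimes> w)) = mat_trace (\<rho> (inv w \<otimes> x) * \<rho> w)"
      using that by (simp add: D(2))
    also have "\<dots> = mat_trace (\<rho> w * \<rho> (inv w \<otimes> x))"
      using that D(1) by (intro mat_trace_mult_comm[of _ n n]) auto
    also have "\<rho> w * \<rho> (inv w \<otimes> x) = \<rho> x"
      using that by (simp flip: D(2) m_assoc)
    finally show ?thesis .
  qed
  define S where "S = {e \<in> Z. \<exists>w\<in>carrier G. inv w \<otimes> g \<otimes> w = g \<otimes> e}"
  have "S = Z"
  proof (rule subgroup_of_Z[of _ c])
    show "subgroup S G"
    proof (rule finite_submonoid_subgroup[OF fin])
      show "S \<subseteq> carrier G" by (auto simp: S_def Z_carrier)
      show "\<one> \<in> S" using g(1) subgroup.one_closed[OF Z] by (auto simp: S_def intro!: bexI[of _ \<one>])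
      fix d e assume "d \<in> S" "e \<in> S"
      then obtain v w where d: "d \<in> Z" "v \<in> carrier G" "inv v \<otimes> g \<otimes> v = g \<otimes> d"
        and e: "e \<in> Z" "w \<in> carrier G" "inv w \<otimes> g \<otimes> w = g \<otimes> e" by (auto simp: S_def)
      note car = g(1) d(2) e(2) Z_carrier[OF d(1)] Z_carrier[OF e(1)]
      have "inv (v \<otimes> w) \<otimes> g \<otimes> (v \<otimes> w) = inv w \<otimes> (inv v \<otimes> g \<otimes> v) \<otimes> w"
        using car by (simp add: inv_mult_group m_assoc)
      also have "\<dots> = inv w \<otimes> g \<otimes> (d \<otimes> w)" using car by (simp add: d m_assoc)
      also have "d \<otimes> w = w \<otimes> d" using d e by (intro Z_comm)
      also have "inv w \<otimes> g \<otimes> (w \<otimes> d) = inv w \<otimes> g \<otimes> w \<otimes> d" using car by (simp add: m_assoc)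
      also have "\<dots> = g \<otimes> (e \<otimes> d)" using car by (simp add: e m_assoc)
      also have "e \<otimes> d = d \<otimes> e" using e car by (intro Z_comm)
      finally have "inv (v \<otimes> w) \<otimes> g \<otimes> (v \<otimes> w) = g \<otimes> (d \<otimes> e)" .
      then show "d \<otimes> e \<in> S" using d e subgroup.m_closed[OF Z] m_closed unfolding S_def by blast
    qed
  qed (use c w in \<open>auto simp: S_def\<close>)
  have tr: "mat_trace (\<rho> (g \<otimes> e)) = mat_trace (\<rho> g)" if "e \<in> Z" for e
  proof -
    have "e \<in> S" using that \<open>S = Z\<close> by simp
    then obtain v where "v \<in> carrier G" "inv v \<otimes> g \<otimes> v = g \<otimes> e" by (auto simp: S_def)
    then show ?thesis using conj[of v g] g(1) by simp
  qed
  have "of_nat p * mat_trace (\<rho> g) = (\<Sum>e\<in>Z. mat_trace (\<rho> (g \<otimes> e)))"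
    using tr card_center by simp
  also have "\<dots> = mat_trace (msum n n (\<lambda>e. \<rho> g * \<rho> e) Z)"
    using g D(1) Z_carrier by (subst mat_trace_msum) (auto simp: D(2) intro!: mult_carrier_mat)
  also have "msum n n (\<lambda>e. \<rho> g * \<rho> e) Z = \<rho> g * msum n n \<rho> Z"
    using g D(1) Z_carrier by (intro mult_msum[symmetric]) auto
  also have "\<dots> = 0\<^sub>m n n" using sum D(1)[OF g(1)] by simp
  finally show ?thesis using p by (simp add: prime_gt_0_nat)
qed

text \<open>By \<open>centralizer\<close> some \<open>k\<close> in \<open>K\<close> does not commute
  with \<open>t\<close>; its conjugate is \<open>k \<otimes> c\<close> with \<open>c\<close> central
  and nontrivial. Replacing \<open>l\<close> by \<open>l \<otimes> k\<close> shows the sum to be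
  fixed by \<open>\<Psi> c\<close>, so \<open>msum_center_fixed\<close> kills it. This is
  orthogonality of the trivial character of \<open>K\<close> to a conjugate one, in a form valid for
  \<open>\<Psi>\<close> of any degree.\<close>

lemma msum_conj_K:
  assumes \<Psi>: "matrix_rep (subgrp G H) n \<Psi>" and sum: "msum n n \<Psi> Z = 0\<^sub>m n n"
    and triv: "\<And>k. k \<in> K \<Longrightarrow> \<Psi> k = 1\<^sub>m n" and t: "t \<in> carrier G" "t \<notin> H"
  shows "msum n n (\<lambda>k. \<Psi> (inv t \<otimes> k \<otimes> t)) K = (0\<^sub>m n n :: 'k::field_char_0 mat)"
proof -
  note D = matrix_repD[OF \<Psi> groups(2), simplified]
  obtain k where k: "k \<in> K" "k \<otimes> t \<noteq> t \<otimes> k" using t centralizer[of t] by blast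
  from conj_eq[OF K_carrier[OF k(1)] t(1)] k(2) obtain c
    where c: "c \<in> Z" "inv t \<otimes> k \<otimes> t = k \<otimes> c" "c \<noteq> \<one>" by metis
  have cH: "c \<in> H" and kH: "k \<in> H" using c ZH k KH by auto
  let ?M = "msum n n (\<lambda>k. \<Psi> (inv t \<otimes> k \<otimes> t)) K"
  have mem: "inv t \<otimes> l \<otimes> t \<in> H" if "l \<in> K" for l using that KH t H_conj by blast
  have "?M * \<Psi> c = msum n n (\<lambda>l. \<Psi> (inv t \<otimes> l \<otimes> t) * \<Psi> c) K"
    by (rule msum_mult) (use D cH mem in auto)
  also have "\<dots> = ?M"
  proof (rule msum_reindex_bij_witness[of _ "\<lambda>l. l \<otimes> inv k" "\<lambda>l. l \<otimes> k"])
    fix l assume l: "l \<in> K"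
    note car = K_carrier[OF l] K_carrier[OF k(1)] t(1) Z_carrier[OF c(1)]
    show "l \<otimes> k \<otimes> inv k = l" "l \<otimes> inv k \<otimes> k = l" using car by (simp_all add: m_assoc)
    show "l \<otimes> k \<in> K" "l \<otimes> inv k \<in> K" using l k K by (simp_all add: subgroup.m_closed subgroup.m_inv_closed)
    have "inv t \<otimes> (l \<otimes> k) \<otimes> t = (inv t \<otimes> l \<otimes> t) \<otimes> (inv t \<otimes> k \<otimes> t)"
    proof -
      have "(inv t \<otimes> l \<otimes> t) \<otimes> (inv t \<otimes> k \<otimes> t) = inv t \<otimes> l \<otimes> (t \<otimes> inv t) \<otimes> k \<otimes> t"
        using car by (simp only: m_assoc m_closed inv_closed)
      then show ?thesis using car by (simp add: m_assoc)
    qed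
    also have "\<dots> = (inv t \<otimes> l \<otimes> t) \<otimes> (k \<otimes> c)" by (simp add: c)
    finally have "\<Psi> (inv t \<otimes> (l \<otimes> k) \<otimes> t) = \<Psi> (inv t \<otimes> l \<otimes> t) * \<Psi> (k \<otimes> c)"
      using D(2)[OF mem[OF l], of "k \<otimes> c"] kH cH subgroup.m_closed[OF H] by simp
    also have "\<Psi> (k \<otimes> c) = \<Psi> c" using D(2)[OF kH cH] triv[OF k(1)] D(1)[OF cH] by simp
    finally show "\<Psi> (inv t \<otimes> (l \<otimes> k) \<otimes> t) = \<Psi> (inv t \<otimes> l \<otimes> t) * \<Psi> c" .
  qed
  finally have fixed: "?M * \<Psi> c = ?M" .
  have "matrix_rep (subgrp G Z) n \<Psi>"
    using groups(1) D ZH by (intro matrix_repI) auto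
  then show ?thesis using msum_center_fixed[OF _ sum _ c(1,3) fixed] by simp
qed

end

text \<open>The space of an induced representation is a direct sum of copies of the space of
  \<open>\<Psi>\<close>, one for each coset; \<open>blk\<close> and \<open>blk_emb\<close> are its
  projections and inclusions.\<close>

definition blk :: "nat \<Rightarrow> nat \<Rightarrow> 'k vec \<Rightarrow> 'k vec" where
  "blk n i v = vec n (\<lambda>q. v $ (i * n + q))"

definition blk_emb :: "nat \<Rightarrow> nat \<Rightarrow> nat \<Rightarrow> 'k::zero vec \<Rightarrow> 'k vec" where
  "blk_emb m n i w = vec (m * n) (\<lambda>r. if r div n = i then w $ (r mod n) else 0)"

lemma blk_index_less: "i < m \<Longrightarrow> q < n \<Longrightarrow> i * n + q < m * (n :: nat)"
proof -
  assume iq: "i < m" "q < n"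
  then have "i * n + q < Suc i * n" by simp
  also have "\<dots> \<le> m * n" using iq by (intro mult_le_mono1) simp
  finally show ?thesis .
qed

lemma blk_carrier [simp]: "blk n i v \<in> carrier_vec n" by (simp add: blk_def)
lemma dim_blk [simp]: "dim_vec (blk n i v) = n" by (simp add: blk_def)
lemma blk_emb_carrier [simp]: "blk_emb m n i w \<in> carrier_vec (m * n)" by (simp add: blk_emb_def)

lemma blk_emb_blk:
  "i < m \<Longrightarrow> j < m \<Longrightarrow> w \<in> carrier_vec n \<Longrightarrow> blk n j (blk_emb m n i w) = (if j = i then w else 0\<^sub>v n)"
  by (auto simp: blk_def blk_emb_def blk_index_less intro!: eq_vecI)

lemma blk_eqI:
  assumes v: "v \<in> carrier_vec (m * n)" "w \<in> carrier_vec (m * n)"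
    and eq: "\<And>i. i < m \<Longrightarrow> blk n i v = blk n i w"
  shows "v = w"
proof (rule eq_vecI)
  fix r assume "r < dim_vec w"
  then have r: "r < m * n" using v by simp
  then have "n > 0" by (cases n) auto
  have "r div n < m" using r by (simp add: less_mult_imp_div_less)
  from arg_cong[OF eq[OF this], of "\<lambda>v. v $ (r mod n)"] \<open>n > 0\<close>
  show "v $ r = w $ r" by (simp add: blk_def)
qed (use v in simp)

lemma blk_emb_linear:
  assumes "w \<in> carrier_vec n" "w' \<in> carrier_vec n"
  shows "blk_emb m n i (w + w') = blk_emb m n i w + blk_emb m n i (w' :: 'k::comm_ring_1 vec)"
    and "blk_emb m n i (c \<cdot>\<^sub>v w) = c \<cdot>\<^sub>v blk_emb m n i w"
    and "blk_emb m n i (0\<^sub>v n) = (0\<^sub>v (m * n) :: 'k vec)"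
proof -
  have *: "r mod n < n" if "r < m * n" for r using that by (cases n) auto
  show "blk_emb m n i (w + w') = blk_emb m n i w + blk_emb m n i w'"
    "blk_emb m n i (c \<cdot>\<^sub>v w) = c \<cdot>\<^sub>v blk_emb m n i w"
    "blk_emb m n i (0\<^sub>v n) = (0\<^sub>v (m * n) :: 'k vec)"
    using assms * by (auto simp: blk_emb_def intro!: eq_vecI)
qed

lemma unit_vec_blk_emb:
  assumes "r < m * n"
  shows "unit_vec (m * n) r = (blk_emb m n (r div n) (unit_vec n (r mod n)) :: 'k::comm_ring_1 vec)"
proof -
  have n: "n > 0" using assms by (cases n) auto
  show ?thesis
  proof (rule eq_vecI)
    fix s assume "s < dim_vec (blk_emb m n (r div n) (unit_vec n (r mod n) :: 'k vec))"
    then have s: "s < m * n" by (simp add: blk_emb_def)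
    have "s = r \<longleftrightarrow> s div n = r div n \<and> s mod n = r mod n" by (metis div_mult_mod_eq)
    then show "unit_vec (m * n) r $ s = blk_emb m n (r div n) (unit_vec n (r mod n) :: 'k vec) $ s"
      using s n assms by (auto simp: blk_emb_def unit_vec_def)
  qed (simp add: blk_emb_def)
qed

section \<open>Block structure and irreducibility of induced representations\<close>

context polarized begin

lemma mult_cancel:
  "x \<in> carrier G \<Longrightarrow> y \<in> carrier G \<Longrightarrow> x \<otimes> (inv x \<otimes> y) = y"
  "x \<in> carrier G \<Longrightarrow> y \<in> carrier G \<Longrightarrow> inv x \<otimes> (x \<otimes> y) = y"
  by (simp_all flip: m_assoc)

context
  fixes ts :: "'a list" and \<Psi> :: "'a \<Rightarrow> 'k::field_char_0 mat" and n :: nat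
  assumes ts: "left_transversal G H ts" and \<Psi>: "matrix_rep (subgrp G H) n \<Psi>"
begin

abbreviation (input) "m \<equiv> length ts"
abbreviation (input) "ind \<equiv> induced_rep G H ts n \<Psi>"

lemma ts_carrier: "i < m \<Longrightarrow> ts ! i \<in> carrier G"
  using ts nth_mem by (auto simp: left_transversal_def)

lemma coset_eq_iff:
  assumes "x \<in> carrier G" "y \<in> carrier G"
  shows "inv x \<otimes> y \<in> H \<longleftrightarrow> x <# H = y <# H"
  using assms subgroup.lcos_module_rev[OF H is_group] subgroup.lcos_module_imp[OF H is_group]
    l_repr_independence[OF _ _ H] lcos_self[OF _ H] by metis

lemma ex1_index:
  assumes "x \<in> carrier G"
  shows "\<exists>!j. j < m \<and> inv x \<otimes> ts ! j \<in> H"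
proof -
  have bij: "bij_betw (\<lambda>i. (ts ! i) <# H) {..<m} (lcosets H)" using ts by (simp add: left_transversal_def)
  have "x <# H \<in> lcosets H" using assms by (auto simp: LCOSETS_def)
  with bij have "x <# H \<in> (\<lambda>i. (ts ! i) <# H) ` {..<m}" by (simp add: bij_betw_def)
  then obtain j where j: "j < m" "x <# H = (ts ! j) <# H" by auto
  show ?thesis
  proof (rule ex1I[of _ j])
    show "j < m \<and> inv x \<otimes> ts ! j \<in> H" using j coset_eq_iff[OF assms ts_carrier] by simp
    fix i assume i: "i < m \<and> inv x \<otimes> ts ! i \<in> H"
    then have "x <# H = (ts ! i) <# H" using coset_eq_iff[OF assms ts_carrier, of i] by blast
    with j have "(ts ! j) <# H = (ts ! i) <# H" by simp
    then show "i = j" using inj_onD[OF bij_betw_imp_inj_on[OF bij], of j i] i j by auto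
  qed
qed

lemma same_index: "i < m \<Longrightarrow> j < m \<Longrightarrow> inv (ts ! i) \<otimes> ts ! j \<in> H \<longleftrightarrow> i = j"
  using ex1_index[OF ts_carrier[of i]] ts_carrier[of i] subgroup.one_closed[OF H] by (metis l_inv)

text \<open>The coset of \<open>inv g \<otimes> ts ! i\<close> has a single representative. So every
  block row of an induced matrix has exactly one block that is not zero by definition.\<close>

lemma ex1_index_mult:
  assumes g: "g \<in> carrier G" and i: "i < m"
  shows "\<exists>!j. j < m \<and> inv (ts ! i) \<otimes> g \<otimes> ts ! j \<in> H"
  using ex1_index[of "inv g \<otimes> ts ! i"] g ts_carrier[OF i] by (simp add: inv_mult_group)

text \<open>\<open>H\<close> is normal, as it contains all commutators; its elements therefore act
  block-diagonally.\<close>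

lemma index_conj:
  assumes h: "h \<in> H" and "i < m" "j < m" 
  shows "inv (ts ! i) \<otimes> h \<otimes> ts ! j \<in> H \<longleftrightarrow> i = j"
proof
  assume "i = j"
  then show "inv (ts ! i) \<otimes> h \<otimes> ts ! j \<in> H" using H_conj[OF ts_carrier h] assms by simp
next
  assume "inv (ts ! i) \<otimes> h \<otimes> ts ! j \<in> H"
  moreover have "inv (ts ! i) \<otimes> h \<otimes> ts ! i \<in> H" using H_conj[OF ts_carrier h] assms by simp
  ultimately show "i = j" using ex1_index_mult[OF H_carrier[OF h] assms(2)] assms by blast
qed

lemmas \<Psi>D = matrix_repD[OF \<Psi> groups(2), simplified]

lemma ind_carrier: "ind g \<in> carrier_mat (m * n) (m * n)" by (simp add: induced_rep_def)

text \<open>In block row \<open>i\<close> only the block column \<open>j\<close> contributes. Later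
  identities for induced matrices are checked block by block through this formula.\<close>

lemma blk_ind:
  assumes g: "g \<in> carrier G" and v: "v \<in> carrier_vec (m * n)" and ij: "i < m" "j < m"
    and h: "inv (ts ! i) \<otimes> g \<otimes> ts ! j \<in> H"
  shows "blk n i (ind g *\<^sub>v v) = \<Psi> (inv (ts ! i) \<otimes> g \<otimes> ts ! j) *\<^sub>v blk n j v"
proof (rule eq_vecI)
  let ?h = "\<lambda>j. inv (ts ! i) \<otimes> g \<otimes> ts ! j"
  note \<Psi>h = \<Psi>D(1)[OF h]
  fix q assume "q < dim_vec (\<Psi> (?h j) *\<^sub>v blk n j v)"
  then have q: "q < n" using \<Psi>h by simp
  have "blk n i (ind g *\<^sub>v v) $ q = (\<Sum>s<m * n. ind g $$ (i * n + q, s) * v $ s)"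
    using q v ij blk_index_less[OF ij(1) q]
    by (simp add: blk_def scalar_prod_def atLeast0LessThan induced_rep_def)
  also have "\<dots> = (\<Sum>l<m. \<Sum>r<n. ind g $$ (i * n + q, l * n + r) * v $ (l * n + r))"
    by (rule sum_lessThan_mult)
  also have "\<dots> = (\<Sum>l<m. if l = j then (\<Sum>r<n. \<Psi> (?h j) $$ (q, r) * v $ (j * n + r)) else 0)"
  proof (rule sum.cong[OF refl])
    fix l assume "l \<in> {..<m}"
    then have l: "l < m" by simp
    have iff: "?h l \<in> H \<longleftrightarrow> l = j" using ex1_index_mult[OF g ij(1)] ij h l by blast
    have "ind g $$ (i * n + q, l * n + r) = (if l = j then \<Psi> (?h j) $$ (q, r) else 0)" if r: "r < n" for r
      using blk_index_less[OF ij(1) q] blk_index_less[OF l r] q r iff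
      by (simp add: induced_rep_def Let_def)
    then show "(\<Sum>r<n. ind g $$ (i * n + q, l * n + r) * v $ (l * n + r)) =
        (if l = j then (\<Sum>r<n. \<Psi> (?h j) $$ (q, r) * v $ (j * n + r)) else 0)"
      by simp
  qed
  also have "\<dots> = (\<Psi> (?h j) *\<^sub>v blk n j v) $ q"
    using ij \<Psi>h q by (simp add: scalar_prod_def atLeast0LessThan blk_def)
  finally show "blk n i (ind g *\<^sub>v v) $ q = (\<Psi> (?h j) *\<^sub>v blk n j v) $ q" .
qed (use \<Psi>D(1)[OF h] in \<open>simp add: blk_def\<close>)

lemma ind_mult_vec_carrier: "v \<in> carrier_vec (m * n) \<Longrightarrow> ind g *\<^sub>v v \<in> carrier_vec (m * n)"
  by (rule mult_mat_vec_carrier[OF ind_carrier])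

lemma matrix_rep_ind: "matrix_rep G (m * n) ind"
proof (rule matrix_repI[OF is_group ind_carrier])
  fix g h assume gh: "g \<in> carrier G" "h \<in> carrier G"
  show "ind (g \<otimes> h) = ind g * ind h"
  proof (rule mat_eq_mult_vecI[OF ind_carrier])
    show "ind g * ind h \<in> carrier_mat (m * n) (m * n)" using ind_carrier ind_carrier by (rule mult_carrier_mat)
    fix v :: "'k vec" assume v: "v \<in> carrier_vec (m * n)"
    have "(ind g * ind h) *\<^sub>v v = ind g *\<^sub>v (ind h *\<^sub>v v)"
      by (rule assoc_mult_mat_vec[OF ind_carrier ind_carrier v])
    moreover have "ind (g \<otimes> h) *\<^sub>v v = ind g *\<^sub>v (ind h *\<^sub>v v)"
    proof (rule blk_eqI)
      fix i assume i: "i < m"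
      \<comment> \<open>Row \<open>i\<close> leads through \<open>g\<close> to \<open>k\<close>, and
        from there through \<open>h\<close> to \<open>j\<close>. The representatives in the middle
        cancel, so \<open>j\<close> is also the block column that \<open>g \<otimes> h\<close>
        assigns to \<open>i\<close>.\<close>
      obtain k where k: "k < m" "inv (ts ! i) \<otimes> g \<otimes> ts ! k \<in> H" using ex1_index_mult[OF gh(1) i] by blast
      obtain j where j: "j < m" "inv (ts ! k) \<otimes> h \<otimes> ts ! j \<in> H" using ex1_index_mult[OF gh(2) k(1)] by blast
      note c = ts_carrier[OF i] ts_carrier[OF k(1)] ts_carrier[OF j(1)] gh
      have "(inv (ts ! i) \<otimes> g \<otimes> ts ! k) \<otimes> (inv (ts ! k) \<otimes> h \<otimes> ts ! j) =
          inv (ts ! i) \<otimes> g \<otimes> (ts ! k \<otimes> inv (ts ! k)) \<otimes> h \<otimes> ts ! j"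
        using c by (simp only: m_assoc m_closed inv_closed)
      then have eq: "(inv (ts ! i) \<otimes> g \<otimes> ts ! k) \<otimes> (inv (ts ! k) \<otimes> h \<otimes> ts ! j) =
          inv (ts ! i) \<otimes> (g \<otimes> h) \<otimes> ts ! j"
        using c by (simp add: m_assoc)
      have "blk n i (ind g *\<^sub>v (ind h *\<^sub>v v)) =
          \<Psi> (inv (ts ! i) \<otimes> g \<otimes> ts ! k) *\<^sub>v (\<Psi> (inv (ts ! k) \<otimes> h \<otimes> ts ! j) *\<^sub>v blk n j v)"
        using blk_ind[OF gh(1) ind_mult_vec_carrier[OF v] i k] blk_ind[OF gh(2) v k(1) j] by simp
      also have "\<dots> = \<Psi> (inv (ts ! i) \<otimes> (g \<otimes> h) \<otimes> ts ! j) *\<^sub>v blk n j v"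
        using \<Psi>D(1)[OF k(2)] \<Psi>D(1)[OF j(2)] \<Psi>D(2)[OF k(2) j(2)] eq by simp
      also have "\<dots> = blk n i (ind (g \<otimes> h) *\<^sub>v v)"
        using subgroup.m_closed[OF H k(2) j(2)] gh v i j(1) by (intro blk_ind[symmetric]) (simp_all add: eq)
      finally show "blk n i (ind (g \<otimes> h) *\<^sub>v v) = blk n i (ind g *\<^sub>v (ind h *\<^sub>v v))" by simp
    qed (use v ind_mult_vec_carrier in auto)
    ultimately show "ind (g \<otimes> h) *\<^sub>v v = (ind g * ind h) *\<^sub>v v" by simp
  qed
next
  show "ind \<one> = 1\<^sub>m (m * n)"
  proof (rule mat_eq_mult_vecI[OF ind_carrier])
    fix v :: "'k vec" assume v: "v \<in> carrier_vec (m * n)"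
    have "ind \<one> *\<^sub>v v = v"
    proof (rule blk_eqI)
      fix i assume i: "i < m"
      then have "inv (ts ! i) \<otimes> \<one> \<otimes> ts ! i = \<one>" using ts_carrier by simp
      then show "blk n i (ind \<one> *\<^sub>v v) = blk n i v"
        using blk_ind[OF one_closed v i i] subgroup.one_closed[OF H] \<Psi>D(3) by simp
    qed (use v ind_mult_vec_carrier in auto)
    then show "ind \<one> *\<^sub>v v = 1\<^sub>m (m * n) *\<^sub>v v" using v by simp
  qed simp
qed

lemma ind_blk_emb:
  assumes g: "g \<in> carrier G" and w: "w \<in> carrier_vec n" and ij: "i < m" "j < m"
    and h: "inv (ts ! j) \<otimes> g \<otimes> ts ! i \<in> H"
  shows "ind g *\<^sub>v blk_emb m n i w = blk_emb m n j (\<Psi> (inv (ts ! j) \<otimes> g \<otimes> ts ! i) *\<^sub>v w)"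
proof (rule blk_eqI)
  fix l assume l: "l < m"
  obtain k where k: "k < m" "inv (ts ! l) \<otimes> g \<otimes> ts ! k \<in> H" using ex1_index_mult[OF g l] by blast
  have "blk n l (ind g *\<^sub>v blk_emb m n i w) = \<Psi> (inv (ts ! l) \<otimes> g \<otimes> ts ! k) *\<^sub>v blk n k (blk_emb m n i w)"
    using blk_ind[OF g blk_emb_carrier l k] .
  also have "\<dots> = (if l = j then \<Psi> (inv (ts ! j) \<otimes> g \<otimes> ts ! i) *\<^sub>v w else 0\<^sub>v n)"
  proof (cases "l = j")
    case True
    then have "k = i" using ex1_index_mult[OF g l] k h ij by blast
    then show ?thesis using True ij w by (simp add: blk_emb_blk)
  next
    case False
    have "k \<noteq> i"
    proof
      assume "k = i"
      have c: "ts ! l \<in> carrier G" "ts ! j \<in> carrier G" "ts ! i \<in> carrier G"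
        using ts_carrier l ij by auto
      \<comment> \<open>Two block rows meeting the same block column have their representatives in
        one coset, so they coincide.\<close>
      have "inv (ts ! l) \<otimes> ts ! j = (inv (ts ! l) \<otimes> g \<otimes> ts ! i) \<otimes> inv (inv (ts ! j) \<otimes> g \<otimes> ts ! i)"
        using c g by (simp add: inv_mult_group m_assoc mult_cancel)
      also have "\<dots> \<in> H" using k h \<open>k = i\<close> H by (simp add: subgroup.m_closed subgroup.m_inv_closed)
      finally show False using same_index[OF l ij(2)] False by simp
    qed
    then show ?thesis using False k ij w \<Psi>D(1)[OF k(2)] by (auto simp: blk_emb_blk)
  qed
  also have "\<dots> = blk n l (blk_emb m n j (\<Psi> (inv (ts ! j) \<otimes> g \<otimes> ts ! i) *\<^sub>v w))"
    using l ij w \<Psi>D(1)[OF h] by (simp add: blk_emb_blk)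
  finally show "blk n l (ind g *\<^sub>v blk_emb m n i w) = blk n l (blk_emb m n j (\<Psi> (inv (ts ! j) \<otimes> g \<otimes> ts ! i) *\<^sub>v w))" .
qed (use ind_mult_vec_carrier blk_emb_carrier in auto)

lemma ind_center_index:
  assumes c: "c \<in> Z" and "r < m * n" "s < m * n"
  shows "ind c $$ (r, s) = (if r div n = s div n then \<Psi> c $$ (r mod n, s mod n) else 0)"
proof -
  have ij: "r div n < m" "s div n < m" using assms by (simp_all add: less_mult_imp_div_less)
  have "inv (ts ! (r div n)) \<otimes> c \<otimes> ts ! (s div n) = c" if "r div n = s div n"
    using that ij ts_carrier c Z_carrier by (simp add: Z_comm[OF c] m_assoc[symmetric])
      (simp add: Z_comm[OF c, symmetric] m_assoc)
  moreover have "inv (ts ! (r div n)) \<otimes> c \<otimes> ts ! (s div n) \<in> H \<longleftrightarrow> r div n = s div n"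
    using index_conj[of c "r div n" "s div n"] ij c ZH by blast
  ultimately show ?thesis using assms by (simp add: induced_rep_def Let_def)
qed

lemma mat_trace_ind_center:
  assumes c: "c \<in> Z"
  shows "mat_trace (ind c) = of_nat m * mat_trace (\<Psi> c)"
proof -
  have "mat_trace (ind c) = (\<Sum>r<m * n. ind c $$ (r, r))"
    using ind_carrier[of c] by (simp add: mat_trace_def)
  also have "\<dots> = (\<Sum>r<m * n. \<Psi> c $$ (r mod n, r mod n))"
    using ind_center_index[OF c] by simp
  also have "\<dots> = (\<Sum>j<m. \<Sum>q<n. \<Psi> c $$ (q, q))"
    by (simp add: sum_lessThan_mult)
  also have "\<dots> = of_nat m * mat_trace (\<Psi> c)"
    using \<Psi>D(1)[of c] c ZH by (auto simp: mat_trace_def)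
  finally show ?thesis .
qed

context
  assumes sum: "msum n n \<Psi> Z = 0\<^sub>m n n"
begin

text \<open>A central \<open>c\<close> acts by \<open>\<Psi> c\<close> on every diagonal block and
  by zero elsewhere, so the vanishing sum is inherited.\<close>

lemma msum_ind_center: "msum (m * n) (m * n) ind Z = 0\<^sub>m (m * n) (m * n)"
proof (rule eq_matI)
  fix r s assume "r < dim_row (0\<^sub>m (m * n) (m * n) :: 'k mat)" "s < dim_col (0\<^sub>m (m * n) (m * n) :: 'k mat)"
  then have rs: "r < m * n" "s < m * n" by auto
  then have "n > 0" by (cases n) auto
  then have "(\<Sum>c\<in>Z. \<Psi> c $$ (r mod n, s mod n)) = 0"
    using arg_cong[OF sum, of "\<lambda>A. A $$ (r mod n, s mod n)"] by (simp add: msum_def)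
  then show "msum (m * n) (m * n) ind Z $$ (r, s) = 0\<^sub>m (m * n) (m * n) $$ (r, s)"
    using rs by (cases "r div n = s div n") (simp_all add: msum_def ind_center_index)
qed (auto simp: msum_def)

lemma mat_trace_ind_off_center: "g \<in> carrier G \<Longrightarrow> g \<notin> Z \<Longrightarrow> mat_trace (ind g) = 0"
  by (rule mat_trace_off_center[OF matrix_rep_ind msum_ind_center])

lemma length_ts_pos: "0 < m"
  using ex1_index[OF one_closed] by auto

lemma irreducible_ind:
  assumes irr: "irreducible_rep (subgrp G H) n \<Psi>" and triv: "\<And>k. k \<in> K \<Longrightarrow> \<Psi> k = 1\<^sub>m n"
  shows "irreducible_rep G (m * n) ind"
  unfolding irreducible_rep_iff
proof (intro conjI allI impI matrix_rep_ind)
  show "0 < m * n" using irr length_ts_pos by (simp add: irreducible_rep_iff)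
  fix W assume W: "rep_invariant G (m * n) ind W"
  have W_act: "ind g *\<^sub>v v \<in> W" if "g \<in> carrier G" "v \<in> W" for g v
    using W that by (simp add: rep_invariant_def)
  show "W = {0\<^sub>v (m * n)} \<or> W = carrier_vec (m * n)"
  proof (cases "W = {0\<^sub>v (m * n)}")
    case False
    then obtain v where v: "v \<in> W" "v \<noteq> 0\<^sub>v (m * n)" using W by (auto simp: rep_invariant_def)
    have vC: "v \<in> carrier_vec (m * n)" using v W by (auto simp: rep_invariant_def)
    have blk0: "blk n i (0\<^sub>v (m * n)) = (0\<^sub>v n :: 'k vec)" if "i < m" for i
      using that by (auto simp: blk_def blk_index_less)
    obtain i where i: "i < m" "blk n i v \<noteq> 0\<^sub>v n"
      using blk_eqI[OF vC zero_carrier_vec] v(2) blk0 by metis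
    note ti = ts_carrier[OF i(1)]
    let ?c = "\<lambda>k. ts ! i \<otimes> k \<otimes> inv (ts ! i)"
    have cH: "?c k \<in> H" if "k \<in> H" for k using H_conj[of "inv (ts ! i)" k] that ti by simp
    have cK: "?c k \<in> H" if "k \<in> K" for k using cH that KH by blast
    define E where "E = msum (m * n) (m * n) (\<lambda>k. ind (?c k)) K"
    have Ev: "E *\<^sub>v v \<in> W"
      unfolding E_def using W finite_K vC ind_carrier W_act v(1) cK H_carrier
      by (intro msum_mult_vec_mem) auto
    have "E *\<^sub>v v = blk_emb m n i (of_nat (card K) \<cdot>\<^sub>v blk n i v)"
    proof (rule blk_eqI)
      show "E *\<^sub>v v \<in> carrier_vec (m * n)" using Ev W by (auto simp: rep_invariant_def)
      fix j assume j: "j < m"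
      note tj = ts_carrier[OF j]
      \<comment> \<open>\<open>?t\<close> compares coset \<open>j\<close> with coset
        \<open>i\<close>. In block \<open>j\<close> the operator \<open>E\<close> is the sum of
        \<open>\<Psi>\<close> over the conjugates of \<open>K\<close> by \<open>?t\<close>: the
        identity taken \<open>card K\<close> times if \<open>j = i\<close>, and zero by
        \<open>msum_conj_K\<close> otherwise.\<close>
      let ?t = "inv (ts ! i) \<otimes> ts ! j"
      have inner: "inv (ts ! j) \<otimes> ?c k \<otimes> ts ! j = inv ?t \<otimes> k \<otimes> ?t" if "k \<in> K" for k
        using ti tj K_carrier[OF that] by (simp add: inv_mult_group m_assoc)
      have innerH: "inv ?t \<otimes> k \<otimes> ?t \<in> H" if "k \<in> K" for k
        using that KH ti tj by (intro H_conj) auto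
      have blkE: "blk n j (E *\<^sub>v v) = msum n n (\<lambda>k. \<Psi> (inv ?t \<otimes> k \<otimes> ?t)) K *\<^sub>v blk n j v"
      proof (rule eq_vecI)
        fix q assume "q < dim_vec (msum n n (\<lambda>k. \<Psi> (inv ?t \<otimes> k \<otimes> ?t)) K *\<^sub>v blk n j v)"
        then have q: "q < n" by (simp add: msum_def)
        have "blk n j (E *\<^sub>v v) $ q = (\<Sum>k\<in>K. (ind (?c k) *\<^sub>v v) $ (j * n + q))"
          using q unfolding E_def blk_def
          by (simp add: msum_mult_vec_index[OF ind_carrier vC blk_index_less[OF j q]])
        also have "\<dots> = (\<Sum>k\<in>K. (\<Psi> (inv ?t \<otimes> k \<otimes> ?t) *\<^sub>v blk n j v) $ q)"
        proof (rule sum.cong[OF refl])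
          fix k assume k: "k \<in> K"
          have "(ind (?c k) *\<^sub>v v) $ (j * n + q) = blk n j (ind (?c k) *\<^sub>v v) $ q"
            using q by (simp add: blk_def)
          also have "blk n j (ind (?c k) *\<^sub>v v) = \<Psi> (inv (ts ! j) \<otimes> ?c k \<otimes> ts ! j) *\<^sub>v blk n j v"
            using cK[OF k] H_carrier innerH[OF k] inner[OF k] by (intro blk_ind vC j) auto
          finally show "(ind (?c k) *\<^sub>v v) $ (j * n + q) = (\<Psi> (inv ?t \<otimes> k \<otimes> ?t) *\<^sub>v blk n j v) $ q"
            by (simp only: inner[OF k])
        qed
        also have "\<dots> = (msum n n (\<lambda>k. \<Psi> (inv ?t \<otimes> k \<otimes> ?t)) K *\<^sub>v blk n j v) $ q"
          using \<Psi>D(1)[OF innerH] q by (intro msum_mult_vec_index[symmetric]) auto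
        finally show "blk n j (E *\<^sub>v v) $ q = (msum n n (\<lambda>k. \<Psi> (inv ?t \<otimes> k \<otimes> ?t)) K *\<^sub>v blk n j v) $ q" .
      qed (simp add: blk_def msum_def)
      show "blk n j (E *\<^sub>v v) = blk n j (blk_emb m n i (of_nat (card K) \<cdot>\<^sub>v blk n i v))"
      proof (cases "j = i")
        case True
        have "msum n n (\<lambda>k. \<Psi> (inv ?t \<otimes> k \<otimes> ?t)) K = msum n n (\<lambda>k. 1\<^sub>m n) K"
          using True ti K_carrier triv by (intro msum_cong) simp
        also have "\<dots> = of_nat (card K) \<cdot>\<^sub>m 1\<^sub>m n" by (rule msum_const) simp
        finally have "blk n j (E *\<^sub>v v) = of_nat (card K) \<cdot>\<^sub>v blk n j v"
          using blkE by (auto intro!: eq_vecI)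
        then show ?thesis using True i by (simp add: blk_emb_blk)
      next
        case False
        then have "?t \<notin> H" using same_index[OF i(1) j] by simp
        then have "msum n n (\<lambda>k. \<Psi> (inv ?t \<otimes> k \<otimes> ?t)) K = 0\<^sub>m n n"
          using ti tj by (intro msum_conj_K[OF \<Psi> sum triv]) auto
        then have "blk n j (E *\<^sub>v v) = 0\<^sub>v n" using blkE by (auto intro!: eq_vecI)
        then show ?thesis using False i j by (simp add: blk_emb_blk)
      qed
    qed simp
    then have "of_nat (card K) \<cdot>\<^sub>v blk_emb m n i (blk n i v) \<in> W"
      using Ev by (simp add: blk_emb_linear(2)[OF blk_carrier blk_carrier])
    then have "inverse (of_nat (card K)) \<cdot>\<^sub>v (of_nat (card K) \<cdot>\<^sub>v blk_emb m n i (blk n i v)) \<in> W"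
      using W unfolding rep_invariant_def by blast
    moreover have "card K \<noteq> 0" using finite_K subgroup.one_closed[OF K] by auto
    ultimately have emb_i: "blk_emb m n i (blk n i v) \<in> W"
      by (simp add: smult_smult_assoc)
    \<comment> \<open>The vectors whose copy in block \<open>i\<close> lies in \<open>W\<close>.
      They are stable under \<open>H\<close> because \<open>ts ! i\<close> conjugates
      \<open>H\<close> into itself, and not all zero by \<open>emb_i\<close>; so irreducibility of
      \<open>\<Psi>\<close> makes \<open>U\<close> the full space.\<close>
    define U where "U = {w \<in> carrier_vec n. blk_emb m n i w \<in> W}"
    have "rep_invariant (subgrp G H) n \<Psi> U"
      unfolding rep_invariant_def
    proof (intro conjI ballI allI)
      show "0\<^sub>v n \<in> U" using W blk_emb_linear(3)[of "0\<^sub>v n :: 'k vec" n "0\<^sub>v n" m i]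
        by (simp add: U_def rep_invariant_def)
      show "v + w \<in> U" if "v \<in> U" "w \<in> U" for v w
        using that W by (auto simp: U_def rep_invariant_def blk_emb_linear(1))
      show "c \<cdot>\<^sub>v v \<in> U" if "v \<in> U" for c v
        using that W blk_emb_linear(2)[of v n v m i c] by (auto simp: U_def rep_invariant_def)
      show "\<Psi> h *\<^sub>v w \<in> U" if "h \<in> carrier (subgrp G H)" "w \<in> U" for h w
      proof -
        have h: "h \<in> H" and w: "w \<in> carrier_vec n" "blk_emb m n i w \<in> W" using that by (auto simp: U_def)
        have eq: "inv (ts ! i) \<otimes> ?c h \<otimes> ts ! i = h"
          using ti H_carrier[OF h] by (simp add: m_assoc) (simp flip: m_assoc)
        have "ind (?c h) *\<^sub>v blk_emb m n i w = blk_emb m n i (\<Psi> h *\<^sub>v w)"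
          using ind_blk_emb[OF _ w(1) i(1) i(1), of "?c h"] cH[OF h] H_carrier h eq by simp
        moreover have "ind (?c h) *\<^sub>v blk_emb m n i w \<in> W" using W_act cH[OF h] H_carrier w by blast
        ultimately show ?thesis using \<Psi>D(1)[OF h] w by (simp add: U_def)
      qed
    qed (auto simp: U_def)
    moreover have "blk n i v \<in> U" using emb_i by (simp add: U_def)
    ultimately have U: "U = carrier_vec n" using irr i(2) by (auto simp: irreducible_rep_iff)
    have "blk_emb m n j w \<in> W" if j: "j < m" and w: "w \<in> carrier_vec n" for j w
    proof -
      have "blk_emb m n i w \<in> W" using U w by (auto simp: U_def)
      \<comment> \<open>This element carries block \<open>i\<close> to block \<open>j\<close> with
        the identity as inner factor.\<close>
      let ?g = "ts ! j \<otimes> inv (ts ! i)"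
      have g: "?g \<in> carrier G" using ti ts_carrier[OF j] by simp
      have eq: "inv (ts ! j) \<otimes> ?g \<otimes> ts ! i = \<one>"
        using ti ts_carrier[OF j] by (simp add: m_assoc)
      have "ind ?g *\<^sub>v blk_emb m n i w = blk_emb m n j w"
        using ind_blk_emb[OF g w i(1) j] eq subgroup.one_closed[OF H] \<Psi>D(3) w by simp
      then show ?thesis using W_act[OF g \<open>blk_emb m n i w \<in> W\<close>] by simp
    qed
    then have "unit_vec (m * n) r \<in> W" if "r < m * n" for r
      using that by (simp add: unit_vec_blk_emb less_mult_imp_div_less)
    then show ?thesis using unit_vec_span[OF W] by simp
  qed simp
qed

end

end

end

section \<open>Rational representations of linear characters\<close>

text \<open>The sum over a central subgroup commutes with the whole representation, so it is zero or
  invertible. It also absorbs every \<open>\<rho> c\<close>, which in the invertible case must be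
  the identity.\<close>

lemma msum_central_subgroup:
  fixes A (structure) and \<rho> :: "'a \<Rightarrow> 'k::field_char_0 mat"
  assumes A: "group A" and \<rho>: "irreducible_rep A n \<rho>" and C: "subgroup C A"
    and comm: "\<And>c g. c \<in> C \<Longrightarrow> g \<in> carrier A \<Longrightarrow> c \<otimes> g = g \<otimes> c"
  shows "msum n n \<rho> C = 0\<^sub>m n n \<or> (\<forall>c\<in>C. \<rho> c = 1\<^sub>m n)"
proof (cases "msum n n \<rho> C = 0\<^sub>m n n")
  case False
  interpret A: group A by fact
  note D = matrix_repD[OF _ A, of n \<rho>]
  have mr: "matrix_rep A n \<rho>" using \<rho> by (simp add: irreducible_rep_iff)
  have CA: "c \<in> carrier A" if "c \<in> C" for c using subgroup.mem_carrier[OF C that] .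
  let ?E = "msum n n \<rho> C"
  have "\<rho> g * ?E = ?E * \<rho> g" if g: "g \<in> carrier A" for g
  proof -
    have "\<rho> g * ?E = msum n n (\<lambda>c. \<rho> g * \<rho> c) C" by (intro mult_msum D mr g CA)
    also have "\<dots> = msum n n (\<lambda>c. \<rho> c * \<rho> g) C"
      by (intro msum_cong) (metis CA D(2) comm g mr)
    also have "\<dots> = ?E * \<rho> g" by (intro msum_mult[symmetric] D mr g CA)
    finally show ?thesis .
  qed
  then obtain Q where Q: "Q \<in> carrier_mat n n" "?E * Q = 1\<^sub>m n"
    using commuting_zero_or_invertible[OF A \<rho> msum_carrier _ False] by metis
  have "\<rho> c = 1\<^sub>m n" if c: "c \<in> C" for c
  proof -
    have "\<rho> c * ?E = msum n n (\<lambda>d. \<rho> c * \<rho> d) C" by (intro mult_msum D mr CA c)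
    also have "\<dots> = ?E"
    proof (rule msum_reindex_bij_witness[of _ "\<lambda>d. inv c \<otimes> d" "\<lambda>d. c \<otimes> d"])
      fix d assume d: "d \<in> C"
      note cd = CA[OF c] CA[OF d]
      show "inv c \<otimes> (c \<otimes> d) = d" "c \<otimes> (inv c \<otimes> d) = d"
        using cd by (simp_all flip: A.m_assoc)
      show "c \<otimes> d \<in> C" "inv c \<otimes> d \<in> C"
        using c d C by (simp_all add: subgroup.m_closed subgroup.m_inv_closed)
      show "\<rho> (c \<otimes> d) = \<rho> c * \<rho> d" using D(2)[OF mr cd] .
    qed
    finally have "\<rho> c * ?E * Q = ?E * Q" by simp
    moreover have "\<rho> c * ?E * Q = \<rho> c * (?E * Q)"
      using D(1)[OF mr CA[OF c]] Q by (intro assoc_mult_mat) auto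
    ultimately show ?thesis using Q D(1)[OF mr CA[OF c]] by simp
  qed
  then show ?thesis by blast
qed simp

section \<open>The field Q(w) as a rational representation\<close>

context prime_root_of_unity begin

text \<open>Multiplication by \<open>w ^ i\<close> on \<open>\<rat>(w)\<close> in the basis \<open>1, w, \<dots>, w ^ (p - 2)\<close>.\<close>

definition cyc_mat :: "nat \<Rightarrow> rat mat" where
  "cyc_mat i = mat (p - 1) (p - 1)
     (\<lambda>(a, b). if (b + i) mod p = p - 1 then - 1 else if a = (b + i) mod p then 1 else 0)"

text \<open>The coordinate map from rational vectors to Q(w). It is injective by the degree bound
  for polynomials vanishing at \<open>w\<close>, so matrix identities can be checked on complex
  numbers.\<close>

definition cyc_vec :: "rat vec \<Rightarrow> complex" where
  "cyc_vec v = (\<Sum>a<p - 1. of_rat (v $ a) * w ^ a)"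

lemma cyc_mat_carrier: "cyc_mat i \<in> carrier_mat (p - 1) (p - 1)"
  by (simp add: cyc_mat_def)

lemma cyc_vec_add: "u \<in> carrier_vec (p - 1) \<Longrightarrow> v \<in> carrier_vec (p - 1) \<Longrightarrow> cyc_vec (u + v) = cyc_vec u + cyc_vec v"
  by (simp add: cyc_vec_def of_rat_add algebra_simps sum.distrib)

lemma cyc_vec_smult: "v \<in> carrier_vec (p - 1) \<Longrightarrow> cyc_vec (c \<cdot>\<^sub>v v) = of_rat c * cyc_vec v"
  by (simp add: cyc_vec_def of_rat_mult sum_distrib_left mult.assoc)

lemma cyc_vec_eval: "\<exists>f. cyc_vec v = eval_rat f w \<and> (\<forall>a<p - 1. poly.coeff f a = v $ a) \<and> (f = 0 \<or> Polynomial.degree f < p - 1)"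
proof (intro exI conjI)
  let ?f = "\<Sum>a<p - 1. Polynomial.monom (v $ a) a"
  show "cyc_vec v = eval_rat ?f w"
    using eval_rat_smult[of _ "Polynomial.monom 1 _"]
    by (simp add: cyc_vec_def eval_rat_sum smult_monom eval_rat_monom)
  show "\<forall>a<p - 1. poly.coeff ?f a = v $ a" by (simp add: coeff_sum)
  have "poly.coeff ?f a = 0" if "a \<ge> p - 1" for a using that by (simp add: coeff_sum)
  then show "?f = 0 \<or> Polynomial.degree ?f < p - 1"
    by (metis leading_coeff_0_iff linorder_not_less)
qed

lemma cyc_vec_in_cyc: "cyc_vec v \<in> cyc w"
  using cyc_vec_eval[of v] by (auto simp: cyc_def)

lemma cyc_vec_eq_0: "v \<in> carrier_vec (p - 1) \<Longrightarrow> cyc_vec v = 0 \<Longrightarrow> v = 0\<^sub>v (p - 1)"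
proof -
  assume v: "v \<in> carrier_vec (p - 1)" "cyc_vec v = 0"
  obtain f where f: "eval_rat f w = 0" "\<forall>a<p - 1. poly.coeff f a = v $ a" "f = 0 \<or> Polynomial.degree f < p - 1"
    using cyc_vec_eval[of v] v by auto
  then have "f = 0" using rat_poly_root_of_unity_degree[OF p w_pow w_neq, of f] by force
  then show ?thesis using f v by (intro eq_vecI) auto
qed

lemma cyc_vec_inj:
  assumes "u \<in> carrier_vec (p - 1)" "v \<in> carrier_vec (p - 1)" "cyc_vec u = cyc_vec v"
  shows "u = v"
proof -
  have "cyc_vec (u + (- 1) \<cdot>\<^sub>v v) = 0"
    using assms by (simp add: cyc_vec_add cyc_vec_smult)
  then have "u + (- 1) \<cdot>\<^sub>v v = 0\<^sub>v (p - 1)" using assms by (intro cyc_vec_eq_0) auto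
  then have "(u + (- 1) \<cdot>\<^sub>v v) $ i = 0" if "i < p - 1" for i using that by simp
  then show ?thesis using assms by (intro eq_vecI) auto
qed

lemma cyc_vec_mat:
  assumes v: "v \<in> carrier_vec (p - 1)"
  shows "cyc_vec (cyc_mat i *\<^sub>v v) = w ^ i * cyc_vec v"
proof -
  have col: "(\<Sum>a<p - 1. of_rat (cyc_mat i $$ (a, b)) * w ^ a) = w ^ (b + i)" if b: "b < p - 1" for b
  proof -
    define r where "r = (b + i) mod p"
    have r: "r < p" "w ^ (b + i) = w ^ r" using p_gt_1 by (simp_all add: r_def power_mod)
    show ?thesis
    proof (cases "r = p - 1")
      \<comment> \<open>\<open>w ^ (p - 1)\<close> is not in the basis; it equals minus the sum of
        the basis, whence the column with all entries \<open>- 1\<close>.\<close>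
      case True
      have "(\<Sum>a<Suc (p - 1). w ^ a) = 0" using sum_powers_root[OF w_pow w_neq] p_gt_1 by simp
      then have "(\<Sum>a<p - 1. w ^ a) = - (w ^ (p - 1))" by (simp add: add_eq_0_iff2)
      then show ?thesis using b True r by (simp add: cyc_mat_def r_def[symmetric] sum_negf)
    next
      case False
      have "(\<Sum>a<p - 1. of_rat (cyc_mat i $$ (a, b)) * w ^ a) = (\<Sum>a<p - 1. if a = r then w ^ a else 0)"
        using b False by (intro sum.cong) (auto simp: cyc_mat_def r_def[symmetric])
      also have "\<dots> = w ^ r" using r False by simp
      finally show ?thesis using r by simp
    qed
  qed
  have "cyc_vec (cyc_mat i *\<^sub>v v) = (\<Sum>a<p - 1. \<Sum>b<p - 1. of_rat (v $ b) * (of_rat (cyc_mat i $$ (a, b)) * w ^ a))"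
    using v cyc_mat_carrier[of i]
    by (simp add: cyc_vec_def scalar_prod_def atLeast0LessThan of_rat_sum of_rat_mult sum_distrib_left sum_distrib_right mult_ac)
  also have "\<dots> = (\<Sum>b<p - 1. of_rat (v $ b) * (\<Sum>a<p - 1. of_rat (cyc_mat i $$ (a, b)) * w ^ a))"
    by (subst sum.swap) (simp add: sum_distrib_left)
  also have "\<dots> = (\<Sum>b<p - 1. of_rat (v $ b) * w ^ (b + i))"
    by (intro sum.cong refl arg_cong[of _ _ "\<lambda>x. _ * x"] col) (simp only: lessThan_iff)
  also have "\<dots> = w ^ i * cyc_vec v"
    by (simp add: cyc_vec_def sum_distrib_left power_add mult_ac)
  finally show ?thesis .
qed

lemma cyc_mat_vec_carrier: "v \<in> carrier_vec (p - 1) \<Longrightarrow> cyc_mat i *\<^sub>v v \<in> carrier_vec (p - 1)"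
  by (rule mult_mat_vec_carrier[OF cyc_mat_carrier])

lemma cyc_mat_mult: "w ^ i * w ^ j = w ^ k \<Longrightarrow> cyc_mat i * cyc_mat j = cyc_mat k"
proof (rule mat_eq_mult_vecI[OF _ cyc_mat_carrier])
  assume ij: "w ^ i * w ^ j = w ^ k"
  show "cyc_mat i * cyc_mat j \<in> carrier_mat (p - 1) (p - 1)"
    using cyc_mat_carrier cyc_mat_carrier by (rule mult_carrier_mat)
  fix v :: "rat vec" assume v: "v \<in> carrier_vec (p - 1)"
  have "cyc_mat i *\<^sub>v (cyc_mat j *\<^sub>v v) = cyc_mat k *\<^sub>v v"
  proof (intro cyc_vec_inj cyc_mat_vec_carrier v)
    show "cyc_vec (cyc_mat i *\<^sub>v (cyc_mat j *\<^sub>v v)) = cyc_vec (cyc_mat k *\<^sub>v v)"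
      by (simp only: cyc_vec_mat[OF cyc_mat_vec_carrier[OF v]] cyc_vec_mat[OF v] mult.assoc[symmetric] ij)
  qed
  then show "cyc_mat i * cyc_mat j *\<^sub>v v = cyc_mat k *\<^sub>v v"
    using assoc_mult_mat_vec[OF cyc_mat_carrier cyc_mat_carrier v] by simp
qed

lemma cyc_mat_one: "w ^ i = 1 \<Longrightarrow> cyc_mat i = 1\<^sub>m (p - 1)"
  by (rule mat_eq_mult_vecI[OF cyc_mat_carrier])
    (auto intro!: cyc_vec_inj cyc_mat_vec_carrier simp: cyc_vec_mat)

text \<open>For \<open>0 < i\<close> no basis vector is sent to itself, and a diagonal entry
  \<open>- 1\<close> occurs only in column \<open>p - 1 - i\<close>, whose image is
  \<open>w ^ (p - 1)\<close>.\<close>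

lemma mat_trace_cyc_mat:
  assumes i: "i < p"
  shows "mat_trace (cyc_mat i) = (if i = 0 then of_nat p - 1 else - 1)"
proof (cases "i = 0")
  case True
  then show ?thesis using cyc_mat_one[of 0] p_gt_1 by (simp add: of_nat_diff)
next
  case False
  have "mat_trace (cyc_mat i) = (\<Sum>a<p - 1. cyc_mat i $$ (a, a))"
    using cyc_mat_carrier[of i] by (simp add: mat_trace_def)
  also have "\<dots> = (\<Sum>a<p - 1. if a = p - 1 - i then - 1 else 0)"
  proof (rule sum.cong[OF refl])
    fix a assume "a \<in> {..<p - 1}"
    then have a: "a < p - 1" by simp
    have "(a + i) mod p \<noteq> a"
    proof
      assume "(a + i) mod p = a"
      then have "(a + i) mod p = a mod p" using a by simp
      then have "i mod p = 0" using mod_eq_dvd_iff_nat[of a "a + i" p] by simp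
      then show False using False i by simp
    qed
    moreover have "(a + i) mod p = p - 1 \<longleftrightarrow> a = p - 1 - i"
    proof (cases "a + i < p")
      case False
      then have "(a + i) mod p = a + i - p" using a i by (simp add: mod_if)
      then show ?thesis using False a i by auto
    qed (use a i in auto)
    ultimately show "cyc_mat i $$ (a, a) = (if a = p - 1 - i then - 1 else 0)"
      using a by (simp add: cyc_mat_def)
  qed
  also have "\<dots> = - 1" using False i by simp
  finally show ?thesis using False by simp
qed

text \<open>Polynomials in \<open>cyc_mat j\<close> multiply \<open>v\<close> by arbitrary elements
  of Q(w^j), which is all of Q(w). As this is a field, every vector is reached from a nonzero
  \<open>v\<close>.\<close>

lemma cyc_mat_irreducible:
  assumes W: "W \<subseteq> carrier_vec (p - 1)" "\<And>u v. u \<in> W \<Longrightarrow> v \<in> W \<Longrightarrow> u + v \<in> W"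
    "\<And>c v. v \<in> W \<Longrightarrow> c \<cdot>\<^sub>v v \<in> W" "\<And>v. v \<in> W \<Longrightarrow> cyc_mat j *\<^sub>v v \<in> W"
    and j: "\<not> p dvd j" and v: "v \<in> W" "v \<noteq> 0\<^sub>v (p - 1)"
  shows "W = carrier_vec (p - 1)"
proof -
  interpret z: prime_root_of_unity p "w ^ j"
    using p w_pow j by unfold_locales (auto simp: power_eq_1_iff mult.commute simp flip: power_mult)
  have "w \<in> {x. x ^ p = 1}" using w_pow by simp
  then have "w \<in> cyc (w ^ j)" unfolding z.roots_eq by (metis (no_types, lifting) imageE cyc_power cyc_self)
  then have cycs: "cyc w \<subseteq> cyc (w ^ j)" by (rule cyc_subset)
  have v0: "cyc_vec v \<noteq> 0" using v W(1) cyc_vec_eq_0 by blast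
  have step: "\<exists>u\<in>W. cyc_vec u = eval_rat f (w ^ j) * cyc_vec v" for f
  proof (induction f)
    case 0
    have "0 \<cdot>\<^sub>v v \<in> W" using W(3) v by blast
    moreover have "cyc_vec (0 \<cdot>\<^sub>v v) = 0" using v W(1) by (subst cyc_vec_smult) auto
    ultimately show ?case by (auto simp: eval_rat_simps)
  next
    case (pCons a f)
    then obtain u where u: "u \<in> W" "cyc_vec u = eval_rat f (w ^ j) * cyc_vec v" by blast
    have uv: "u \<in> carrier_vec (p - 1)" "v \<in> carrier_vec (p - 1)" using u v W(1) by auto
    have "cyc_vec (a \<cdot>\<^sub>v v + cyc_mat j *\<^sub>v u) = of_rat a * cyc_vec v + w ^ j * cyc_vec u"
      by (simp only: cyc_vec_add[OF smult_carrier_vec[THEN iffD2, OF uv(2)] cyc_mat_vec_carrier[OF uv(1)]]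
          cyc_vec_smult[OF uv(2)] cyc_vec_mat[OF uv(1)])
    also have "\<dots> = eval_rat (pCons a f) (w ^ j) * cyc_vec v"
      by (simp add: u eval_rat_simps algebra_simps)
    finally have "cyc_vec (a \<cdot>\<^sub>v v + cyc_mat j *\<^sub>v u) = eval_rat (pCons a f) (w ^ j) * cyc_vec v" .
    moreover have "a \<cdot>\<^sub>v v + cyc_mat j *\<^sub>v u \<in> W" using W u v by blast
    ultimately show ?case by blast
  qed
  have "t \<in> W" if t: "t \<in> carrier_vec (p - 1)" for t
  proof -
    have "cyc_vec t * inverse (cyc_vec v) \<in> cyc w"
      by (intro cyc_mult cyc_inverse cyc_vec_in_cyc v0)
    then obtain f where "cyc_vec t * inverse (cyc_vec v) = eval_rat f (w ^ j)"
      using cycs by (auto simp: cyc_def)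
    then have f: "cyc_vec t = eval_rat f (w ^ j) * cyc_vec v" using v0 by (simp add: field_simps)
    obtain u where "u \<in> W" "cyc_vec u = eval_rat f (w ^ j) * cyc_vec v" using step by blast
    then show ?thesis using cyc_vec_inj[of t u] t W(1) f by auto
  qed
  then show ?thesis using W(1) by blast
qed

end

text \<open>\<open>g\<close> acts on Q(w) as multiplication by \<open>\<psi> g\<close>. Since
  \<open>\<psi> z\<close> is \<open>w\<close>, the action of \<open>z\<close> alone leaves no proper
  nonzero subspace invariant.\<close>

lemma (in prime_root_of_unity) rational_rep_exists:
  assumes A: "group A" and \<psi>: "\<psi> \<in> lin A" and root: "\<And>g. g \<in> carrier A \<Longrightarrow> \<psi> g ^ p = 1"
    and z: "z \<in> carrier A" "\<psi> z = w"
  obtains \<Psi> :: "'a \<Rightarrow> rat mat" where "irreducible_rep A (p - 1) \<Psi>"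
    "\<And>g. g \<in> carrier A \<Longrightarrow> mat_trace (\<Psi> g) = (if \<psi> g = 1 then of_nat p - 1 else - 1)"
proof
  note lin = \<psi>[unfolded lin_iff[OF A]]
  \<comment> \<open>The exponent is chosen below \<open>p\<close> because
    \<open>mat_trace_cyc_mat\<close> requires it.\<close>
  define e where "e g = (SOME i. i < p \<and> \<psi> g = w ^ i)" for g
  have e: "e g < p \<and> \<psi> g = w ^ e g" if g: "g \<in> carrier A" for g
  proof -
    have "\<psi> g \<in> {x. x ^ p = 1}" using root[OF g] by simp
    then obtain i where "i < p \<and> \<psi> g = w ^ i" unfolding roots_eq by auto
    then show ?thesis unfolding e_def by (rule someI)
  qed
  let ?\<Psi> = "\<lambda>g. cyc_mat (e g)"
  interpret A: group A by fact
  have mr: "matrix_rep A (p - 1) ?\<Psi>"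
  proof (rule matrix_repI[OF A cyc_mat_carrier])
    show "?\<Psi> (g \<otimes>\<^bsub>A\<^esub> h) = ?\<Psi> g * ?\<Psi> h" if "g \<in> carrier A" "h \<in> carrier A" for g h
      using that lin e by (intro cyc_mat_mult[symmetric]) (metis A.m_closed)
    show "?\<Psi> \<one>\<^bsub>A\<^esub> = 1\<^sub>m (p - 1)" using lin e[OF A.one_closed] by (intro cyc_mat_one) auto
  qed
  have ez: "\<not> p dvd e z" using e[OF z(1)] z(2) w_neq by (auto simp flip: power_eq_1_iff)
  show "irreducible_rep A (p - 1) ?\<Psi>"
    unfolding irreducible_rep_iff
  proof (intro conjI allI impI mr)
    show "0 < p - 1" using p_gt_1 by simp
    fix W assume W: "rep_invariant A (p - 1) ?\<Psi> W"
    show "W = {0\<^sub>v (p - 1)} \<or> W = carrier_vec (p - 1)"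
    proof (cases "W = {0\<^sub>v (p - 1)}")
      case False
      then obtain v where "v \<in> W" "v \<noteq> 0\<^sub>v (p - 1)" using W by (auto simp: rep_invariant_def)
      then have "W = carrier_vec (p - 1)"
        using W z(1) ez by (intro cyc_mat_irreducible[of W "e z" v]) (auto simp: rep_invariant_def)
      then show ?thesis by simp
    qed simp
  qed
  show "mat_trace (?\<Psi> g) = (if \<psi> g = 1 then of_nat p - 1 else - 1)" if g: "g \<in> carrier A" for g
  proof -
    have "\<psi> g = 1 \<longleftrightarrow> e g = 0"
      using e[OF g] by (metis dvd_0_right nat_dvd_not_less not_gr_zero power_eq_1_iff)
    then show ?thesis using mat_trace_cyc_mat e[OF g] by simp
  qed
qed

section \<open>Schur index, value field and \<open>Omega\<close> of linear characters\<close>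

lemma schur_index_linear:
  assumes A: "group A" and \<psi>: "\<psi> \<in> lin A"
  shows "schur_index A \<psi> = 1"
proof -
  interpret A: group A by fact
  note lin = \<psi>[unfolded lin_iff[OF A]]
  let ?\<rho> = "\<lambda>g. mat 1 1 (\<lambda>_. \<psi> g)"
  have "matrix_rep A 1 ?\<rho>"
    using lin by (intro matrix_repI[OF A]) (auto intro!: eq_matI simp: scalar_prod_def)
  moreover have "elements_mat (?\<rho> g) \<subseteq> field_of_values A \<psi>" if "g \<in> carrier A" for g
    using that by (auto simp: elements_mat_def field_of_values_def intro!: generate_field.incl)
  moreover have "character A ?\<rho> g = of_nat 1 * \<psi> g" if "g \<in> carrier A" for g
    using that by (simp add: character_def mat_trace_def)
  ultimately have "\<exists>n \<rho>. matrix_rep A n \<rho> \<and>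
      (\<forall>g \<in> carrier A. elements_mat (\<rho> g) \<subseteq> field_of_values A \<psi>) \<and>
      (\<forall>g \<in> carrier A. character A \<rho> g = of_nat 1 * \<psi> g)" by blast
  then show ?thesis
    unfolding schur_index_def by (intro Least_equality) auto
qed

context prime_root_of_unity begin

lemma field_of_values_linear:
  assumes "\<And>g. g \<in> carrier A \<Longrightarrow> \<psi> g ^ p = 1" and "z \<in> carrier A" "\<psi> z = w"
  shows "field_of_values A \<psi> = cyc w"
  unfolding field_of_values_def
proof (rule generate_field_eq_cyc)
  show "\<psi> ` carrier A \<subseteq> cyc w"
  proof
    fix x assume "x \<in> \<psi> ` carrier A"
    then have "x \<in> {x. x ^ p = 1}" using assms by auto
    then show "x \<in> cyc w" unfolding roots_eq by (auto intro: cyc_power cyc_self)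
  qed
  show "w \<in> generate_field class_ring (\<psi> ` carrier A)"
    using assms by (intro generate_field.incl) auto
qed

text \<open>The Schur index is 1 and the value field is Q(w), so \<open>Omega\<close> is the trace
  of the root of unity \<open>\<psi> g\<close> down to Q.\<close>

lemma Omega_linear:
  assumes A: "group A" and \<psi>: "\<psi> \<in> lin A" and root: "\<And>g. g \<in> carrier A \<Longrightarrow> \<psi> g ^ p = 1"
    and z: "z \<in> carrier A" "\<psi> z = w" and g: "g \<in> carrier A"
  shows "Omega A \<psi> g = (if \<psi> g = 1 then of_nat p - 1 else - 1)"
proof -
  have "\<psi> g \<in> {x. x ^ p = 1}" using root[OF g] by simp
  then obtain i where "\<psi> g = w ^ i" unfolding roots_eq by auto
  then show ?thesis
    using field_of_values_linear[of A \<psi> z, OF root z] sum_Gal_power[of i]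
    by (simp add: Omega_def schur_index_linear[OF A \<psi>] power_eq_1_iff)
qed

end

section \<open>Irreducible representations of extraspecial groups of order \<open>p\<^sup>5\<close>\<close>

text \<open>\<open>H_prod\<close> and \<open>KZ\<close> make \<open>H\<close> the internal direct
  product of \<open>K\<close> and the center. The two orders give the index \<open>p ^ 2\<close>,
  the degree of the nonlinear characters.\<close>

locale extraspecial_p5 = polarized G p K H for G :: "('a, 'b) monoid_scheme" (structure) and p K H +
  fixes z :: 'a
  assumes z: "z \<in> Z" "z \<noteq> \<one>"
    and derived: "commutator_subgroup G = Z"
    and H_prod: "h \<in> H \<Longrightarrow> \<exists>k\<in>K. \<exists>c\<in>Z. h = k \<otimes> c"
    and KZ: "K \<inter> Z = {\<one>}"
    and card_H: "card H = p ^ 3" and card_G: "card (carrier G) = p ^ 5"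
begin

lemma p_pos: "p > 0" using p by (rule prime_gt_0_nat)

lemma Z_generate: "Z = generate G {z}"
proof (rule subgroup_of_Z[symmetric])
  show "subgroup (generate G {z}) G" using z Z_carrier by (intro generate_is_subgroup) auto
  show "generate G {z} \<subseteq> Z" using z(1) Z by (intro generate_subgroup_incl) auto
  show "z \<in> generate G {z}" by (rule generate.incl) simp
qed (rule z)

text \<open>Looks at values on \<open>Z\<close> only, so that characters of the center can be
  compared with restrictions of characters of \<open>H\<close>.\<close>

definition hom_Z :: "('a \<Rightarrow> complex) \<Rightarrow> bool" where
  "hom_Z f \<longleftrightarrow> (\<forall>c\<in>Z. \<forall>d\<in>Z. f (c \<otimes> d) = f c * f d) \<and> f \<one> = 1"

lemma hom_Z_lin: "f \<in> lin (subgrp G Z) \<Longrightarrow> hom_Z f" "f \<in> lin (subgrp G H) \<Longrightarrow> hom_Z f"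
  unfolding lin_iff[OF groups(1)] lin_iff[OF groups(2)] hom_Z_def using ZH by auto

lemma hom_Z_inv:
  assumes f: "hom_Z f" and c: "c \<in> Z"
  shows "f c * f (inv c) = 1"
proof -
  have "f (c \<otimes> inv c) = f c * f (inv c)" using f c subgroup.m_inv_closed[OF Z c] by (simp add: hom_Z_def)
  then show ?thesis using f c Z_carrier by (simp add: hom_Z_def)
qed

lemma hom_Z_eqI:
  assumes f: "hom_Z f" and g: "hom_Z g" and c: "c \<in> Z" "c \<noteq> \<one>" "f c = g c" and d: "d \<in> Z"
  shows "f d = g d"
proof -
  define S where "S = {d \<in> Z. f d = g d}"
  have "S = Z"
  proof (rule subgroup_of_Z[of _ c])
    show "subgroup S G"
    proof (rule finite_submonoid_subgroup[OF fin])
      show "S \<subseteq> carrier G" by (auto simp: S_def Z_carrier)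
      show "\<one> \<in> S" using f g subgroup.one_closed[OF Z] by (simp add: S_def hom_Z_def)
      show "a \<otimes> b \<in> S" if "a \<in> S" "b \<in> S" for a b
        using that f g subgroup.m_closed[OF Z] by (auto simp: S_def hom_Z_def)
    qed
  qed (use c in \<open>auto simp: S_def\<close>)
  then show ?thesis using d by (auto simp: S_def)
qed

lemma hom_Z_neq_1: "hom_Z f \<Longrightarrow> f z \<noteq> 1 \<Longrightarrow> c \<in> Z \<Longrightarrow> c \<noteq> \<one> \<Longrightarrow> f c \<noteq> 1"
  using hom_Z_eqI[of f "\<lambda>_. 1" c z] z by (auto simp: hom_Z_def)

lemma hom_Z_power: 
  assumes f: "hom_Z f" and c: "c \<in> Z"
  shows "f c ^ p = 1"
proof -
  interpret Zg: group "subgrp G Z" by (rule groups)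
  have "f (c [^]\<^bsub>subgrp G Z\<^esub> n) = f c ^ n" for n :: nat
  proof (induction n)
    case (Suc n)
    have "c [^]\<^bsub>subgrp G Z\<^esub> n \<in> Z" using Zg.nat_pow_closed[of c n] c by simp
    then show ?case using Suc f c by (simp add: hom_Z_def)
  qed (use f in \<open>simp add: hom_Z_def\<close>)
  from this[of "Coset.order (subgrp G Z)"] show ?thesis
    using Zg.pow_order_eq_1[of c] c f card_center by (simp add: Coset.order_def hom_Z_def)
qed

lemma comm_group_Z: "comm_group (subgrp G Z)"
  using groups(1) Z_comm Z_carrier by (intro group.group_comm_groupI) auto

text \<open>The derived subgroup is the center and \<open>z\<close> generates it, so nontriviality
  there is tested at \<open>z\<close>. All irreducible characters of the center are linear, as it is
  abelian.\<close>

lemma M_iff: "\<mu> \<in> Irr_over (subgrp G Z) (commutator_subgroup G) \<longleftrightarrow> \<mu> \<in> lin (subgrp G Z) \<and> \<mu> z \<noteq> 1"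
proof -
  have "\<mu> \<in> Irr_over (subgrp G Z) (commutator_subgroup G) \<longleftrightarrow>
      \<mu> \<in> lin (subgrp G Z) \<and> \<not> (\<forall>c\<in>Z. \<mu> c = 1)"
    unfolding Irr_over_def Irr_comm_group[OF comm_group_Z] derived char_kernel_def
    by (auto simp: lin_iff[OF groups(1)])
  also have "\<dots> \<longleftrightarrow> \<mu> \<in> lin (subgrp G Z) \<and> \<mu> z \<noteq> 1"
  proof -
    have "\<forall>c\<in>Z. \<mu> c = 1" if "\<mu> \<in> lin (subgrp G Z)" "\<mu> z = 1"
      using hom_Z_eqI[OF hom_Z_lin(1)[OF that(1)], of "\<lambda>_. 1" z] that z by (auto simp: hom_Z_def)
    then show ?thesis using z by auto
  qed
  finally show ?thesis .
qed

text \<open>Triviality is required on all of \<open>K\<close>, which suits the induction argument;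
  \<open>is_psi_iff\<close> reduces it to two generators for the presented groups.\<close>

definition is_psi :: "('a \<Rightarrow> complex) \<Rightarrow> ('a \<Rightarrow> complex) \<Rightarrow> bool" where
  "is_psi \<mu> \<psi> \<longleftrightarrow> \<psi> \<in> lin (subgrp G H) \<and> \<psi> z = \<mu> z \<and> (\<forall>k\<in>K. \<psi> k = 1)"

lemma KZ_cancel:
  assumes "k \<in> K" "k' \<in> K" "c \<in> Z" "c' \<in> Z" "k \<otimes> c = k' \<otimes> c'"
  shows "c = c'"
proof -
  note car = K_carrier[OF assms(1)] K_carrier[OF assms(2)] Z_carrier[OF assms(3)] Z_carrier[OF assms(4)]
  have "inv k' \<otimes> k = c' \<otimes> inv c"
  proof -
    have "inv k' \<otimes> (k \<otimes> c) \<otimes> inv c = inv k' \<otimes> (k' \<otimes> c') \<otimes> inv c" using assms(5) by simp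
    then show ?thesis using car by (simp add: m_assoc mult_cancel)
  qed
  moreover have "inv k' \<otimes> k \<in> K" using assms K by (simp add: subgroup.m_closed subgroup.m_inv_closed)
  moreover have "c' \<otimes> inv c \<in> Z" using assms Z by (simp add: subgroup.m_closed subgroup.m_inv_closed)
  ultimately have "c' \<otimes> inv c = \<one>" using KZ by auto
  then show ?thesis using car by (metis inv_closed inv_equality inv_inv)
qed

lemma ex1_psi:
  assumes \<mu>: "\<mu> \<in> lin (subgrp G Z)"
  shows "\<exists>!\<psi>. is_psi \<mu> \<psi>"
proof -
  note \<mu>h = hom_Z_lin(1)[OF \<mu>]
  \<comment> \<open>The projection of \<open>H\<close> to its central factor, well defined by
    \<open>KZ_cancel\<close>; composing \<open>\<mu>\<close> with it extends \<open>\<mu>\<close> to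
    \<open>H\<close>.\<close>
  define zp where "zp h = (THE c. c \<in> Z \<and> (\<exists>k\<in>K. h = k \<otimes> c))" for h
  have zp: "zp (k \<otimes> c) = c" if "k \<in> K" "c \<in> Z" for k c
    unfolding zp_def using that KZ_cancel by (intro the_equality) auto
  define \<psi> where "\<psi> h = (if h \<in> H then \<mu> (zp h) else 0)" for h
  have kcH: "k \<otimes> c \<in> H" if "k \<in> K" "c \<in> Z" for k c
    using that KH ZH subgroup.m_closed[OF H] by blast
  have \<psi>: "\<psi> (k \<otimes> c) = \<mu> c" if "k \<in> K" "c \<in> Z" for k c
    using zp[OF that] kcH[OF that] by (simp add: \<psi>_def)
  have K1: "\<one> \<in> K" and Z1: "\<one> \<in> Z" using K Z by (simp_all add: subgroup.one_closed)
  have "\<psi> \<in> lin (subgrp G H)"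
    unfolding lin_iff[OF groups(2)]
  proof (intro conjI ballI allI impI)
    fix g h assume gh: "g \<in> carrier (subgrp G H)" "h \<in> carrier (subgrp G H)"
    obtain k c where kc: "k \<in> K" "c \<in> Z" "g = k \<otimes> c" using H_prod[of g] gh by auto
    obtain k' c' where kc': "k' \<in> K" "c' \<in> Z" "h = k' \<otimes> c'" using H_prod[of h] gh by auto
    note car = K_carrier[OF kc(1)] K_carrier[OF kc'(1)] Z_carrier[OF kc(2)] Z_carrier[OF kc'(2)]
    have "g \<otimes> h = k \<otimes> (c \<otimes> k') \<otimes> c'" using kc kc' car by (simp add: m_assoc)
    also have "c \<otimes> k' = k' \<otimes> c" using car kc by (intro Z_comm)
    also have "k \<otimes> (k' \<otimes> c) \<otimes> c' = (k \<otimes> k') \<otimes> (c \<otimes> c')" using car by (simp add: m_assoc)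
    finally have "\<psi> (g \<otimes> h) = \<mu> (c \<otimes> c')"
      using \<psi>[of "k \<otimes> k'" "c \<otimes> c'"] kc kc' K Z by (simp add: subgroup.m_closed)
    also have "\<dots> = \<psi> g * \<psi> h" using \<mu>h kc kc' \<psi> by (simp add: hom_Z_def)
    finally show "\<psi> (g \<otimes>\<^bsub>subgrp G H\<^esub> h) = \<psi> g * \<psi> h" by simp
  next
    show "\<psi> \<one>\<^bsub>subgrp G H\<^esub> = 1" using \<psi>[OF K1 Z1] \<mu>h by (simp add: hom_Z_def)
  qed (simp add: \<psi>_def)
  moreover have "\<psi> z = \<mu> z" using \<psi>[OF K1 z(1)] z Z_carrier by simp
  moreover have "\<psi> k = 1" if "k \<in> K" for k using \<psi>[OF that Z1] \<mu>h K_carrier[OF that] by (simp add: hom_Z_def)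
  ultimately have ex: "is_psi \<mu> \<psi>" by (simp add: is_psi_def)
  moreover have "\<psi>1 = \<psi>2" if "is_psi \<mu> \<psi>1" "is_psi \<mu> \<psi>2" for \<psi>1 \<psi>2
  proof
    fix h
    have l: "\<psi>1 \<in> lin (subgrp G H)" "\<psi>2 \<in> lin (subgrp G H)" using that by (auto simp: is_psi_def)
    note l' = l[unfolded lin_iff[OF groups(2)]]
    show "\<psi>1 h = \<psi>2 h"
    proof (cases "h \<in> H")
      case True
      then obtain k c where kc: "k \<in> K" "c \<in> Z" "h = k \<otimes> c" using H_prod by blast
      then have H': "k \<in> H" "c \<in> H" using KH ZH by auto
      have "\<psi>1 c = \<psi>2 c"
        using hom_Z_eqI[OF hom_Z_lin(2)[OF l(1)] hom_Z_lin(2)[OF l(2)] z _ kc(2)] that by (simp add: is_psi_def)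
      then show ?thesis using that kc H' l' by (simp add: is_psi_def)
    qed (use l' in simp)
  qed
  ultimately show ?thesis by blast
qed

lemma left_transversal_exists: "\<exists>ts. left_transversal G H ts"
proof -
  have "finite (lcosets H)" using fin by (auto simp: LCOSETS_def)
  then obtain Cs where Cs: "set Cs = lcosets H" "distinct Cs" using finite_distinct_list by blast
  have "\<exists>x. x \<in> carrier G \<and> x <# H = C" if "C \<in> lcosets H" for C using that by (auto simp: LCOSETS_def)
  then obtain r where r: "\<And>C. C \<in> lcosets H \<Longrightarrow> r C \<in> carrier G \<and> r C <# H = C" by metis
  have eq: "(map r Cs ! i) <# H = Cs ! i" if "i < length Cs" for i
    using r[of "Cs ! i"] Cs that nth_mem by auto
  have "bij_betw (\<lambda>i. Cs ! i) {..<length Cs} (lcosets H)"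
    using Cs bij_betw_nth by blast
  then have "bij_betw (\<lambda>i. (map r Cs ! i) <# H) {..<length (map r Cs)} (lcosets H)"
    using eq by (subst bij_betw_cong[of _ _ "\<lambda>i. Cs ! i"]) auto
  moreover have "set (map r Cs) \<subseteq> carrier G" using r Cs by auto
  ultimately show ?thesis unfolding left_transversal_def by blast
qed

lemma length_transversal:
  assumes "left_transversal G H ts"
  shows "length ts = p ^ 2"
proof -
  have "card (lcosets H) = length ts"
    using assms bij_betw_same_card unfolding left_transversal_def by fastforce
  then have "length ts * p ^ 3 = p ^ 5"
    using l_lagrange[OF fin H] card_H card_G by (simp add: Coset.order_def)
  also have "p ^ 5 = p ^ 2 * p ^ 3" by (simp flip: power_add)
  finally have "length ts * p ^ 3 = p ^ 2 * p ^ 3" .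
  moreover have "p ^ 3 \<noteq> 0" using p_pos by simp
  ultimately show ?thesis by (metis mult_right_cancel)
qed

section \<open>The character chi_mu and its required pair\<close>

context
  fixes \<mu> \<psi>
  assumes \<mu>: "\<mu> \<in> lin (subgrp G Z)" "\<mu> z \<noteq> 1" and \<psi>: "is_psi \<mu> \<psi>"
begin

lemma psi_lin: "\<psi> \<in> lin (subgrp G H)" using \<psi> by (simp add: is_psi_def)

lemmas psiD = psi_lin[unfolded lin_iff[OF groups(2)], simplified]

lemma psi_center: "c \<in> Z \<Longrightarrow> \<psi> c = \<mu> c"
  using hom_Z_eqI[OF hom_Z_lin(2)[OF psi_lin] hom_Z_lin(1)[OF \<mu>(1)] z] \<psi> by (simp add: is_psi_def)

lemma psi_z: "\<psi> z \<noteq> 1" using psi_center z \<mu> by simp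

lemma psi_power: "h \<in> H \<Longrightarrow> \<psi> h ^ p = 1"
proof -
  assume "h \<in> H"
  then obtain k c where kc: "k \<in> K" "c \<in> Z" "h = k \<otimes> c" using H_prod by blast
  then have "\<psi> h = \<psi> c" using psiD KH ZH \<psi> by (auto simp: is_psi_def subset_iff)
  then show ?thesis using hom_Z_power[OF hom_Z_lin(2)[OF psi_lin] kc(2)] by simp
qed

interpretation w: prime_root_of_unity p "\<psi> z"
  using p psi_power z ZH psi_z by unfold_locales auto

abbreviation "lin_rep \<equiv> \<lambda>h. mat 1 1 (\<lambda>_. \<psi> h)"

lemma lin_rep: "irreducible_rep (subgrp G H) 1 lin_rep"
  using psiD by (intro irreducible_rep_dim_1 matrix_repI groups) (auto intro!: eq_matI simp: scalar_prod_def)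

lemma lin_rep_K: "k \<in> K \<Longrightarrow> lin_rep k = 1\<^sub>m 1"
  using \<psi> by (auto intro!: eq_matI simp: is_psi_def)

lemma lin_rep_msum: "msum 1 1 lin_rep Z = 0\<^sub>m 1 1"
proof -
  have "subgroup Z (subgrp G H)" using Z H ZH by (intro subgroup_incl)
  from msum_central_subgroup[OF groups(2) lin_rep this]
  have "msum 1 1 lin_rep Z = 0\<^sub>m 1 1 \<or> (\<forall>c\<in>Z. lin_rep c = 1\<^sub>m 1)"
    using Z_comm H_carrier by auto
  moreover have "lin_rep z \<noteq> 1\<^sub>m 1"
  proof
    assume "lin_rep z = 1\<^sub>m 1"
    from arg_cong[OF this, of "\<lambda>A. A $$ (0, 0)"] psi_z show False by simp
  qed
  ultimately show ?thesis using z by blast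
qed

lemma chi_rep:
  assumes ts: "left_transversal G H ts"
  shows "irreducible_rep G (p ^ 2) (induced_rep G H ts 1 lin_rep)"
    and "g \<in> carrier G \<Longrightarrow> mat_trace (induced_rep G H ts 1 lin_rep g) = chi_of p G \<mu> g"
proof -
  have mr: "matrix_rep (subgrp G H) 1 lin_rep" using lin_rep by (simp add: irreducible_rep_iff)
  show "irreducible_rep G (p ^ 2) (induced_rep G H ts 1 lin_rep)"
    using irreducible_ind[OF ts mr lin_rep_msum lin_rep lin_rep_K] length_transversal[OF ts] by simp
  show "mat_trace (induced_rep G H ts 1 lin_rep g) = chi_of p G \<mu> g" if g: "g \<in> carrier G"
  proof (cases "g \<in> Z")
    case True
    then show ?thesis
      using mat_trace_ind_center[OF ts mr True] length_transversal[OF ts]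
      by (simp add: chi_of_def mat_trace_def psi_center)
  next
    case False
    then show ?thesis using mat_trace_ind_off_center[OF ts mr lin_rep_msum g] by (simp add: chi_of_def)
  qed
qed

lemma character_chi_rep:
  "left_transversal G H ts \<Longrightarrow> character G (induced_rep G H ts 1 lin_rep) = chi_of p G \<mu>"
proof
  fix g assume ts: "left_transversal G H ts"
  show "character G (induced_rep G H ts 1 lin_rep) g = chi_of p G \<mu> g"
  proof (cases "g \<in> carrier G")
    case True
    then show ?thesis by (simp only: character_def chi_rep(2)[OF ts] if_True)
  next
    case False
    then show ?thesis using Z_carrier by (auto simp: character_def chi_of_def)
  qed
qed

lemma chi_Irr: "chi_of p G \<mu> \<in> Irr G"
proof -
  obtain ts where ts: "left_transversal G H ts" using left_transversal_exists by blast
  show ?thesis unfolding Irr_def using chi_rep(1)[OF ts] character_chi_rep[OF ts] by force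
qed

lemma chi_nl: "chi_of p G \<mu> \<in> nl G"
proof -
  have "\<one> \<in> Z" using Z by (rule subgroup.one_closed)
  moreover have "\<mu> \<one> = 1" using hom_Z_lin(1)[OF \<mu>(1)] by (simp add: hom_Z_def)
  moreover have "of_nat (p ^ 2) \<noteq> (1 :: complex)"
    using prime_gt_1_nat[OF p] by (simp only: of_nat_eq_1_iff) simp
  ultimately show ?thesis using chi_Irr by (simp add: nl_def chi_of_def)
qed

text \<open>Off the center, choose \<open>w\<close> not commuting with \<open>g\<close>: replacing
  \<open>x\<close> by \<open>x \<otimes> w\<close> reproduces the sum times \<open>\<psi> c\<close>
  for a nontrivial central \<open>c\<close>. This factor is not 1, so the sum vanishes. On the
  center the degree appears as the quotient of \<open>p ^ 5\<close> by \<open>p ^ 3\<close>.\<close>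

lemma induced_char_psi: "induced_char G H \<psi> = chi_of p G \<mu>"
proof
  fix g
  let ?f = "\<lambda>y. if y \<in> H then \<psi> y else 0"
  have ind: "induced_char G H \<psi> g = (\<Sum>x\<in>carrier G. ?f (x \<otimes> g \<otimes> inv x)) / of_nat (p ^ 3)" if "g \<in> carrier G"
    using that by (simp add: induced_char_def Let_def card_H)
  consider "g \<notin> carrier G" | "g \<in> Z" | "g \<in> carrier G" "g \<notin> Z" by blast
  then show "induced_char G H \<psi> g = chi_of p G \<mu> g"
  proof cases
    case 1
    then show ?thesis using Z_carrier by (auto simp: induced_char_def chi_of_def)
  next
    case 2
    have "x \<otimes> g \<otimes> inv x = g" if "x \<in> carrier G" for x
      using that Z_comm[OF 2 that, symmetric] Z_carrier[OF 2] by (simp add: m_assoc)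
    then have "induced_char G H \<psi> g = of_nat (p ^ 5) * \<mu> g / of_nat (p ^ 3)"
      using ind[OF Z_carrier[OF 2]] 2 ZH by (auto simp: psi_center card_G)
    also have "\<dots> = of_nat (p ^ 2) * \<mu> g"
      using p_pos by (simp add: field_simps flip: power_add)
    finally show ?thesis using 2 by (simp add: chi_of_def)
  next
    case 3
    obtain w where w: "w \<in> carrier G" "g \<otimes> w \<noteq> w \<otimes> g" using 3 by (auto simp: center_def)
    from conj_eq[OF 3(1) w(1)] w(2) obtain c where c: "c \<in> Z" "inv w \<otimes> g \<otimes> w = g \<otimes> c" "c \<noteq> \<one>" by metis
    have cH: "c \<in> H" using c ZH by auto
    have "(\<Sum>x\<in>carrier G. ?f (x \<otimes> g \<otimes> inv x)) = (\<Sum>x\<in>carrier G. ?f (x \<otimes> g \<otimes> inv x) * \<psi> c)"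
    proof (rule sum.reindex_bij_witness[of _ "\<lambda>x. x \<otimes> inv w" "\<lambda>x. x \<otimes> w"])
      fix x assume x: "x \<in> carrier G"
      note car = x w(1) 3(1) Z_carrier[OF c(1)]
      show "x \<otimes> w \<otimes> inv w = x" "x \<otimes> inv w \<otimes> w = x" using car by (simp_all add: m_assoc)
      show "x \<otimes> w \<in> carrier G" "x \<otimes> inv w \<in> carrier G" using car by auto
      have "x \<otimes> g \<otimes> inv x = x \<otimes> w \<otimes> (inv w \<otimes> g \<otimes> w) \<otimes> inv (x \<otimes> w)"
        using car by (simp add: m_assoc inv_mult_group mult_cancel)
      also have "\<dots> = x \<otimes> w \<otimes> g \<otimes> (c \<otimes> inv (x \<otimes> w))" using car by (simp add: c m_assoc)
      also have "c \<otimes> inv (x \<otimes> w) = inv (x \<otimes> w) \<otimes> c" using car c by (intro Z_comm) auto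
      finally have eq: "x \<otimes> g \<otimes> inv x = (x \<otimes> w \<otimes> g \<otimes> inv (x \<otimes> w)) \<otimes> c"
        using car by (simp add: m_assoc)
      let ?y = "x \<otimes> w \<otimes> g \<otimes> inv (x \<otimes> w)"
      have y: "?y \<in> carrier G" using car by simp
      have "?y \<otimes> c \<in> H \<longleftrightarrow> ?y \<in> H"
      proof
        assume "?y \<otimes> c \<in> H"
        then have "?y \<otimes> c \<otimes> inv c \<in> H" using cH H by (simp add: subgroup.m_closed subgroup.m_inv_closed)
        moreover have "?y \<otimes> c \<otimes> inv c = ?y" using y car(4) by (simp only: m_assoc inv_closed r_inv r_one)
        ultimately show "?y \<in> H" by simp
      qed (rule subgroup.m_closed[OF H _ cH])
      then show "?f (x \<otimes> w \<otimes> g \<otimes> inv (x \<otimes> w)) * \<psi> c = ?f (x \<otimes> g \<otimes> inv x)"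
        unfolding eq using psiD cH by auto
    qed
    then have "(\<Sum>x\<in>carrier G. ?f (x \<otimes> g \<otimes> inv x)) * (1 - \<psi> c) = 0"
      by (simp add: right_diff_distrib flip: sum_distrib_right)
    moreover have "\<psi> c \<noteq> 1" using hom_Z_neq_1[OF hom_Z_lin(2)[OF psi_lin] psi_z c(1,3)] .
    ultimately show ?thesis using ind[OF 3(1)] 3 by (simp add: chi_of_def)
  qed
qed

lemma fields_eq: "field_of_values (subgrp G H) \<psi> = field_of_values G (chi_of p G \<mu>)"
proof -
  have zH: "z \<in> H" using z ZH by auto
  have "field_of_values (subgrp G H) \<psi> = cyc (\<psi> z)"
    using psi_power zH by (intro w.field_of_values_linear) auto
  moreover have "field_of_values G (chi_of p G \<mu>) = cyc (\<psi> z)"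
    unfolding field_of_values_def
  proof (rule w.generate_field_eq_cyc)
    show "chi_of p G \<mu> ` carrier G \<subseteq> cyc (\<psi> z)"
    proof safe
      fix g
      have "\<mu> g \<in> cyc (\<psi> z)" if "g \<in> Z"
      proof -
        have "\<mu> g \<in> {x. x ^ p = 1}" using hom_Z_power[OF hom_Z_lin(1)[OF \<mu>(1)] that] by simp
        then show ?thesis unfolding w.roots_eq by (metis imageE cyc_power cyc_self)
      qed
      then show "chi_of p G \<mu> g \<in> cyc (\<psi> z)"
        using cyc_of_rat[of 0 "\<psi> z"] cyc_of_rat[of "of_nat (p ^ 2)" "\<psi> z"] cyc_mult
        by (auto simp: chi_of_def simp del: of_nat_power)
    qed
    \<comment> \<open>The value of the character at \<open>z\<close>; dividing by the rational
      number \<open>p ^ 2\<close> recovers \<open>\<psi> z\<close>.\<close>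
    let ?x = "of_nat (p ^ 2) * \<psi> z"
    have "?x = chi_of p G \<mu> z" using z by (simp add: chi_of_def psi_center)
    then have "?x \<in> generate_field class_ring (chi_of p G \<mu> ` carrier G)"
      using z Z_carrier by (auto intro: generate_field.incl)
    then have "cyc ?x \<subseteq> generate_field class_ring (chi_of p G \<mu> ` carrier G)"
      by (rule generate_field_cyc_subset)
    moreover have "of_rat (1 / of_nat (p ^ 2)) * ?x \<in> cyc ?x" by (intro cyc_mult cyc_of_rat cyc_self)
    moreover have "of_rat (1 / of_nat (p ^ 2)) * ?x = \<psi> z"
      using p_pos by (simp add: of_rat_divide of_rat_power)
    ultimately show "\<psi> z \<in> generate_field class_ring (chi_of p G \<mu> ` carrier G)"
      by (metis subsetD)
  qed
  ultimately show ?thesis by simp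
qed

lemma required_pair_psi: "required_pair G (chi_of p G \<mu>) H \<psi>"
  unfolding required_pair_def
  using chi_Irr H psi_lin induced_char_psi fields_eq by blast

lemma Omega_psi: "h \<in> H \<Longrightarrow> Omega (subgrp G H) \<psi> h = (if \<psi> h = 1 then of_nat p - 1 else - 1)"
  using psi_power z ZH by (intro w.Omega_linear[OF groups(2) psi_lin, where z = z]) auto

lemma rational_rep_psi: "\<exists>n \<Psi>. irr_rat_rep_affording (subgrp G H) n \<Psi> (Omega (subgrp G H) \<psi>)"
proof -
  have "z \<in> carrier (subgrp G H)" using z ZH by auto
  then obtain \<Psi> :: "'a \<Rightarrow> rat mat" where \<Psi>: "irreducible_rep (subgrp G H) (p - 1) \<Psi>"
    "\<And>g. g \<in> H \<Longrightarrow> mat_trace (\<Psi> g) = (if \<psi> g = 1 then of_nat p - 1 else - 1)"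
    using w.rational_rep_exists[OF groups(2) psi_lin _ _ refl] psi_power by auto
  then show ?thesis
    by (intro exI[of _ "p - 1"] exI[of _ \<Psi>])
      (auto simp: irr_rat_rep_affording_def affords_over_rat_def character_def Omega_psi of_rat_diff)
qed

section \<open>Induction of rational representations affording Omega(psi)\<close>

context
  fixes n and \<Psi> :: "'a \<Rightarrow> rat mat"
  assumes \<Psi>: "irr_rat_rep_affording (subgrp G H) n \<Psi> (Omega (subgrp G H) \<psi>)"
begin

lemma irr_Psi: "irreducible_rep (subgrp G H) n \<Psi>" using \<Psi> by (simp add: irr_rat_rep_affording_def)
lemma mr_Psi: "matrix_rep (subgrp G H) n \<Psi>" using irr_Psi by (simp add: irreducible_rep_iff)
lemmas PsiD = matrix_repD[OF mr_Psi groups(2), simplified]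

lemma trace_Psi:
  assumes h: "h \<in> H"
  shows "mat_trace (\<Psi> h) = (if \<psi> h = 1 then of_nat p - 1 else - 1)"
proof -
  have "of_rat (mat_trace (\<Psi> h)) = Omega (subgrp G H) \<psi> h"
    using \<Psi> h by (simp add: irr_rat_rep_affording_def affords_over_rat_def character_def)
  also have "\<dots> = of_rat (if \<psi> h = 1 then of_nat p - 1 else - 1)"
    using h by (simp add: Omega_psi of_rat_diff)
  finally show ?thesis by (simp only: of_rat_eq_iff)
qed

lemma H_subgroups: "subgroup K (subgrp G H)" "subgroup Z (subgrp G H)"
  using Z K H ZH KH by (auto intro: subgroup_incl)

text \<open>Only the character of \<open>\<Psi>\<close> is known. It equals \<open>p - 1\<close> on
  all of \<open>K\<close>, so the sum over \<open>K\<close> has nonzero trace, and in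
  \<open>msum_central_subgroup\<close>, applied to \<open>K\<close> inside the abelian
  \<open>H\<close>, triviality remains.\<close>

lemma Psi_K: "k \<in> K \<Longrightarrow> \<Psi> k = 1\<^sub>m n"
proof -
  have "msum n n \<Psi> K \<noteq> 0\<^sub>m n n"
  proof
    assume "msum n n \<Psi> K = 0\<^sub>m n n"
    then have "mat_trace (msum n n \<Psi> K) = 0" by simp
    moreover have "mat_trace (msum n n \<Psi> K) = (\<Sum>k\<in>K. mat_trace (\<Psi> k))"
      using PsiD(1) KH by (intro mat_trace_msum) auto
    moreover have "\<dots> = of_nat (card K) * (of_nat p - 1)"
      using trace_Psi KH \<psi> by (simp add: is_psi_def subset_iff)
    moreover have "card K \<noteq> 0" using finite_K subgroup.one_closed[OF K] by auto
    ultimately show False using prime_gt_1_nat[OF p] by auto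
  qed
  moreover have "k \<otimes> g = g \<otimes> k" if "k \<in> K" "g \<in> H" for k g using that KH H_comm by blast
  ultimately show "k \<in> K \<Longrightarrow> \<Psi> k = 1\<^sub>m n"
    using msum_central_subgroup[OF groups(2) irr_Psi H_subgroups(1)] by auto
qed

text \<open>Were \<open>\<Psi> z\<close> the identity, its trace would be the degree
  \<open>n\<close>, but it is \<open>- 1\<close>.\<close>

lemma Psi_msum: "msum n n \<Psi> Z = 0\<^sub>m n n"
proof -
  have "\<Psi> z \<noteq> 1\<^sub>m n"
  proof
    assume "\<Psi> z = 1\<^sub>m n"
    then have "(of_nat n :: rat) = - 1" using trace_Psi[of z] psi_z z ZH by auto
    then show False using of_nat_0_le_iff[of n, where 'a = rat] by simp
  qed
  moreover have "c \<otimes> g = g \<otimes> c" if "c \<in> Z" "g \<in> H" for c g using that Z_comm H_carrier by blast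
  ultimately show ?thesis
    using msum_central_subgroup[OF groups(2) irr_Psi H_subgroups(2)] z by auto
qed

context
  fixes ts assumes ts: "left_transversal G H ts"
begin

lemma irr_ind_Psi: "irreducible_rep G (length ts * n) (induced_rep G H ts n \<Psi>)"
  by (rule irreducible_ind[OF ts mr_Psi Psi_msum irr_Psi Psi_K])

lemma kernel_ind_Psi: "\<not> commutator_subgroup G \<subseteq> rep_kernel G (length ts * n) (induced_rep G H ts n \<Psi>)"
proof
  let ?N = "length ts * n"
  assume "commutator_subgroup G \<subseteq> rep_kernel G ?N (induced_rep G H ts n \<Psi>)"
  then have "induced_rep G H ts n \<Psi> z = 1\<^sub>m ?N" using z by (auto simp: derived rep_kernel_iff)
  then have "(of_nat ?N :: rat) = of_nat (length ts) * mat_trace (\<Psi> z)"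
    using mat_trace_ind_center[OF ts mr_Psi z(1)] mat_trace_one[of ?N, where 'k = rat] by metis
  then have "(of_nat n :: rat) = - 1"
    using trace_Psi[of z] psi_z z ZH length_transversal[OF ts] p_pos by auto
  then show False using of_nat_0_le_iff[of n, where 'a = rat] by simp
qed

text \<open>The product of characters lives on \<open>Z\<close>, where the induced trace is
  \<open>length ts\<close> times \<open>p - 1\<close> at the identity and times \<open>- 1\<close>
  elsewhere. The traces of \<open>\<rho>\<close> on \<open>Z\<close> sum to zero, which leaves
  \<open>length ts * N * p\<close>. These values are the same for every
  \<open>\<mu>\<close>.\<close>

lemma equivalent_ind_Psi:
  fixes \<rho> :: "'a \<Rightarrow> rat mat"
  assumes \<rho>: "irreducible_rep G N \<rho>" and ker: "\<not> commutator_subgroup G \<subseteq> rep_kernel G N \<rho>"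
  shows "equivalent_reps G \<rho> (induced_rep G H ts n \<Psi>)"
proof -
  let ?\<tau> = "induced_rep G H ts n \<Psi>"
  have mr: "matrix_rep G N \<rho>" and N: "0 < N" using \<rho> by (auto simp: irreducible_rep_iff)
  note D = matrix_repD[OF mr is_group]
  have "\<not> (\<forall>c\<in>Z. \<rho> c = 1\<^sub>m N)" using ker Z_carrier by (auto simp: derived rep_kernel_iff)
  then have sum: "msum N N \<rho> Z = 0\<^sub>m N N"
    using msum_central_subgroup[OF is_group \<rho> Z] Z_comm by blast
  have "(\<Sum>g\<in>carrier G. mat_trace (\<rho> g) * mat_trace (?\<tau> (inv g))) =
      (\<Sum>c\<in>Z. mat_trace (\<rho> c) * mat_trace (?\<tau> (inv c)))"
  proof (rule sum.mono_neutral_right[OF fin])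
    show "Z \<subseteq> carrier G" using Z_carrier by blast
    show "\<forall>g\<in>carrier G - Z. mat_trace (\<rho> g) * mat_trace (?\<tau> (inv g)) = 0"
      using mat_trace_off_center[OF mr sum] by simp
  qed
  \<comment> \<open>The values \<open>p - 1\<close> and \<open>- 1\<close> are written as
    \<open>p\<close> at the identity minus 1 everywhere, so that the zero sum of traces can be
    used.\<close>
  also have "\<dots> = (\<Sum>c\<in>Z. of_nat (length ts) * (mat_trace (\<rho> c) * (if c = \<one> then of_nat p else 0) - mat_trace (\<rho> c)))"
  proof (rule sum.cong[OF refl])
    fix c assume c: "c \<in> Z"
    have ci: "inv c \<in> Z" using c by (rule subgroup.m_inv_closed[OF Z])
    have "\<psi> (inv c) = 1 \<longleftrightarrow> c = \<one>"
      using hom_Z_neq_1[OF hom_Z_lin(2)[OF psi_lin] psi_z ci] psiD c Z_carrier inv_eq_1_iff by auto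
    then have "mat_trace (?\<tau> (inv c)) = of_nat (length ts) * (if c = \<one> then of_nat p - 1 else - 1)"
      using mat_trace_ind_center[OF ts mr_Psi ci] trace_Psi[of "inv c"] ci ZH by auto
    then show "mat_trace (\<rho> c) * mat_trace (?\<tau> (inv c)) =
        of_nat (length ts) * (mat_trace (\<rho> c) * (if c = \<one> then of_nat p else 0) - mat_trace (\<rho> c))"
      by (simp add: algebra_simps)
  qed
  also have "\<dots> = of_nat (length ts) * ((\<Sum>c\<in>Z. if c = \<one> then mat_trace (\<rho> \<one>) * of_nat p else 0) - (\<Sum>c\<in>Z. mat_trace (\<rho> c)))"
    by (simp add: sum_subtractf flip: sum_distrib_left)
      (intro disjI2 sum.cong; simp)
  also have "(\<Sum>c\<in>Z. mat_trace (\<rho> c)) = mat_trace (msum N N \<rho> Z)"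
    using D(1) Z_carrier by (intro mat_trace_msum[symmetric]) auto
  also have "\<dots> = 0" using sum by simp
  also have "(\<Sum>c\<in>Z. if c = \<one> then mat_trace (\<rho> \<one>) * of_nat p else 0) = (of_nat N * of_nat p :: rat)"
    using finite_Z subgroup.one_closed[OF Z] D(3) by simp
  finally have "(\<Sum>g\<in>carrier G. mat_trace (\<rho> g) * mat_trace (?\<tau> (inv g))) \<noteq> 0"
    using N p_pos length_transversal[OF ts] by simp
  then show ?thesis using equivalent_if_char_product_nonzero[OF is_group \<rho> irr_ind_Psi] by blast
qed

end

end

end

text \<open>For the harder inclusion, the center acts by scalars \<open>\<mu>\<close>. If these were
  trivial, all matrices would commute, hence be scalar, and the degree would be 1. Otherwise the
  representation is compared with the induced one for \<open>\<mu>\<close>: each central element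
  contributes the same nonzero amount, since \<open>\<mu> c\<close> and \<open>\<mu> (inv c)\<close>
  cancel.\<close>

lemma nl_eq: "nl G = chi_of p G ` Irr_over (subgrp G Z) (commutator_subgroup G)"
proof (intro equalityI subsetI)
  fix \<chi> assume "\<chi> \<in> chi_of p G ` Irr_over (subgrp G Z) (commutator_subgroup G)"
  then obtain \<mu> where \<mu>: "\<mu> \<in> lin (subgrp G Z)" "\<mu> z \<noteq> 1" "\<chi> = chi_of p G \<mu>" by (auto simp: M_iff)
  then show "\<chi> \<in> nl G" using ex1_psi[OF \<mu>(1)] chi_nl[OF \<mu>(1,2)] by blast
next
  fix \<chi> assume "\<chi> \<in> nl G"
  then obtain N \<rho> where \<rho>: "irreducible_rep G N \<rho>" and \<chi>: "\<chi> = character G \<rho>" and ne: "\<chi> \<one> \<noteq> 1"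
    by (auto simp: nl_def Irr_def)
  have mr: "matrix_rep G N \<rho>" and N: "0 < N" using \<rho> by (auto simp: irreducible_rep_iff)
  note D = matrix_repD[OF mr is_group]
  have N1: "N \<noteq> 1" using ne by (auto simp: \<chi> character_def D(3))
  define \<mu> where "\<mu> c = (if c \<in> Z then \<rho> c $$ (0, 0) else 0)" for c
  have sc: "\<rho> c = \<mu> c \<cdot>\<^sub>m 1\<^sub>m N" if c: "c \<in> Z" for c
  proof -
    have "\<rho> g * \<rho> c = \<rho> c * \<rho> g" if "g \<in> carrier G" for g
      using Z_comm[OF c that] that Z_carrier[OF c] by (metis D(2))
    then obtain a where "\<rho> c = a \<cdot>\<^sub>m 1\<^sub>m N" using commuting_scalar[OF is_group \<rho> D(1)[OF Z_carrier[OF c]]] by blast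
    then show ?thesis using N c by (simp add: \<mu>_def)
  qed
  have \<mu>: "\<mu> \<in> lin (subgrp G Z)"
    unfolding lin_iff[OF groups(1)]
  proof (intro conjI ballI allI impI)
    fix c d assume cd: "c \<in> carrier (subgrp G Z)" "d \<in> carrier (subgrp G Z)"
    then have "\<rho> (c \<otimes> d) = \<rho> c * \<rho> d" using D(2) Z_carrier by simp
    also have "\<dots> = (\<mu> c * \<mu> d) \<cdot>\<^sub>m 1\<^sub>m N" using sc cd by (auto intro!: eq_matI)
    finally show "\<mu> (c \<otimes>\<^bsub>subgrp G Z\<^esub> d) = \<mu> c * \<mu> d"
      using N cd subgroup.m_closed[OF Z] by (simp add: \<mu>_def)
  next
    show "\<mu> \<one>\<^bsub>subgrp G Z\<^esub> = 1" using D(3) N subgroup.one_closed[OF Z] by (simp add: \<mu>_def)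
  qed (simp add: \<mu>_def)
  have \<mu>z: "\<mu> z \<noteq> 1"
  proof
    assume "\<mu> z = 1"
    then have one: "\<mu> c = 1" if "c \<in> Z" for c
      using hom_Z_eqI[OF hom_Z_lin(1)[OF \<mu>], of "\<lambda>_. 1" z] that z by (auto simp: hom_Z_def)
    have comm: "\<rho> h * \<rho> g = \<rho> g * \<rho> h" if gh: "g \<in> carrier G" "h \<in> carrier G" for g h
    proof -
      obtain c where c: "c \<in> Z" "inv h \<otimes> g \<otimes> h = g \<otimes> c" using conj_eq[OF gh] by metis
      have "h \<otimes> (inv h \<otimes> g \<otimes> h) = g \<otimes> h" using gh by (simp add: m_assoc mult_cancel)
      then have "g \<otimes> h = h \<otimes> (g \<otimes> c)" using c by simp
      then have "\<rho> g * \<rho> h = \<rho> h * (\<rho> g * \<rho> c)" using gh Z_carrier[OF c(1)] by (simp flip: D(2))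
      also have "\<rho> c = 1\<^sub>m N" using sc[OF c(1)] one[OF c(1)] by (auto intro!: eq_matI)
      also have "\<rho> g * 1\<^sub>m N = \<rho> g" using D(1)[OF gh(1)] by simp
      finally show ?thesis by simp
    qed
    have "\<exists>a. \<rho> g = a \<cdot>\<^sub>m 1\<^sub>m N" if "g \<in> carrier G" for g
      using commuting_scalar[OF is_group \<rho> D(1)[OF that]] comm[OF that] by metis
    then show False using scalar_irreducible_dim[OF \<rho>] N1 by blast
  qed
  obtain \<psi> where \<psi>: "is_psi \<mu> \<psi>" using ex1_psi[OF \<mu>] by blast
  obtain ts where ts: "left_transversal G H ts" using left_transversal_exists by blast
  let ?\<tau> = "induced_rep G H ts 1 (\<lambda>h. mat 1 1 (\<lambda>_. \<psi> h))"
  note \<tau> = chi_rep[OF \<mu> \<mu>z \<psi> ts]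
  have "(\<Sum>g\<in>carrier G. mat_trace (\<rho> g) * mat_trace (?\<tau> (inv g))) =
      (\<Sum>c\<in>Z. mat_trace (\<rho> c) * mat_trace (?\<tau> (inv c)))"
  proof (rule sum.mono_neutral_right[OF fin])
    show "Z \<subseteq> carrier G" using Z_carrier by blast
    show "\<forall>g\<in>carrier G - Z. mat_trace (\<rho> g) * mat_trace (?\<tau> (inv g)) = 0"
    proof
      fix g assume g: "g \<in> carrier G - Z"
      then have "inv g \<notin> Z" using subgroup.m_inv_closed[OF Z, of "inv g"] by auto
      then show "mat_trace (\<rho> g) * mat_trace (?\<tau> (inv g)) = 0"
        using g \<tau>(2)[OF inv_closed, of g] by (simp add: chi_of_def del: One_nat_def)
    qed
  qed
  also have "\<dots> = (\<Sum>c\<in>Z. of_nat N * of_nat (p ^ 2))"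
  proof (rule sum.cong[OF refl])
    fix c assume c: "c \<in> Z"
    have ci: "inv c \<in> Z" using c by (rule subgroup.m_inv_closed[OF Z])
    have "mat_trace (\<rho> c) = \<mu> c * of_nat N"
      using sc[OF c] mat_trace_smult[OF one_carrier_mat, of "\<mu> c" N] by simp
    then have "mat_trace (\<rho> c) * mat_trace (?\<tau> (inv c)) = of_nat N * of_nat (p ^ 2) * (\<mu> c * \<mu> (inv c))"
      using ci by (simp add: \<tau>(2)[OF Z_carrier[OF ci]] chi_of_def del: One_nat_def)
    then show "mat_trace (\<rho> c) * mat_trace (?\<tau> (inv c)) = of_nat N * of_nat (p ^ 2)"
      by (simp only: hom_Z_inv[OF hom_Z_lin(1)[OF \<mu>] c] mult_1_right)
  qed
  also have "\<dots> \<noteq> 0" using N p_pos card_center by simp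
  finally have eq: "equivalent_reps G \<rho> ?\<tau>"
    using equivalent_if_char_product_nonzero[OF is_group \<rho> \<tau>(1)] by blast
  have "\<chi> = chi_of p G \<mu>"
    using mat_trace_equivalent[OF eq] \<tau>(2) Z_carrier
    by (auto simp: \<chi> character_def fun_eq_iff chi_of_def)
  then show "\<chi> \<in> chi_of p G ` Irr_over (subgrp G Z) (commutator_subgroup G)"
    using \<mu> \<mu>z by (auto simp: M_iff)
qed

end

section \<open>Normal forms in the two presented groups\<close>

text \<open>Each \<open>s\<close> that moves past a \<open>t\<close> leaves one factor
  \<open>c\<close>, which commutes with both.\<close>

lemma (in group) pow_mult_commutator:
  assumes car: "s \<in> carrier G" "t \<in> carrier G" "c \<in> carrier G"
    and comm: "c \<otimes> s = s \<otimes> c" "c \<otimes> t = t \<otimes> c" "s \<otimes> t = t \<otimes> s \<otimes> c"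
  shows "s [^] (a::nat) \<otimes> t [^] (k::nat) = t [^] k \<otimes> s [^] a \<otimes> c [^] (a * k)"
proof -
  have cs: "c [^] n \<otimes> s = s \<otimes> c [^] n" for n :: nat using group_commutes_pow comm car by blast
  have ct: "c [^] n \<otimes> t = t \<otimes> c [^] n" for n :: nat using group_commutes_pow comm car by blast
  have one: "s [^] a \<otimes> t = t \<otimes> s [^] a \<otimes> c [^] a" for a :: nat
  proof (induction a)
    case 0
    then show ?case using car by simp
  next
    case (Suc a)
    have "s [^] Suc a \<otimes> t = s [^] a \<otimes> (s \<otimes> t)" using car by (simp add: m_assoc)
    also have "\<dots> = (s [^] a \<otimes> t) \<otimes> (s \<otimes> c)" using car by (simp add: comm m_assoc)
    also have "\<dots> = t \<otimes> s [^] a \<otimes> (c [^] a \<otimes> s) \<otimes> c" using car by (simp add: Suc m_assoc)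
    also have "\<dots> = t \<otimes> s [^] Suc a \<otimes> c [^] Suc a" using car by (simp add: cs m_assoc)
    finally show ?case .
  qed
  show ?thesis
  proof (induction k)
    case 0
    then show ?case using car by simp
  next
    case (Suc k)
    have "s [^] a \<otimes> t [^] Suc k = s [^] a \<otimes> t [^] k \<otimes> t" using car by (simp add: m_assoc)
    also have "\<dots> = t [^] k \<otimes> s [^] a \<otimes> (c [^] (a * k) \<otimes> t)" using car by (simp add: Suc m_assoc)
    also have "\<dots> = t [^] k \<otimes> (s [^] a \<otimes> t) \<otimes> c [^] (a * k)" using car by (simp add: ct m_assoc)
    also have "\<dots> = t [^] Suc k \<otimes> s [^] a \<otimes> (c [^] a \<otimes> c [^] (a * k))" using car by (simp add: one m_assoc)
    also have "c [^] a \<otimes> c [^] (a * k) = c [^] (a * Suc k)" using car by (simp add: nat_pow_mult)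
    finally show ?case .
  qed
qed

text \<open>Common shape of both presentations: commutation pairs \<open>x\<close> with
  \<open>u\<close> and \<open>y\<close> with \<open>v\<close>. The \<open>p\<close>-th powers of
  \<open>x\<close> and \<open>y\<close> are trivial, while those of \<open>u\<close> and
  \<open>v\<close> may be any power of \<open>z\<close>; this admits the generator of order
  \<open>p ^ 2\<close> in the first group.\<close>

locale phi5_gens = group G for G :: "('a, 'b) monoid_scheme" (structure) +
  fixes p :: nat and x y u v z :: 'a
  assumes p: "Factorial_Ring.prime p" and card_G: "card (carrier G) = p ^ 5"
    and gens: "x \<in> carrier G" "y \<in> carrier G" "u \<in> carrier G" "v \<in> carrier G" "z \<in> carrier G"
    and gen: "generate G {x, y, u, v, z} = carrier G"
    and z_comm: "z \<otimes> x = x \<otimes> z" "z \<otimes> y = y \<otimes> z" "z \<otimes> u = u \<otimes> z" "z \<otimes> v = v \<otimes> z"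
    and xu: "x \<otimes> u = u \<otimes> x \<otimes> z" and yv: "y \<otimes> v = v \<otimes> y \<otimes> z"
    and yu: "y \<otimes> u = u \<otimes> y" and xv: "x \<otimes> v = v \<otimes> x" and uv: "u \<otimes> v = v \<otimes> u" and xy: "x \<otimes> y = y \<otimes> x"
    and pow_p: "x [^] p = \<one>" "y [^] p = \<one>" "z [^] p = \<one>"
    and u_pow: "\<exists>e::nat. u [^] p = z [^] e" and v_pow: "\<exists>e::nat. v [^] p = z [^] e"
begin

lemma fin: "finite (carrier G)"
  using card_G p by (metis card.infinite power_eq_0_iff prime_gt_0_nat less_irrefl)

lemma p_gt_1: "p > 1" using p by (rule prime_gt_1_nat)

lemma z_central: "g \<in> carrier G \<Longrightarrow> z \<otimes> g = g \<otimes> z"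
proof -
  have "subgroup {g \<in> carrier G. z \<otimes> g = g \<otimes> z} G"
  proof (rule finite_submonoid_subgroup[OF fin])
    fix a b assume ab: "a \<in> {g \<in> carrier G. z \<otimes> g = g \<otimes> z}" "b \<in> {g \<in> carrier G. z \<otimes> g = g \<otimes> z}"
    have "z \<otimes> (a \<otimes> b) = (z \<otimes> a) \<otimes> b" using ab gens by (intro m_assoc[symmetric]) auto
    also have "\<dots> = (a \<otimes> z) \<otimes> b" using ab by simp
    also have "\<dots> = a \<otimes> (z \<otimes> b)" using ab gens by (intro m_assoc) auto
    also have "\<dots> = a \<otimes> (b \<otimes> z)" using ab by simp
    also have "\<dots> = a \<otimes> b \<otimes> z" using ab gens by (intro m_assoc[symmetric]) auto
    finally show "a \<otimes> b \<in> {g \<in> carrier G. z \<otimes> g = g \<otimes> z}" using ab by simp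
  qed (use gens in auto)
  then have "generate G {x, y, u, v, z} \<subseteq> {g \<in> carrier G. z \<otimes> g = g \<otimes> z}"
    using gens z_comm by (intro generate_subgroup_incl) auto
  then show "g \<in> carrier G \<Longrightarrow> z \<otimes> g = g \<otimes> z" using gen by auto
qed

lemma zp_central: "g \<in> carrier G \<Longrightarrow> z [^] (n::nat) \<otimes> g = g \<otimes> z [^] n"
  using group_commutes_pow[OF z_central] gens by blast

lemma pow_comm:
  "s \<in> carrier G \<Longrightarrow> t \<in> carrier G \<Longrightarrow> s \<otimes> t = t \<otimes> s \<Longrightarrow> s [^] (a::nat) \<otimes> t [^] (k::nat) = t [^] k \<otimes> s [^] a"
  using pow_mult_commutator[of s t \<one> a k] by simp

text \<open>Exponents are arbitrary naturals, so products follow \<open>nf_mult\<close> without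
  carries; reduction modulo \<open>p\<close> is left to \<open>nf_reduce\<close>.\<close>

definition nf :: "nat \<Rightarrow> nat \<Rightarrow> nat \<Rightarrow> nat \<Rightarrow> nat \<Rightarrow> 'a" where
  "nf k l a b c = u [^] k \<otimes> v [^] l \<otimes> (x [^] a \<otimes> y [^] b) \<otimes> z [^] c"

lemma nf_carrier: "nf k l a b c \<in> carrier G" using gens by (simp add: nf_def)

lemma two_pow_mult:
  assumes "s \<in> carrier G" "t \<in> carrier G" "s \<otimes> t = t \<otimes> s"
  shows "s [^] (a::nat) \<otimes> t [^] (b::nat) \<otimes> (s [^] (a'::nat) \<otimes> t [^] (b'::nat)) = s [^] (a + a') \<otimes> t [^] (b + b')"
proof -
  have "s [^] a \<otimes> t [^] b \<otimes> (s [^] a' \<otimes> t [^] b') = s [^] a \<otimes> (t [^] b \<otimes> s [^] a') \<otimes> t [^] b'"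
    using assms by (simp add: m_assoc)
  also have "t [^] b \<otimes> s [^] a' = s [^] a' \<otimes> t [^] b" using assms pow_comm by metis
  also have "s [^] a \<otimes> (s [^] a' \<otimes> t [^] b) \<otimes> t [^] b' = (s [^] a \<otimes> s [^] a') \<otimes> (t [^] b \<otimes> t [^] b')"
    using assms by (simp add: m_assoc)
  finally show ?thesis using assms by (simp add: nat_pow_mult)
qed

lemma xy_uv:
  "(x [^] a \<otimes> y [^] b) \<otimes> (u [^] k \<otimes> v [^] l) = (u [^] k \<otimes> v [^] l) \<otimes> (x [^] a \<otimes> y [^] b) \<otimes> z [^] (a * k + b * l :: nat)"
  for a b k l :: nat
proof -
  note xu' = pow_mult_commutator[OF gens(1,3,5) z_comm(1,3) xu, of a k]
  note yv' = pow_mult_commutator[OF gens(2,4,5) z_comm(2,4) yv, of b l]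
  note yu' = pow_comm[OF gens(2,3) yu, of b k]
  note xv' = pow_comm[OF gens(1,4) xv, of a l]
  have "(x [^] a \<otimes> y [^] b) \<otimes> (u [^] k \<otimes> v [^] l) = x [^] a \<otimes> (y [^] b \<otimes> u [^] k) \<otimes> v [^] l"
    using gens by (simp add: m_assoc)
  also have "\<dots> = (x [^] a \<otimes> u [^] k) \<otimes> (y [^] b \<otimes> v [^] l)" using gens by (simp add: yu' m_assoc)
  also have "\<dots> = u [^] k \<otimes> x [^] a \<otimes> (z [^] (a * k) \<otimes> (v [^] l \<otimes> y [^] b)) \<otimes> z [^] (b * l)"
    using gens by (simp add: xu' yv' m_assoc)
  also have "z [^] (a * k) \<otimes> (v [^] l \<otimes> y [^] b) = (v [^] l \<otimes> y [^] b) \<otimes> z [^] (a * k)"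
    using gens by (intro zp_central) auto
  also have "u [^] k \<otimes> x [^] a \<otimes> ((v [^] l \<otimes> y [^] b) \<otimes> z [^] (a * k)) \<otimes> z [^] (b * l) =
      u [^] k \<otimes> (x [^] a \<otimes> v [^] l) \<otimes> y [^] b \<otimes> (z [^] (a * k) \<otimes> z [^] (b * l))"
    using gens by (simp add: m_assoc)
  also have "\<dots> = (u [^] k \<otimes> v [^] l) \<otimes> (x [^] a \<otimes> y [^] b) \<otimes> z [^] (a * k + b * l)"
    using gens by (simp add: xv' nat_pow_mult m_assoc)
  finally show ?thesis .
qed

text \<open>The Heisenberg law: the only correction comes from moving \<open>x\<close> past
  \<open>u\<close> and \<open>y\<close> past \<open>v\<close>, at the cost of one \<open>z\<close>
  for each crossing.\<close>

lemma nf_mult: "nf k l a b c \<otimes> nf k' l' a' b' c' = nf (k + k') (l + l') (a + a') (b + b') (c + c' + (a * k' + b * l'))"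
proof -
  define P P' Q Q' where "P = u [^] k \<otimes> v [^] l" and "P' = u [^] k' \<otimes> v [^] l'"
    and "Q = x [^] a \<otimes> y [^] b" and "Q' = x [^] a' \<otimes> y [^] b'"
  have car: "P \<in> carrier G" "P' \<in> carrier G" "Q \<in> carrier G" "Q' \<in> carrier G"
    using gens by (simp_all add: P_def P'_def Q_def Q'_def)
  let ?m = "a * k' + b * l'"
  have "(P \<otimes> Q \<otimes> z [^] c) \<otimes> (P' \<otimes> Q' \<otimes> z [^] c') = P \<otimes> Q \<otimes> (z [^] c \<otimes> (P' \<otimes> Q')) \<otimes> z [^] c'"
    using car gens by (simp add: m_assoc)
  also have "z [^] c \<otimes> (P' \<otimes> Q') = (P' \<otimes> Q') \<otimes> z [^] c" using car by (intro zp_central) auto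
  also have "P \<otimes> Q \<otimes> ((P' \<otimes> Q') \<otimes> z [^] c) \<otimes> z [^] c' = P \<otimes> (Q \<otimes> P') \<otimes> Q' \<otimes> (z [^] c \<otimes> z [^] c')"
    using car gens by (simp add: m_assoc)
  also have "Q \<otimes> P' = P' \<otimes> Q \<otimes> z [^] ?m" unfolding Q_def P'_def by (rule xy_uv)
  also have "P \<otimes> (P' \<otimes> Q \<otimes> z [^] ?m) \<otimes> Q' \<otimes> (z [^] c \<otimes> z [^] c') =
      P \<otimes> P' \<otimes> Q \<otimes> (z [^] ?m \<otimes> Q') \<otimes> (z [^] c \<otimes> z [^] c')"
    using car gens by (simp add: m_assoc)
  also have "z [^] ?m \<otimes> Q' = Q' \<otimes> z [^] ?m" using car by (intro zp_central)
  also have "P \<otimes> P' \<otimes> Q \<otimes> (Q' \<otimes> z [^] ?m) \<otimes> (z [^] c \<otimes> z [^] c') =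
      (P \<otimes> P') \<otimes> (Q \<otimes> Q') \<otimes> (z [^] ?m \<otimes> (z [^] c \<otimes> z [^] c'))"
    using car gens by (simp add: m_assoc)
  also have "P \<otimes> P' = u [^] (k + k') \<otimes> v [^] (l + l')"
    unfolding P_def P'_def by (rule two_pow_mult[OF gens(3,4) uv])
  also have "Q \<otimes> Q' = x [^] (a + a') \<otimes> y [^] (b + b')"
    unfolding Q_def Q'_def by (rule two_pow_mult[OF gens(1,2) xy])
  also have "z [^] ?m \<otimes> (z [^] c \<otimes> z [^] c') = z [^] (c + c' + ?m)"
    using gens by (simp add: nat_pow_mult add.commute)
  finally show ?thesis by (simp add: nf_def P_def P'_def Q_def Q'_def)
qed

lemma nf_gens: "nf 0 0 1 0 0 = x" "nf 0 0 0 1 0 = y" "nf 1 0 0 0 0 = u" "nf 0 1 0 0 0 = v" "nf 0 0 0 0 1 = z"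
  "nf 0 0 0 0 0 = \<one>" "nf 0 0 0 0 c = z [^] c" "nf 0 0 a b 0 = x [^] a \<otimes> y [^] b"
  using gens by (simp_all add: nf_def)

lemma nf_z: "nf k l a b (c + d) = nf k l a b c \<otimes> z [^] d"
  using nf_mult[of k l a b c 0 0 0 0 d] by (simp add: nf_gens)

lemma pow_mod:
  assumes s: "s \<in> carrier G" and "s [^] p = z [^] (e::nat)"
  shows "s [^] (k::nat) = s [^] (k mod p) \<otimes> z [^] (e * (k div p))"
proof -
  have "s [^] k = s [^] (k mod p + p * (k div p))" by simp
  also have "\<dots> = s [^] (k mod p) \<otimes> (s [^] p) [^] (k div p)"
    using s by (simp only: nat_pow_mult nat_pow_pow)
  finally show ?thesis using gens by (simp add: assms(2) nat_pow_pow)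
qed

lemma pow_mod_1:
  assumes s: "s \<in> carrier G" and "s [^] p = \<one>"
  shows "s [^] (k::nat) = s [^] (k mod p)"
  using pow_mod[OF s, of 0 k] assms by simp

text \<open>Reducing the exponents of \<open>u\<close> and \<open>v\<close> spills powers of
  \<open>z\<close>, so the last exponent is only asserted to exist.\<close>

lemma nf_reduce: "\<exists>c'<p. nf k l a b c = nf (k mod p) (l mod p) (a mod p) (b mod p) c'"
proof -
  obtain e f :: nat where ef: "u [^] p = z [^] e" "v [^] p = z [^] f" using u_pow v_pow by blast
  have factors: "u [^] k = nf (k mod p) 0 0 0 (e * (k div p))" "v [^] l = nf 0 (l mod p) 0 0 (f * (l div p))"
    "x [^] a \<otimes> y [^] b = nf 0 0 (a mod p) (b mod p) 0" "z [^] c = nf 0 0 0 0 c"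
    using gens pow_mod[OF gens(3) ef(1), of k] pow_mod[OF gens(4) ef(2), of l]
      pow_mod_1[OF gens(1) pow_p(1), of a] pow_mod_1[OF gens(2) pow_p(2), of b] by (simp_all add: nf_def)
  define n where "n = e * (k div p) + f * (l div p) + c"
  have "nf k l a b c = nf (k mod p) (l mod p) (a mod p) (b mod p) n"
    unfolding nf_def[of k l a b c] factors by (simp add: nf_mult n_def)
  also have "\<dots> = nf (k mod p) (l mod p) (a mod p) (b mod p) (n mod p)"
    unfolding nf_def pow_mod_1[OF gens(5) pow_p(3), of n] ..
  finally show ?thesis using p_gt_1 by (intro exI conjI) auto
qed

lemma nf_surj:
  assumes "g \<in> carrier G"
  obtains k l a b c where "g = nf k l a b c" "k < p" "l < p" "a < p" "b < p" "c < p"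
proof -
  let ?S = "{g. \<exists>k l a b c. g = nf k l a b c}"
  have "subgroup ?S G"
  proof (rule finite_submonoid_subgroup[OF fin])
    show "\<one> \<in> ?S" using nf_gens(6)[symmetric] by blast
    show "g \<otimes> h \<in> ?S" if "g \<in> ?S" "h \<in> ?S" for g h using that nf_mult by (auto; blast)
  qed (auto simp: nf_carrier)
  moreover have "{x, y, u, v, z} \<subseteq> ?S" using nf_gens[symmetric] by blast
  ultimately have "g \<in> ?S" using generate_subgroup_incl gen assms by blast
  then obtain k l a b c where g: "g = nf k l a b c" by blast
  obtain c' where "c' < p" "nf k l a b c = nf (k mod p) (l mod p) (a mod p) (b mod p) c'" using nf_reduce by blast
  then show ?thesis using that[of "k mod p" "l mod p" "a mod p" "b mod p" c'] g p_gt_1 by simp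
qed

definition nf_map :: "nat \<times> nat \<times> nat \<times> nat \<times> nat \<Rightarrow> 'a" where
  "nf_map = (\<lambda>(k, l, a, b, c). nf k l a b c)"

definition box :: "(nat \<times> nat \<times> nat \<times> nat \<times> nat) set" where
  "box = {..<p} \<times> {..<p} \<times> {..<p} \<times> {..<p} \<times> {..<p}"

text \<open>The \<open>p ^ 5\<close> reduced normal forms cover a group of order
  \<open>p ^ 5\<close>, so they are distinct. Here the order of the group excludes any further
  relation.\<close>

lemma nf_inj: "inj_on nf_map box"
proof (rule eq_card_imp_inj_on)
  show "finite box" by (simp add: box_def)
  have "nf_map ` box = carrier G"
  proof
    show "nf_map ` box \<subseteq> carrier G" by (auto simp: nf_map_def nf_carrier)
    show "carrier G \<subseteq> nf_map ` box"
    proof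
      fix g assume "g \<in> carrier G"
      then obtain k l a b c where "g = nf k l a b c" "k < p" "l < p" "a < p" "b < p" "c < p" by (rule nf_surj)
      then show "g \<in> nf_map ` box"
        by (intro image_eqI[of _ _ "(k, l, a, b, c)"]) (auto simp: nf_map_def box_def)
    qed
  qed
  then show "card (nf_map ` box) = card box"
    using card_G by (simp add: box_def card_cartesian_product eval_nat_numeral)
qed

lemma nf_eqD:
  assumes "nf k l a b c = nf k' l' a' b' c'"
    and "k < p" "l < p" "a < p" "b < p" "c < p" "k' < p" "l' < p" "a' < p" "b' < p" "c' < p"
  shows "k = k' \<and> l = l' \<and> a = a' \<and> b = b' \<and> c = c'"
  using inj_onD[OF nf_inj, of "(k, l, a, b, c)" "(k', l', a', b', c')"] assms
  by (simp add: nf_map_def box_def)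

lemma z_pow_1: "n < p \<Longrightarrow> z [^] n = \<one> \<Longrightarrow> n = 0"
  using nf_eqD[of 0 0 0 0 n 0 0 0 0 0] p_gt_1 by (simp add: nf_gens)

lemma nf_z_cancel: "n < p \<Longrightarrow> nf k l a b (c + n) = nf k l a b c \<Longrightarrow> n = 0"
  using z_pow_1 nf_carrier gens by (simp add: nf_z)

text \<open>Multiplication by \<open>x\<close> on the left creates \<open>k\<close> factors
  \<open>z\<close>, on the right none; so commuting forces \<open>k = 0\<close>. The three analogues
  below test \<open>l\<close>, \<open>a\<close> and \<open>b\<close> with \<open>y\<close>,
  \<open>u\<close> and \<open>v\<close>.\<close>

lemma nf_commute_x:
  assumes "k < p" and comm: "x \<otimes> nf k l a b c = nf k l a b c \<otimes> x"
  shows "k = 0"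
proof -
  have "nf 0 0 1 0 0 \<otimes> nf k l a b c = nf k l (Suc a) b (c + k)" "nf k l a b c \<otimes> nf 0 0 1 0 0 = nf k l (Suc a) b c"
    by (simp_all add: nf_mult)
  with comm have "nf k l (Suc a) b (c + k) = nf k l (Suc a) b c" unfolding nf_gens(1) by simp
  then show ?thesis using nf_z_cancel assms(1) by blast
qed

lemma nf_commute_y:
  assumes "l < p" and comm: "y \<otimes> nf k l a b c = nf k l a b c \<otimes> y"
  shows "l = 0"
proof -
  have "nf 0 0 0 1 0 \<otimes> nf k l a b c = nf k l a (Suc b) (c + l)" "nf k l a b c \<otimes> nf 0 0 0 1 0 = nf k l a (Suc b) c"
    by (simp_all add: nf_mult)
  with comm have "nf k l a (Suc b) (c + l) = nf k l a (Suc b) c" unfolding nf_gens(2) by simp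
  then show ?thesis using nf_z_cancel assms(1) by blast
qed

lemma nf_commute_u:
  assumes "a < p" and comm: "u \<otimes> nf k l a b c = nf k l a b c \<otimes> u"
  shows "a = 0"
proof -
  have "nf 1 0 0 0 0 \<otimes> nf k l a b c = nf (Suc k) l a b c" "nf k l a b c \<otimes> nf 1 0 0 0 0 = nf (Suc k) l a b (c + a)"
    by (simp_all add: nf_mult)
  with comm have "nf (Suc k) l a b (c + a) = nf (Suc k) l a b c" unfolding nf_gens(3) by simp
  then show ?thesis using nf_z_cancel assms(1) by blast
qed

lemma nf_commute_v:
  assumes "b < p" and comm: "v \<otimes> nf k l a b c = nf k l a b c \<otimes> v"
  shows "b = 0"
proof -
  have "nf 0 1 0 0 0 \<otimes> nf k l a b c = nf k (Suc l) a b c" "nf k l a b c \<otimes> nf 0 1 0 0 0 = nf k (Suc l) a b (c + b)"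
    by (simp_all add: nf_mult)
  with comm have "nf k (Suc l) a b (c + b) = nf k (Suc l) a b c" unfolding nf_gens(4) by simp
  then show ?thesis using nf_z_cancel assms(1) by blast
qed

section \<open>Center, derived subgroup and the subgroups \<open>K\<close> and
  \<open>H\<close>\<close>

lemma center_eq: "center G = {z [^] c | c :: nat. c < p}"
proof
  show "{z [^] c | c :: nat. c < p} \<subseteq> center G" using zp_central gens by (auto simp: center_def)
  show "center G \<subseteq> {z [^] c | c :: nat. c < p}"
  proof
    fix g assume g: "g \<in> center G"
    then have "g \<in> carrier G" by (simp add: center_def)
    then obtain k l a b c where nf: "g = nf k l a b c" "k < p" "l < p" "a < p" "b < p" "c < p" by (rule nf_surj)
    have comm: "h \<otimes> nf k l a b c = nf k l a b c \<otimes> h" if "h \<in> carrier G" for h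
      using g that nf(1) unfolding center_def by auto
    have "k = 0" by (rule nf_commute_x[OF nf(2) comm[OF gens(1)]])
    moreover have "l = 0" by (rule nf_commute_y[OF nf(3) comm[OF gens(2)]])
    moreover have "a = 0" by (rule nf_commute_u[OF nf(4) comm[OF gens(3)]])
    moreover have "b = 0" by (rule nf_commute_v[OF nf(5) comm[OF gens(4)]])
    ultimately show "g \<in> {z [^] c | c :: nat. c < p}" using nf by (auto simp: nf_gens)
  qed
qed

lemma z_pow_center: "z [^] (n::nat) \<in> center G"
  using zp_central gens by (simp add: center_def)

lemma card_center: "card (center G) = p"
proof -
  have "inj_on (\<lambda>c. z [^] (c::nat)) {..<p}"
  proof (rule inj_onI)
    fix c d assume "c \<in> {..<p}" "d \<in> {..<p}" "z [^] c = z [^] d"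
    then show "c = d" using nf_eqD[of 0 0 0 0 c 0 0 0 0 d] p_gt_1 by (simp add: nf_gens)
  qed
  moreover have "center G = (\<lambda>c. z [^] (c::nat)) ` {..<p}" by (auto simp: center_eq)
  ultimately show ?thesis by (simp add: card_image)
qed

lemma commutator_center:
  assumes g: "g \<in> carrier G" and h: "h \<in> carrier G"
  shows "inv g \<otimes> inv h \<otimes> g \<otimes> h \<in> center G"
proof -
  obtain k l a b c where nf: "g = nf k l a b c" by (rule nf_surj[OF g])
  obtain k' l' a' b' c' where nf': "h = nf k' l' a' b' c'" by (rule nf_surj[OF h])
  let ?m = "a * k' + b * l'" and ?m' = "a' * k + b' * l"
  \<comment> \<open>The two products agree in their first four exponents and differ by powers of
    \<open>z\<close>. One power is put on each side because exponents are natural numbers.\<close>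
  have "(g \<otimes> h) \<otimes> z [^] ?m' = (h \<otimes> g) \<otimes> z [^] ?m"
    unfolding nf nf' nf_mult nf_z[symmetric] by (simp add: add_ac)
  then have "inv (h \<otimes> g) \<otimes> ((g \<otimes> h) \<otimes> z [^] ?m') \<otimes> inv (z [^] ?m') = inv (h \<otimes> g) \<otimes> ((h \<otimes> g) \<otimes> z [^] ?m) \<otimes> inv (z [^] ?m')"
    by simp
  moreover have "inv (h \<otimes> g) \<otimes> ((h \<otimes> g) \<otimes> z [^] ?m) = z [^] ?m"
    using g h gens by (metis inv_closed l_inv l_one m_assoc m_closed nat_pow_closed)
  moreover have "inv (h \<otimes> g) \<otimes> ((g \<otimes> h) \<otimes> z [^] ?m') \<otimes> inv (z [^] ?m') = inv (h \<otimes> g) \<otimes> (g \<otimes> h)"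
    using g h gens by (simp add: m_assoc)
  moreover have "inv (h \<otimes> g) \<otimes> (g \<otimes> h) = inv g \<otimes> inv h \<otimes> g \<otimes> h"
    using g h by (simp add: inv_mult_group m_assoc)
  ultimately have eq: "inv g \<otimes> inv h \<otimes> g \<otimes> h = z [^] ?m \<otimes> inv (z [^] ?m')" by simp
  \<comment> \<open>The exponent is a natural number congruent to minus \<open>?m'\<close> modulo
    \<open>p\<close>.\<close>
  have "inv (z [^] ?m') = z [^] (p * ?m' - ?m')"
  proof -
    have "z [^] (p * ?m' - ?m') \<otimes> z [^] ?m' = z [^] (p * ?m')"
      using gens p_gt_1 by (simp add: nat_pow_mult)
    also have "\<dots> = \<one>" using gens pow_p by (simp flip: nat_pow_pow)
    finally show ?thesis using gens by (simp add: inv_equality)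
  qed
  then show ?thesis using gens z_pow_center by (simp add: eq nat_pow_mult)
qed

definition K :: "'a set" where "K = {nf 0 0 a b 0 | a b. True}"
text \<open>Given by generators to match the subgroup in the theorem; \<open>H_eq\<close> describes
  it by exponents.\<close>

definition H :: "'a set" where "H = generate G {x, y, z}"

lemma H_eq: "H = {nf 0 0 a b c | a b c. True}"
proof
  have "subgroup {nf 0 0 a b c | a b c. True} G"
  proof (rule finite_submonoid_subgroup[OF fin])
    show "\<one> \<in> {nf 0 0 a b c | a b c. True}" using nf_gens(6)[symmetric] by blast
    show "g \<otimes> h \<in> {nf 0 0 a b c | a b c. True}"
      if "g \<in> {nf 0 0 a b c | a b c. True}" "h \<in> {nf 0 0 a b c | a b c. True}" for g h
      using that by (auto simp: nf_mult) blast+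
  qed (auto simp: nf_carrier)
  moreover have "{x, y, z} \<subseteq> {nf 0 0 a b c | a b c. True}" using nf_gens[symmetric] by blast
  ultimately show "H \<subseteq> {nf 0 0 a b c | a b c. True}" unfolding H_def by (intro generate_subgroup_incl)
  have sub: "subgroup H G" unfolding H_def using gens by (intro generate_is_subgroup) auto
  have mem: "x \<in> H" "y \<in> H" "z \<in> H" unfolding H_def by (auto intro: generate.incl)
  have pow: "s [^] n \<in> H" if "s \<in> H" for s and n :: nat
    by (induction n) (use that sub in \<open>auto simp: subgroup.one_closed subgroup.m_closed\<close>)
  show "{nf 0 0 a b c | a b c. True} \<subseteq> H"
    using pow mem sub gens by (auto simp: nf_def intro!: subgroup.m_closed[OF sub])
qed

lemma K_subgroup: "subgroup K G"
proof (rule finite_submonoid_subgroup[OF fin])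
  show "\<one> \<in> K" using nf_gens(6)[symmetric] unfolding K_def by blast
  show "g \<otimes> h \<in> K" if "g \<in> K" "h \<in> K" for g h
    using that by (auto simp: K_def nf_mult) blast+
qed (auto simp: K_def nf_carrier)

lemma gens_K: "x \<in> K" "y \<in> K"
  using nf_gens(1,2)[symmetric] unfolding K_def by blast+

lemma derived_eq: "commutator_subgroup G = center G"
proof
  have "subgroup (center G) G"
  proof (rule finite_submonoid_subgroup[OF fin])
    show "a \<otimes> b \<in> center G" if "a \<in> center G" "b \<in> center G" for a b
      using that gens z_pow_center by (auto simp: center_eq nat_pow_mult)
  qed (use z_pow_center[of 0] in \<open>auto simp: center_def\<close>)
  moreover have "g \<otimes> h \<otimes> inv g \<otimes> inv h \<in> center G" if "g \<in> carrier G" "h \<in> carrier G" for g h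
    using commutator_center[of "inv g" "inv h"] that by simp
  ultimately show "commutator_subgroup G \<subseteq> center G"
    unfolding derived_def by (intro generate_subgroup_incl) auto
  \<comment> \<open>\<open>derived\<close> is generated by products of the form
    \<open>g \<otimes> h \<otimes> inv g \<otimes> inv h\<close>, whereas \<open>z\<close> is the
    commutator of \<open>x\<close> and \<open>u\<close> in the other convention; inverting both
    arguments converts one into the other.\<close>
  have "z = inv x \<otimes> inv u \<otimes> inv (inv x) \<otimes> inv (inv u)"
  proof -
    have "inv x \<otimes> inv u \<otimes> (x \<otimes> u) = inv (u \<otimes> x) \<otimes> (u \<otimes> x \<otimes> z)"
      unfolding xu using gens by (simp add: inv_mult_group)
    also have "\<dots> = z" using gens by (metis inv_closed l_inv l_one m_assoc m_closed)
    finally show ?thesis using gens by (simp add: m_assoc)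
  qed
  moreover have "inv x \<otimes> inv u \<otimes> inv (inv x) \<otimes> inv (inv u) \<in> commutator_subgroup G"
    unfolding derived_def using gens by (intro generate.incl UN_I[of "inv x"] UN_I[of "inv u"] singletonI) auto
  ultimately have "z \<in> commutator_subgroup G" by simp
  moreover have sub: "subgroup (commutator_subgroup G) G" by (simp add: derived_is_subgroup)
  ultimately have "z [^] n \<in> commutator_subgroup G" for n :: nat
    by (induction n) (auto simp: subgroup.one_closed subgroup.m_closed)
  then show "center G \<subseteq> commutator_subgroup G" by (auto simp: center_eq)
qed

lemma card_H: "card H = p ^ 3"
proof -
  let ?B = "{0} \<times> {0} \<times> {..<p} \<times> {..<p} \<times> {..<p}"
  have "H = nf_map ` ?B"
  proof
    show "nf_map ` ?B \<subseteq> H" by (auto simp: nf_map_def H_eq)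
    show "H \<subseteq> nf_map ` ?B"
    proof
      fix h assume "h \<in> H"
      then obtain a b c where h: "h = nf 0 0 a b c" by (auto simp: H_eq)
      obtain c' where "c' < p" "nf 0 0 a b c = nf (0 mod p) (0 mod p) (a mod p) (b mod p) c'" using nf_reduce by blast
      then show "h \<in> nf_map ` ?B" using h p_gt_1
        by (intro image_eqI[of _ _ "(0, 0, a mod p, b mod p, c')"]) (auto simp: nf_map_def)
    qed
  qed
  moreover have "inj_on nf_map ?B"
    by (rule inj_on_subset[OF nf_inj]) (use p_gt_1 in \<open>auto simp: box_def\<close>)
  ultimately show ?thesis by (simp add: card_image card_cartesian_product eval_nat_numeral)
qed

sublocale extraspecial_p5 G p K H z
proof (intro extraspecial_p5.intro polarized.intro polarized_axioms.intro extraspecial_p5_axioms.intro is_group)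
  show "subgroup K G" by (rule K_subgroup)
  show "subgroup H G" unfolding H_def using gens by (intro generate_is_subgroup) auto
  show "K \<subseteq> H" unfolding K_def H_eq by blast
  show "center G \<subseteq> H" unfolding H_eq center_eq by (auto simp flip: nf_gens(7))
  show "g \<otimes> h = h \<otimes> g" if "g \<in> H" "h \<in> H" for g h
    using that by (auto simp: H_eq nf_mult add.commute)
  \<comment> \<open>Commuting with \<open>x\<close> kills the exponent of \<open>u\<close>, and
    commuting with \<open>y\<close> that of \<open>v\<close>.\<close>
  show "g \<in> H" if g: "g \<in> carrier G" and comm: "\<And>k. k \<in> K \<Longrightarrow> k \<otimes> g = g \<otimes> k" for g
  proof -
    obtain k l a b c where nf: "g = nf k l a b c" "k < p" "l < p" by (rule nf_surj[OF g])
    have comm': "x \<otimes> nf k l a b c = nf k l a b c \<otimes> x" "y \<otimes> nf k l a b c = nf k l a b c \<otimes> y"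
      using comm[OF gens_K(1)] comm[OF gens_K(2)] unfolding nf(1) by auto
    have "k = 0" by (rule nf_commute_x[OF nf(2) comm'(1)])
    moreover have "l = 0" by (rule nf_commute_y[OF nf(3) comm'(2)])
    ultimately show ?thesis using nf by (auto simp: H_eq)
  qed
  show "z \<in> center G" using z_pow_center[of 1] gens by simp
  show "z \<noteq> \<one>" using z_pow_1[of 1] p_gt_1 gens by auto
  show "\<exists>k\<in>K. \<exists>c\<in>center G. h = k \<otimes> c" if h: "h \<in> H" for h
  proof -
    obtain a b c where "h = nf 0 0 a b c" using h by (auto simp: H_eq)
    then have "h = nf 0 0 a b 0 \<otimes> z [^] c" using nf_z[of 0 0 a b 0 c] by simp
    then show ?thesis using z_pow_center by (auto simp: K_def)
  qed
  show "K \<inter> center G = {\<one>}"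
  proof
    show "K \<inter> center G \<subseteq> {\<one>}"
    proof
      fix g assume g: "g \<in> K \<inter> center G"
      then obtain a b where ab: "g = nf 0 0 a b 0" by (auto simp: K_def)
      obtain c where c: "g = nf 0 0 0 0 c" "c < p" using g by (auto simp: center_eq nf_gens)
      have "nf 0 0 a b 0 = nf 0 0 (a mod p) (b mod p) 0"
        unfolding nf_def using pow_mod_1[OF gens(1) pow_p(1), of a] pow_mod_1[OF gens(2) pow_p(2), of b] by simp
      then have "c = 0" using ab c nf_eqD[of 0 0 "a mod p" "b mod p" 0 0 0 0 0 c] p_gt_1 by simp
      then show "g \<in> {\<one>}" using c by (simp add: nf_gens)
    qed
    have "\<one> \<in> K" using K_subgroup by (rule subgroup.one_closed)
    then show "{\<one>} \<subseteq> K \<inter> center G" using z_pow_center[of 0] by simp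
  qed
qed (use p fin card_center commutator_center derived_eq card_H card_G in auto)

lemma is_psi_iff: "is_psi \<mu> \<psi> \<longleftrightarrow> \<psi> \<in> lin (subgrp G H) \<and> \<psi> z = \<mu> z \<and> \<psi> x = 1 \<and> \<psi> y = 1"
proof -
  have "\<psi> k = 1" if \<psi>: "\<psi> \<in> lin (subgrp G H)" and xy: "\<psi> x = 1" "\<psi> y = 1" and k: "k \<in> K" for k
  proof -
    note D = \<psi>[unfolded lin_iff[OF groups(2)], simplified]
    have memH: "x \<in> H" "y \<in> H" using gens_K KH by auto
    have pow: "s [^] n \<in> H \<and> \<psi> (s [^] n) = 1" if "s \<in> H" "\<psi> s = 1" for s and n :: nat
      using that D subgroup.m_closed[OF H] subgroup.one_closed[OF H] by (induction n) auto
    obtain a b where "k = nf 0 0 a b 0" using k by (auto simp: K_def)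
    then have "k = x [^] a \<otimes> y [^] b" by (simp only: nf_gens)
    then show ?thesis using pow[OF memH(1) xy(1), of a] pow[OF memH(2) xy(2), of b] D by simp
  qed
  then show ?thesis using gens_K by (auto simp: is_psi_def)
qed

end

text \<open>The last claim of the theorem has to exhibit some \<open>\<mu>\<close>, so the set of
  these characters must be nonempty.\<close>

lemma (in phi5_gens) nontrivial_center_character:
  "\<exists>\<mu>. \<mu> \<in> lin (subgrp G Z) \<and> \<mu> z \<noteq> 1"
proof -
  have "card {w :: complex. w ^ p = 1} = p" using p_gt_1 by (intro card_roots_unity_eq) simp
  then have "{w :: complex. w ^ p = 1} \<noteq> {1}" using p_gt_1 by auto
  moreover have "1 \<in> {w :: complex. w ^ p = 1}" by simp
  ultimately obtain w :: complex where w: "w ^ p = 1" "w \<noteq> 1" by blast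
  interpret w: prime_root_of_unity p w using p w by unfold_locales
  \<comment> \<open>The discrete logarithm to the base \<open>z\<close>, well defined by uniqueness
    of normal forms.\<close>
  define e where "e g = (THE c :: nat. c < p \<and> g = z [^] c)" for g
  have e: "e (z [^] n) = n mod p" for n :: nat
  proof -
    have "z [^] n = z [^] (n mod p)" by (rule pow_mod_1[OF gens(5) pow_p(3)])
    moreover have "c = n mod p" if "c < p" "z [^] n = z [^] c" for c
      using nf_eqD[of 0 0 0 0 c 0 0 0 0 "n mod p"] that calculation p_gt_1 by (simp add: nf_gens)
    ultimately show ?thesis unfolding e_def using p_gt_1 by (intro the_equality) auto
  qed
  define \<mu> where "\<mu> g = (if g \<in> Z then w ^ e g else 0)" for g
  have \<mu>: "\<mu> (z [^] n) = w ^ n" for n :: nat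
    using z_pow_center by (simp add: \<mu>_def e w.power_mod)
  have "\<mu> \<in> lin (subgrp G Z)"
    unfolding lin_iff[OF groups(1)]
  proof (intro conjI ballI allI impI)
    fix g h assume "g \<in> carrier (subgrp G Z)" "h \<in> carrier (subgrp G Z)"
    then obtain c d :: nat where "g = z [^] c" "h = z [^] d" by (auto simp: center_eq)
    then show "\<mu> (g \<otimes>\<^bsub>subgrp G Z\<^esub> h) = \<mu> g * \<mu> h"
      using gens by (simp add: nat_pow_mult \<mu> power_add)
  qed (use \<mu>[of 0] in \<open>auto simp: \<mu>_def\<close>)
  moreover have "\<mu> z \<noteq> 1" using \<mu>[of 1] gens w by simp
  ultimately show ?thesis by blast
qed

section \<open>From the two presentations to \<open>phi5_gens\<close>\<close>

lemma (in group) commutator_eqD: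
  assumes "a \<in> carrier G" "b \<in> carrier G" "commutator G a b = c"
  shows "a \<otimes> b = b \<otimes> a \<otimes> c"
proof -
  have "b \<otimes> a \<otimes> commutator G a b = b \<otimes> (a \<otimes> inv a) \<otimes> inv b \<otimes> a \<otimes> b"
    using assms(1,2) by (simp only: commutator_def m_assoc m_closed inv_closed)
  also have "\<dots> = a \<otimes> b" using assms(1,2) by simp
  finally show ?thesis using assms(3) by simp
qed

lemma (in group) commutator_oneD:
  "a \<in> carrier G \<Longrightarrow> b \<in> carrier G \<Longrightarrow> commutator G a b = \<one> \<Longrightarrow> a \<otimes> b = b \<otimes> a"
  using commutator_eqD[of a b \<one>] by simp

lemma (in group) inv_commute:
  assumes "a \<in> carrier G" "s \<in> carrier G" "a \<otimes> s = s \<otimes> a"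
  shows "inv a \<otimes> s = s \<otimes> inv a"
  using assms by (metis inv_closed inv_solve_left inv_solve_right m_assoc m_closed)

lemma phi5_relations:
  fixes G :: "('a, 'b) monoid_scheme" (structure)
  assumes "group G" and car: "a1 \<in> carrier G" "a2 \<in> carrier G" "a3 \<in> carrier G" "a4 \<in> carrier G" "b \<in> carrier G"
    and rel: "phi5_commutator_relations G a1 a2 a3 a4 b"
  shows "a1 \<otimes> a2 = a2 \<otimes> a1 \<otimes> b" "a3 \<otimes> a4 = a4 \<otimes> a3 \<otimes> b"
    and "b \<otimes> a1 = a1 \<otimes> b" "b \<otimes> a2 = a2 \<otimes> b" "b \<otimes> a3 = a3 \<otimes> b" "b \<otimes> a4 = a4 \<otimes> b"
    and "a1 \<otimes> a3 = a3 \<otimes> a1" "a1 \<otimes> a4 = a4 \<otimes> a1" "a2 \<otimes> a3 = a3 \<otimes> a2" "a2 \<otimes> a4 = a4 \<otimes> a2"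
proof -
  interpret group G by fact
  note r = rel[unfolded phi5_commutator_relations_def]
  show "a1 \<otimes> a2 = a2 \<otimes> a1 \<otimes> b" "a3 \<otimes> a4 = a4 \<otimes> a3 \<otimes> b"
    using r car commutator_eqD by blast+
  show "b \<otimes> a1 = a1 \<otimes> b" "b \<otimes> a2 = a2 \<otimes> b" "b \<otimes> a3 = a3 \<otimes> b" "b \<otimes> a4 = a4 \<otimes> b"
    using r car commutator_oneD by metis+
  show "a1 \<otimes> a3 = a3 \<otimes> a1" "a1 \<otimes> a4 = a4 \<otimes> a1" "a2 \<otimes> a3 = a3 \<otimes> a2" "a2 \<otimes> a4 = a4 \<otimes> a2"
    using r car commutator_oneD by blast+
qed

text \<open>Inverting \<open>\<alpha>\<^sub>1\<close> gives \<open>[\<alpha>\<^sub>2, \<alpha>\<^sub>1\<inverse>] = \<beta>\<close>, the sign required by \<open>phi5_gens\<close>.\<close>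

lemma phi5_gens_2111:
  fixes G :: "('a, 'b) monoid_scheme" (structure)
  assumes "Factorial_Ring.prime p" and "Phi5_2111 p G a1 a2 a3 a4 b"
  shows "phi5_gens G p a2 a3 (inv\<^bsub>G\<^esub> a1) a4 b"
proof -
  interpret group G using assms by (simp add: Phi5_2111_def)
  have car: "a1 \<in> carrier G" "a2 \<in> carrier G" "a3 \<in> carrier G" "a4 \<in> carrier G" "b \<in> carrier G"
    and gen: "generate G {a1, a2, a3, a4, b} = carrier G"
    and rel: "phi5_commutator_relations G a1 a2 a3 a4 b"
    and pow: "a1 [^] p = b" "a2 [^] p = \<one>" "a3 [^] p = \<one>" "a4 [^] p = \<one>" "b [^] p = \<one>"
    and ord: "card (carrier G) = p ^ 5"
    using assms(2) by (auto simp: Phi5_2111_def Coset.order_def)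
  note r = phi5_relations[OF is_group car rel]
  show ?thesis
  proof (intro phi5_gens.intro phi5_gens_axioms.intro is_group)
    show "generate G {a2, a3, inv a1, a4, b} = carrier G"
    proof
      show "generate G {a2, a3, inv a1, a4, b} \<subseteq> carrier G" using car by (intro generate_incl) auto
      have sub: "subgroup (generate G {a2, a3, inv a1, a4, b}) G" using car by (intro generate_is_subgroup) auto
      have mem: "{a2, a3, inv a1, a4, b} \<subseteq> generate G {a2, a3, inv a1, a4, b}" by (auto intro: generate.incl)
      have "inv (inv a1) \<in> generate G {a2, a3, inv a1, a4, b}"
        by (rule subgroup.m_inv_closed[OF sub]) (use mem in auto)
      then show "carrier G \<subseteq> generate G {a2, a3, inv a1, a4, b}"
        unfolding gen[symmetric] using mem car by (intro generate_subgroup_incl sub) auto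
    qed
    show "b \<otimes> inv a1 = inv a1 \<otimes> b" using inv_commute[of a1 b] car r by simp
    show "a3 \<otimes> inv a1 = inv a1 \<otimes> a3" using inv_commute[of a1 a3] car r by simp
    show "inv a1 \<otimes> a4 = a4 \<otimes> inv a1" using inv_commute[of a1 a4] car r by simp
    \<comment> \<open>The relation between \<open>a1\<close> and \<open>a2\<close> is multiplied by
      \<open>inv a1\<close> on both sides.\<close>
    have "inv a1 \<otimes> (a1 \<otimes> a2) \<otimes> inv a1 = inv a1 \<otimes> (a2 \<otimes> (a1 \<otimes> b)) \<otimes> inv a1"
      using r(1) car by (simp add: m_assoc)
    also have "\<dots> = inv a1 \<otimes> (a2 \<otimes> (b \<otimes> a1)) \<otimes> inv a1" by (simp only: r(3))
    also have "\<dots> = inv a1 \<otimes> a2 \<otimes> b \<otimes> (a1 \<otimes> inv a1)" using car by (simp only: m_assoc m_closed inv_closed)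
    finally show "a2 \<otimes> inv a1 = inv a1 \<otimes> a2 \<otimes> b" using car by (simp flip: m_assoc)
    \<comment> \<open>\<open>phi5_gens\<close> asks for a natural exponent, so the inverse of
      \<open>b\<close> is written as a power with exponent \<open>p - 1\<close>.\<close>
    have "inv a1 [^] p = inv b" using car pow by (simp add: nat_pow_inv)
    also have "\<dots> = b [^] (p - 1)"
    proof (rule inv_equality)
      have "p = Suc (p - 1)" using prime_gt_0_nat[OF assms(1)] by simp
      then show "b [^] (p - 1) \<otimes> b = \<one>" using pow(5) by (metis nat_pow_Suc)
    qed (use car in auto)
    finally show "\<exists>e::nat. inv a1 [^] p = b [^] e" by blast
    show "\<exists>e::nat. a4 [^] p = b [^] e" using pow by (intro exI[of _ 0]) simp
  qed (use assms(1) car pow ord r in auto)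
qed

text \<open>Here the signs fit as they stand: \<open>a1\<close> is paired with \<open>a2\<close> and
  \<open>a3\<close> with \<open>a4\<close>, so \<open>a1\<close> and \<open>a3\<close> take the
  roles of \<open>x\<close> and \<open>y\<close>.\<close>

lemma phi5_gens_11111:
  fixes G :: "('a, 'b) monoid_scheme" (structure)
  assumes "Factorial_Ring.prime p" and "Phi5_11111 p G a1 a2 a3 a4 b"
  shows "phi5_gens G p a1 a3 a2 a4 b"
proof -
  interpret group G using assms by (simp add: Phi5_11111_def)
  have car: "a1 \<in> carrier G" "a2 \<in> carrier G" "a3 \<in> carrier G" "a4 \<in> carrier G" "b \<in> carrier G"
    and gen: "generate G {a1, a2, a3, a4, b} = carrier G"
    and rel: "phi5_commutator_relations G a1 a2 a3 a4 b"
    and pow: "a1 [^] p = \<one>" "a2 [^] p = \<one>" "a3 [^] p = \<one>" "a4 [^] p = \<one>" "b [^] p = \<one>"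
    and ord: "card (carrier G) = p ^ 5"
    using assms(2) by (auto simp: Phi5_11111_def Coset.order_def)
  note r = phi5_relations[OF is_group car rel]
  show ?thesis
  proof (intro phi5_gens.intro phi5_gens_axioms.intro is_group)
    show "generate G {a1, a3, a2, a4, b} = carrier G" using gen by (simp add: insert_commute)
    show "\<exists>e::nat. a2 [^] p = b [^] e" "\<exists>e::nat. a4 [^] p = b [^] e" using pow by (auto intro!: exI[of _ 0])
  qed (use assms(1) car pow ord r in auto)
qed

theorem theorem8:
  fixes p :: nat and G :: "('a, 'b) monoid_scheme"
    and a1 a2 a3 a4 b z :: 'a and H :: "'a set"
    and M :: "('a \<Rightarrow> complex) set"
    and is_psi :: "('a \<Rightarrow> complex) \<Rightarrow> ('a \<Rightarrow> complex) \<Rightarrow> bool"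
  assumes "Factorial_Ring.prime p" and "odd p"
    and "M = Irr_over (subgrp G (center G)) (commutator_subgroup G)"
    and "(Phi5_2111 p G a1 a2 a3 a4 b \<and>
          z = a1 [^]\<^bsub>G\<^esub> p \<and>
          H = generate G {a1 [^]\<^bsub>G\<^esub> p, a2, a3} \<and>
          is_psi = (\<lambda>\<mu> \<psi>. \<psi> \<in> lin (subgrp G H) \<and>
                     \<psi> (a1 [^]\<^bsub>G\<^esub> p) = \<mu> (a1 [^]\<^bsub>G\<^esub> p) \<and> \<psi> a2 = 1 \<and> \<psi> a3 = 1)) \<or>
         (Phi5_11111 p G a1 a2 a3 a4 b \<and>
          z = b \<and>
          H = generate G {a1, a3, b} \<and>
          is_psi = (\<lambda>\<mu> \<psi>. \<psi> \<in> lin (subgrp G H) \<and>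
                     \<psi> a1 = 1 \<and> \<psi> a3 = 1 \<and> \<psi> b = \<mu> b))"
  shows
    "center G = commutator_subgroup G \<and> commutator_subgroup G = generate G {z} \<and>
     nl G = chi_of p G ` M \<and>
     (\<forall>\<mu> \<in> M. (\<exists>!\<psi>. is_psi \<mu> \<psi>) \<and>
        (\<forall>\<psi>. is_psi \<mu> \<psi> \<longrightarrow>
           required_pair G (chi_of p G \<mu>) H \<psi> \<and>
           (\<exists>n \<Psi>. irr_rat_rep_affording (subgrp G H) n \<Psi> (Omega (subgrp G H) \<psi>)) \<and>
           (\<forall>n \<Psi> ts.
              irr_rat_rep_affording (subgrp G H) n \<Psi> (Omega (subgrp G H) \<psi>) \<and>
              left_transversal G H ts \<longrightarrow>
              irreducible_rep G (length ts * n) (induced_rep G H ts n \<Psi>) \<and>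
              \<not> commutator_subgroup G \<subseteq>
                  rep_kernel G (length ts * n) (induced_rep G H ts n \<Psi>)))) \<and>
     (\<forall>N (\<rho> :: 'a \<Rightarrow> rat mat).
        irreducible_rep G N \<rho> \<and> \<not> commutator_subgroup G \<subseteq> rep_kernel G N \<rho> \<longrightarrow>
        (\<exists>\<mu> \<in> M. \<forall>\<psi> n \<Psi> ts.
           is_psi \<mu> \<psi> \<and>
           irr_rat_rep_affording (subgrp G H) n \<Psi> (Omega (subgrp G H) \<psi>) \<and>
           left_transversal G H ts \<longrightarrow>
           equivalent_reps G \<rho> (induced_rep G H ts n \<Psi>)))"
proof -
  \<comment> \<open>Both alternatives become one configuration; only the roles of the generators
    differ.\<close>
  have "\<exists>x y u v. phi5_gens G p x y u v z \<and> H = generate G {x, y, z} \<and>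
      is_psi = (\<lambda>\<mu> \<psi>. \<psi> \<in> lin (subgrp G H) \<and> \<psi> z = \<mu> z \<and> \<psi> x = 1 \<and> \<psi> y = 1)"
    using assms(4)
  proof (elim disjE conjE)
    assume P: "Phi5_2111 p G a1 a2 a3 a4 b" and z: "z = a1 [^]\<^bsub>G\<^esub> p"
      and H: "H = generate G {a1 [^]\<^bsub>G\<^esub> p, a2, a3}"
      and is_psi: "is_psi = (\<lambda>\<mu> \<psi>. \<psi> \<in> lin (subgrp G H) \<and>
                     \<psi> (a1 [^]\<^bsub>G\<^esub> p) = \<mu> (a1 [^]\<^bsub>G\<^esub> p) \<and> \<psi> a2 = 1 \<and> \<psi> a3 = 1)"
    have "a1 [^]\<^bsub>G\<^esub> p = b" using P by (simp add: Phi5_2111_def)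
    then show ?thesis
      using phi5_gens_2111[OF assms(1) P] unfolding is_psi H z
      by (intro exI[of _ a2] exI[of _ a3] exI[of _ "inv\<^bsub>G\<^esub> a1"] exI[of _ a4]) (simp add: insert_commute)
  next
    assume P: "Phi5_11111 p G a1 a2 a3 a4 b" and z: "z = b" and H: "H = generate G {a1, a3, b}"
      and is_psi: "is_psi = (\<lambda>\<mu> \<psi>. \<psi> \<in> lin (subgrp G H) \<and> \<psi> a1 = 1 \<and> \<psi> a3 = 1 \<and> \<psi> b = \<mu> b)"
    show ?thesis
      using phi5_gens_11111[OF assms(1) P] unfolding is_psi H z
      by (intro exI[of _ a1] exI[of _ a3] exI[of _ a2] exI[of _ a4]) (auto simp: fun_eq_iff)
  qed
  then obtain x y u v where L: "phi5_gens G p x y u v z" and H: "H = generate G {x, y, z}"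
    and is_psi: "is_psi = (\<lambda>\<mu> \<psi>. \<psi> \<in> lin (subgrp G H) \<and> \<psi> z = \<mu> z \<and> \<psi> x = 1 \<and> \<psi> y = 1)"
    by blast
  interpret L: phi5_gens G p x y u v z by (rule L)
  have HL: "H = L.H" unfolding H L.H_def ..
  have psi: "is_psi = L.is_psi" unfolding is_psi HL by (intro ext) (simp add: L.is_psi_iff)
  note M = assms(3)
  show ?thesis
    unfolding psi HL
  proof (intro conjI ballI allI impI)
    show "center G = commutator_subgroup G" using L.derived by simp
    show "commutator_subgroup G = generate G {z}" unfolding L.derived by (rule L.Z_generate)
    show "nl G = chi_of p G ` M" unfolding M by (rule L.nl_eq)
  next
    fix \<mu> assume "\<mu> \<in> M"
    then have \<mu>: "\<mu> \<in> lin (subgrp G (center G))" "\<mu> z \<noteq> 1" by (simp_all add: M L.M_iff)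
    show "\<exists>!\<psi>. L.is_psi \<mu> \<psi>" using \<mu>(1) by (rule L.ex1_psi)
    fix \<psi> assume \<psi>: "L.is_psi \<mu> \<psi>"
    show "required_pair G (chi_of p G \<mu>) L.H \<psi>" using \<mu> \<psi> by (rule L.required_pair_psi)
    show "\<exists>n \<Psi>. irr_rat_rep_affording (subgrp G L.H) n \<Psi> (Omega (subgrp G L.H) \<psi>)"
      using \<mu> \<psi> by (rule L.rational_rep_psi)
    fix n \<Psi> ts
    assume "irr_rat_rep_affording (subgrp G L.H) n \<Psi> (Omega (subgrp G L.H) \<psi>) \<and> left_transversal G L.H ts"
    then have r: "irr_rat_rep_affording (subgrp G L.H) n \<Psi> (Omega (subgrp G L.H) \<psi>)" "left_transversal G L.H ts" by auto
    show "irreducible_rep G (length ts * n) (induced_rep G L.H ts n \<Psi>)" by (rule L.irr_ind_Psi[OF \<mu> \<psi> r])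
    show "\<not> commutator_subgroup G \<subseteq> rep_kernel G (length ts * n) (induced_rep G L.H ts n \<Psi>)"
      by (rule L.kernel_ind_Psi[OF \<mu> \<psi> r])
  next
    fix N and \<rho> :: "'a \<Rightarrow> rat mat"
    assume \<rho>: "irreducible_rep G N \<rho> \<and> \<not> commutator_subgroup G \<subseteq> rep_kernel G N \<rho>"
    \<comment> \<open>Every \<open>\<mu>\<close> in \<open>M\<close> would serve, since the induced
      rational representations are all equivalent; it remains to have one.\<close>
    obtain \<mu>0 where ne: "\<mu>0 \<in> lin (subgrp G (center G))" "\<mu>0 z \<noteq> 1"
      using L.nontrivial_center_character by blast
    have "\<mu>0 \<in> M" using ne by (simp add: M L.M_iff)
    then show "\<exists>\<mu> \<in> M. \<forall>\<psi> n \<Psi> ts. L.is_psi \<mu> \<psi> \<and>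
        irr_rat_rep_affording (subgrp G L.H) n \<Psi> (Omega (subgrp G L.H) \<psi>) \<and> left_transversal G L.H ts \<longrightarrow>
        equivalent_reps G \<rho> (induced_rep G L.H ts n \<Psi>)"
      using L.equivalent_ind_Psi[OF ne] \<rho> by blast
  qed
qed

end
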